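(* Let $K$ be an infinite field, $n\ge 2$ and $m\ge 1$ integers. If $X=(X_1,\dots,X_m)\in \mathrm{Mat}_{n,n}^m$ satisfies $X\notin\mathcal N(n,m)$ and $d\ge n-1$ is an integer, then there exists an $m$-tuple $T\in \mathrm{Mat}_{d,d}^m$ such that $f_T(X)\ne 0$. In particular, $\delta(n,m)\le n-1$ and $\gamma(n,m)\le n(n-1)$.
   Context: $\mathrm{Mat}_{p,q}$ is the space of $p\times q$ matrices over $K$. The group $G=\mathrm{SL}_n\times \mathrm{SL}_n$ acts on $V=\mathrm{Mat}_{n,n}^m$ by $(A,B)\cdot(X_1,\dots,X_m)=(AX_1B^{-1},\dots,AX_mB^{-1})$, and $R(n,m)=K[V]^G$ is the graded ring of invariant polynomial functions. The null cone $\mathcal N(n,m)\subseteq V$ is the zero set of all non-constant homogeneous invariants in $R(n,m)$. For $T=(T_1,\dots,T_m)\in\mathrm{Mat}_{d,d}^m$, the invariant $f_T\in R(n,m)$ (of degree $dn$) is $f_T(X_1,\dots,X_m)=\det(X_1\otimes T_1+\cdots+X_m\otimes T_m)$, where $\otimes$ is the Kronecker product. $\gamma(n,m)$ is the smallest positive integer $d$ such that the non-constant homogeneous invariants of degree $\le d$ have zero set equal to $\mathcal N(n,m)$. $\delta(n,m)$ is the smallest positive integer $k$ such that for every $X\notin\mathcal N(n,m)$ there exist an integer $d$ with $1\le d\le k$ and $T\in\mathrm{Mat}_{d,d}^m$ with $f_T(X)\ne0$. *)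

theory Defs
  imports
    "Jordan_Normal_Form.Determinant"
    "Jordan_Normal_Form.Gauss_Jordan_Elimination"
    "HOL-Library.Poly_Mapping"
begin

text \<open>The field \<open>K\<close> is the type \<open>'a :: field\<close>; an \<open>m\<close>-tuple of matrices is a list of length \<open>m\<close>,
  with entries indexed from \<open>0\<close>.\<close>

definition mat_tuples :: "nat \<Rightarrow> nat \<Rightarrow> 'a::field mat list set" where
  "mat_tuples n m = {X. length X = m \<and> set X \<subseteq> carrier_mat n n}"

definition SL :: "nat \<Rightarrow> 'a::field mat set" where
  "SL n = {A \<in> carrier_mat n n. det A = 1}"

definition lr_act :: "'a::field mat \<Rightarrow> 'a mat \<Rightarrow> 'a mat list \<Rightarrow> 'a mat list" where
  "lr_act A B X = map (\<lambda>M. A * M * the (mat_inverse B)) X"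

text \<open>Polynomials in the coordinates of the space of tuples. The variable \<open>(k, i, j)\<close> stands for
  the \<open>(i, j)\<close> entry of the \<open>k\<close>-th matrix; a monomial is its exponent vector.\<close>

type_synonym var = "nat \<times> nat \<times> nat"
type_synonym 'a coord_poly = "(var \<Rightarrow>\<^sub>0 nat) \<Rightarrow>\<^sub>0 'a"

definition coord :: "'a::field mat list \<Rightarrow> var \<Rightarrow> 'a" where
  "coord X = (\<lambda>(k, i, j). X ! k $$ (i, j))"

definition eval_coord_poly :: "'a::field coord_poly \<Rightarrow> 'a mat list \<Rightarrow> 'a" where
  "eval_coord_poly p X =
     (\<Sum>\<mu>\<in>Poly_Mapping.keys p. Poly_Mapping.lookup p \<mu> *
        (\<Prod>v\<in>Poly_Mapping.keys \<mu>. coord X v ^ Poly_Mapping.lookup \<mu> v))"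

definition coord_polys :: "nat \<Rightarrow> nat \<Rightarrow> 'a::field coord_poly set" where
  "coord_polys n m = {p. \<forall>\<mu>\<in>Poly_Mapping.keys p.
     Poly_Mapping.keys \<mu> \<subseteq> {..<m} \<times> {..<n} \<times> {..<n}}"

definition homogeneous_of_degree :: "nat \<Rightarrow> 'a::field coord_poly \<Rightarrow> bool" where
  "homogeneous_of_degree e p \<longleftrightarrow>
     (\<forall>\<mu>\<in>Poly_Mapping.keys p. (\<Sum>v\<in>Poly_Mapping.keys \<mu>. Poly_Mapping.lookup \<mu> v) = e)"

text \<open>Polynomial functions are functions of \<open>X\<close> whose values outside \<open>mat_tuples n m\<close> are
  irrelevant.\<close>

definition invariant_function :: "nat \<Rightarrow> nat \<Rightarrow> ('a::field mat list \<Rightarrow> 'a) \<Rightarrow> bool" where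
  "invariant_function n m f \<longleftrightarrow>
     (\<forall>A\<in>SL n. \<forall>B\<in>SL n. \<forall>X\<in>mat_tuples n m. f (lr_act A B X) = f X)"

text \<open>The degree \<open>e\<close> component of the graded ring \<open>R(n,m)\<close>. The zero function lies in every
  component. Its zero set is the whole space, so it does not affect the zero sets below, where the
  non-constant homogeneous invariants are represented by the components with \<open>e \<ge> 1\<close>.\<close>

definition invariants :: "nat \<Rightarrow> nat \<Rightarrow> nat \<Rightarrow> ('a::field mat list \<Rightarrow> 'a) set" where
  "invariants n m e =
     {f. invariant_function n m f \<and>
         (\<exists>p\<in>coord_polys n m. homogeneous_of_degree e p \<and>
            (\<forall>X\<in>mat_tuples n m. f X = eval_coord_poly p X))}"

definition null_cone :: "nat \<Rightarrow> nat \<Rightarrow> 'a::field mat list set" where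
  "null_cone n m = {X \<in> mat_tuples n m. \<forall>e\<ge>1. \<forall>f\<in>invariants n m e. f X = 0}"

definition kronecker :: "'a::field mat \<Rightarrow> 'a mat \<Rightarrow> 'a mat"  (infixl \<open>\<otimes>\<^sub>K\<close> 70) where
  "A \<otimes>\<^sub>K B = mat (dim_row A * dim_row B) (dim_col A * dim_col B)
     (\<lambda>(i, j). A $$ (i div dim_row B, j div dim_col B) * B $$ (i mod dim_row B, j mod dim_col B))"

text \<open>\<open>f_inv n d T X\<close> is \<open>f\<^sub>T(X)\<close> for \<open>X \<in> mat_tuples n m\<close> and \<open>T \<in> mat_tuples d m\<close>. The sizes are
  arguments because the zero matrix starting the sum needs them.\<close>

definition f_inv :: "nat \<Rightarrow> nat \<Rightarrow> 'a::field mat list \<Rightarrow> 'a mat list \<Rightarrow> 'a" where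
  "f_inv n d T X = det (foldr (+) (map2 (\<otimes>\<^sub>K) X T) (0\<^sub>m (n * d) (n * d)))"

text \<open>The type argument of \<open>\<gamma>\<close> and \<open>\<delta>\<close> is the field.\<close>

definition \<gamma> :: "'a::field itself \<Rightarrow> nat \<Rightarrow> nat \<Rightarrow> nat" where
  "\<gamma> _ n m = (LEAST d. d > 0 \<and>
     {X \<in> mat_tuples n m. \<forall>e. 1 \<le> e \<and> e \<le> d \<longrightarrow> (\<forall>f\<in>invariants n m e. f X = 0)}
       = (null_cone n m :: 'a mat list set))"

definition \<delta> :: "'a::field itself \<Rightarrow> nat \<Rightarrow> nat \<Rightarrow> nat" where
  "\<delta> _ n m = (LEAST k. k > 0 \<and>
     (\<forall>X \<in> mat_tuples n m - null_cone n m.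
        \<exists>d T. 1 \<le> d \<and> d \<le> k \<and> T \<in> mat_tuples d m \<and> f_inv n d T (X :: 'a mat list) \<noteq> 0))"

end

theory Submission
  imports Defs "HOL-Library.Nat_Bijection" "HOL-Computational_Algebra.Formal_Laurent_Series"
    "HOL-Computational_Algebra.Fraction_Field"
begin

text \<open>A one-parameter subgroup of \<open>SL\<^sub>n \<times> SL\<^sub>n\<close> contracts to zero every tuple \<open>X\<close> with a shrunk
  subspace, that is, a subspace \<open>U\<close> of \<open>K\<^sup>n\<close> with \<open>dim (\<Sum>\<^sub>k X\<^sub>k U) < dim U\<close>.  So a tuple outside the
  null cone has none.  Let \<open>r(d)\<close> be the maximal rank of \<open>\<Sum>\<^sub>k X\<^sub>k \<otimes> T\<^sub>k\<close> over all \<open>d \<times> d\<close> tuples \<open>T\<close>.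

  Over an extension field of \<open>K\<close> the full matrix ring of size \<open>d\<close> is spanned by a division ring, in
  which the maximal rank \<open>r(d)\<close> is attained; Gaussian elimination by blocks shows that \<open>d\<close> divides it.
  If the maximal value \<open>\<rho>\<close> of \<open>r(d) / d\<close> were smaller than \<open>n\<close>, then the second Wong sequence of an
  element of rank \<open>\<rho> d\<close> would yield either a shrunk subspace or a blow-up of some size \<open>d c\<close> and rank
  larger than \<open>\<rho> d c\<close>.  Hence \<open>r(d) = n d\<close> for some \<open>d\<close>, and then for all multiples of \<open>d\<close>.

  Finally \<open>r(d + 1) = n (d + 1)\<close> implies \<open>r(d) = n d\<close> for \<open>d \<ge> n - 1\<close>: delete a block row, and then
  one of the \<open>d + 1\<close> block columns such that the rank stays above \<open>(n - 1) d\<close>.\<close>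

section \<open>Column-finite matrices\<close>

text \<open>Elimination by blocks needs a division ring, and \<open>K\<close> itself may admit none
  of degree \<open>d\<close>. Fresh variables supply one for every \<open>d\<close>: a cyclic
  permutation of \<open>d\<close> variables is an automorphism of the field K(x_0, x_1, ...), and
  adjoining \<open>Z\<close> whose \<open>d\<close>-th power is a Laurent variable gives a cyclic
  division algebra. Infiniteness of \<open>K\<close> allows the return: a minor that is nonzero over
  the extension stays nonzero at suitable scalars of \<open>K\<close>.

  The constant n - 1 comes from a count. Among d + 1 block columns, n d basis columns leave some
  block with fewer than d of them if n d < d (d + 1), that is, if n \<le> d; this would stop the
  descent at size n. Reserving n basis columns for one block lowers the average in the other d
  blocks to n (d - 1) / d, which is below d also for n = d + 1. For d = n - 1 the reserved block
  stacks only n - 1 linear combinations of the X_k and must still have rank n; hence the separate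
  proof that some combination has rank at least two. Divisibility of the maximal rank by d then
  rounds (n - 1) d + 1 up to n d.\<close>

text \<open>In this ring matrices of all sizes are multiplied without side conditions: a \<open>p \<times> q\<close> matrix is an
  element \<open>A\<close> with \<open>pr p * A = A = A * pr q\<close>, where \<open>pr p\<close> is the projection on the first \<open>p\<close>
  coordinates.  The Kronecker product \<open>\<boxtimes>\<close> below is total as well; it indexes rows and columns by a
  pairing function on the natural numbers instead of \<open>div\<close> and \<open>mod\<close>.\<close>

typedef (overloaded) 'a cfm = "{A :: nat \<Rightarrow> nat \<Rightarrow> 'a::zero. \<forall>j. finite {i. A i j \<noteq> 0}}"
  morphisms ent Cfm
  by (rule exI[of _ "\<lambda>_ _. 0"]) simp

setup_lifting type_definition_cfm

lemma finite_ent: "finite {i. ent A i j \<noteq> 0}"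
  using ent[of A] by blast

lemma cfm_eqI: "(\<And>i j. ent A i j = ent B i j) \<Longrightarrow> A = B"
  by (metis ent_inject ext)

instantiation cfm :: (field) ring_1
begin

lift_definition zero_cfm :: "'a cfm" is "\<lambda>_ _. 0" by simp
lift_definition one_cfm :: "'a cfm" is "\<lambda>i j. if i = j then 1 else 0" by simp
lift_definition plus_cfm :: "'a cfm \<Rightarrow> 'a cfm \<Rightarrow> 'a cfm" is "\<lambda>A B i j. A i j + B i j"
proof -
  fix A B :: "nat \<Rightarrow> nat \<Rightarrow> 'a" and j
  assume "\<And>j. finite {i. A i j \<noteq> 0}" "\<And>j. finite {i. B i j \<noteq> 0}"
  then have "finite ({i. A i j \<noteq> 0} \<union> {i. B i j \<noteq> 0})" by blast
  then show "finite {i. A i j + B i j \<noteq> 0}"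
    by (rule rev_finite_subset) auto
qed
lift_definition uminus_cfm :: "'a cfm \<Rightarrow> 'a cfm" is "\<lambda>A i j. - A i j" by simp
definition minus_cfm :: "'a cfm \<Rightarrow> 'a cfm \<Rightarrow> 'a cfm" where "minus_cfm A B = A + - B"
lift_definition times_cfm :: "'a cfm \<Rightarrow> 'a cfm \<Rightarrow> 'a cfm"
  is "\<lambda>A B i j. \<Sum>k | B k j \<noteq> 0. A i k * B k j"
proof -
  fix A B :: "nat \<Rightarrow> nat \<Rightarrow> 'a" and j
  assume A: "\<And>j. finite {i. A i j \<noteq> 0}" and B: "\<And>j. finite {i. B i j \<noteq> 0}"
  have "{i. (\<Sum>k | B k j \<noteq> 0. A i k * B k j) \<noteq> 0} \<subseteq> (\<Union>k\<in>{k. B k j \<noteq> 0}. {i. A i k \<noteq> 0})"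
  proof
    fix i assume "i \<in> {i. (\<Sum>k | B k j \<noteq> 0. A i k * B k j) \<noteq> 0}"
    then obtain k where "k \<in> {k. B k j \<noteq> 0}" "A i k * B k j \<noteq> 0"
      by (metis (mono_tags, lifting) mem_Collect_eq sum.not_neutral_contains_not_neutral)
    then show "i \<in> (\<Union>k\<in>{k. B k j \<noteq> 0}. {i. A i k \<noteq> 0})" by auto
  qed
  then show "finite {i. (\<Sum>k | B k j \<noteq> 0. A i k * B k j) \<noteq> 0}"
    by (rule finite_subset) (use A B in auto)
qed

lemma ent_times_fin:
  assumes "finite S" "\<And>k. k \<notin> S \<Longrightarrow> ent B k j = 0"
  shows "ent (A * B) i j = (\<Sum>k\<in>S. ent A i k * ent B k j)"
  unfolding times_cfm.rep_eq
  by (rule sum.mono_neutral_left) (use assms in auto)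

instance
proof
  fix a b c :: "'a cfm"
  show "a + b + c = a + (b + c)" by transfer (simp add: add.assoc)
  show "a + b = b + a" by transfer (simp add: add.commute)
  show "0 + a = a" by transfer simp
  show "- a + a = 0" by transfer simp
  show "a - b = a + - b" by (rule minus_cfm_def)
  show "(0::'a cfm) \<noteq> 1" by transfer (metis zero_neq_one)
  show "1 * a = a"
  proof (rule cfm_eqI)
    fix i j
    show "ent (1 * a) i j = ent a i j"
      by (subst ent_times_fin[of "insert i {k. ent a k j \<noteq> 0}"])
        (auto simp: finite_ent one_cfm.rep_eq if_distrib[of "\<lambda>x. x * _"] cong: if_cong)
  qed
  show "a * 1 = a"
  proof (rule cfm_eqI)
    fix i j
    show "ent (a * 1) i j = ent a i j"
      by (subst ent_times_fin[of "{j}"]) (auto simp: one_cfm.rep_eq)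
  qed
  show "(a + b) * c = a * c + b * c"
    by transfer (simp add: distrib_right sum.distrib)
  show "a * (b + c) = a * b + a * c"
  proof (rule cfm_eqI)
    fix i j
    let ?S = "{k. ent b k j \<noteq> 0} \<union> {k. ent c k j \<noteq> 0}"
    have "ent (a * (b + c)) i j = (\<Sum>k\<in>?S. ent a i k * ent (b + c) k j)"
      "ent (a * b) i j = (\<Sum>k\<in>?S. ent a i k * ent b k j)"
      "ent (a * c) i j = (\<Sum>k\<in>?S. ent a i k * ent c k j)"
      by (rule ent_times_fin; auto simp: finite_ent plus_cfm.rep_eq)+
    then show "ent (a * (b + c)) i j = ent (a * b + a * c) i j"
      by (simp add: plus_cfm.rep_eq distrib_left sum.distrib)
  qed
  show "a * b * c = a * (b * c)"
  proof (rule cfm_eqI)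
    fix i j
    let ?T = "{l. ent c l j \<noteq> 0}"
    let ?S = "\<Union>l\<in>?T. {k. ent b k l \<noteq> 0}"
    have fS: "finite ?S" by (auto simp: finite_ent)
    have "ent (a * b * c) i j = (\<Sum>l\<in>?T. ent (a * b) i l * ent c l j)"
      by (rule ent_times_fin) (auto simp: finite_ent)
    also have "\<dots> = (\<Sum>l\<in>?T. (\<Sum>k\<in>?S. ent a i k * ent b k l) * ent c l j)"
      by (intro sum.cong refl arg_cong2[of _ _ _ _ "(*)"] ent_times_fin[OF fS]) auto
    also have "\<dots> = (\<Sum>k\<in>?S. ent a i k * (\<Sum>l\<in>?T. ent b k l * ent c l j))"
      unfolding sum_distrib_left sum_distrib_right by (subst sum.swap) (simp add: mult.assoc)
    also have "\<dots> = (\<Sum>k\<in>?S. ent a i k * ent (b * c) k j)"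
      by (intro sum.cong refl arg_cong2[of _ _ _ _ "(*)"] ent_times_fin[symmetric])
         (auto simp: finite_ent)
    also have "\<dots> = ent (a * (b * c)) i j"
    proof (rule ent_times_fin[symmetric, OF fS])
      fix k assume "k \<notin> ?S"
      then show "ent (b * c) k j = 0"
        by (subst ent_times_fin[of ?T]) (auto simp: finite_ent intro!: sum.neutral)
    qed
    finally show "ent (a * b * c) i j = ent (a * (b * c)) i j" .
  qed
qed

end

lemma ent_add [simp]: "ent (A + B) i j = ent A i j + ent B i j"
  by (simp add: plus_cfm.rep_eq)
lemma ent_minus [simp]: "ent (- A) i j = - ent A i j"
  by (simp add: uminus_cfm.rep_eq)
lemma ent_diff [simp]: "ent (A - B) i j = ent A i j - ent B i j"
  by (simp only: minus_cfm_def ent_add ent_minus diff_conv_add_uminus)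
lemma ent_0 [simp]: "ent 0 i j = 0"
  by (simp add: zero_cfm.rep_eq)
lemma ent_1: "ent 1 i j = (if i = j then 1 else 0)"
  by (simp add: one_cfm.rep_eq)
lemma ent_sum: "ent (sum f S) i j = (\<Sum>x\<in>S. ent (f x) i j)"
  by (induction S rule: infinite_finite_induct) auto

lift_definition cst :: "'a::field \<Rightarrow> 'a cfm" is "\<lambda>c i j. if i = j then c else 0" by simp
lift_definition pr :: "nat \<Rightarrow> 'a::field cfm" is "\<lambda>n i j. if i = j \<and> i < n then 1 else 0" by simp
lift_definition mu :: "nat \<Rightarrow> nat \<Rightarrow> 'a::field cfm" is "\<lambda>r s i j. if i = r \<and> j = s then 1 else 0" by simp
lift_definition mp :: "(nat \<Rightarrow> nat) \<Rightarrow> 'a::field cfm" is "\<lambda>g i j. if i = g j then 1 else 0" by simp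
text \<open>The transpose of \<open>mp g\<close>. The guard \<open>inj g\<close> keeps its columns
  finite, since a fibre of an arbitrary \<open>g\<close> may be infinite.\<close>

lift_definition tp :: "(nat \<Rightarrow> nat) \<Rightarrow> 'a::field cfm" is "\<lambda>g i j. if g i = j \<and> inj g then 1 else 0"
proof -
  fix g :: "nat \<Rightarrow> nat" and j
  show "finite {i. (if g i = j \<and> inj g then 1 else 0::'a) \<noteq> 0}"
  proof (cases "inj g")
    case True
    then have "finite (g -` {j})" by (simp add: finite_vimageI)
    then show ?thesis by (rule rev_finite_subset) auto
  qed simp
qed

lemma ent_cst: "ent (cst c) i j = (if i = j then c else 0)" by transfer simp
lemma ent_pr: "ent (pr n) i j = (if i = j \<and> i < n then 1 else 0)" by transfer simp
lemma ent_mu: "ent (mu r s) i j = (if i = r \<and> j = s then 1 else 0)" by transfer simp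
lemma ent_mp: "ent (mp g) i j = (if i = g j then 1 else 0)" by transfer simp
lemma ent_tp: "inj g \<Longrightarrow> ent (tp g) i j = (if g i = j then 1 else 0)" by transfer simp

lemma ent_times_single:
  assumes "\<And>k. k \<noteq> l \<Longrightarrow> ent B k j = 0"
  shows "ent (A * B) i j = ent A i l * ent B l j"
  by (subst ent_times_fin[of "{l}"]) (use assms in auto)

lemma ent_times_single_left:
  assumes "\<And>k. k \<noteq> l \<Longrightarrow> ent A i k = 0"
  shows "ent (A * B) i j = ent A i l * ent B l j"
proof -
  have "ent (A * B) i j = (\<Sum>k\<in>insert l {k. ent B k j \<noteq> 0}. ent A i k * ent B k j)"
    by (rule ent_times_fin) (auto simp: finite_ent)
  also have "\<dots> = (\<Sum>k\<in>{l}. ent A i k * ent B k j)"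
    by (rule sum.mono_neutral_right) (use assms in \<open>auto simp: finite_ent\<close>)
  finally show ?thesis by simp
qed

lemma ent_times_zero_left: "(\<And>k. ent A i k = 0) \<Longrightarrow> ent (A * B) i j = 0"
  by (subst ent_times_single_left[of 0]) auto

lemma ent_cst_mult [simp]: "ent (cst c * A) i j = c * ent A i j"
  by (subst ent_times_single_left[of i]) (auto simp: ent_cst)
lemma ent_mult_cst [simp]: "ent (A * cst c) i j = ent A i j * c"
  by (subst ent_times_single[of j]) (auto simp: ent_cst)
lemma ent_pr_mult: "ent (pr n * A) i j = (if i < n then ent A i j else 0)"
  by (subst ent_times_single_left[of i]) (auto simp: ent_pr)
lemma ent_mult_pr: "ent (A * pr n) i j = (if j < n then ent A i j else 0)"
  by (subst ent_times_single[of j]) (auto simp: ent_pr)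
lemma ent_mu_mult: "ent (mu r s * A) i j = (if i = r then ent A s j else 0)"
  by (subst ent_times_single_left[of s]) (auto simp: ent_mu)
lemma ent_mult_mu: "ent (A * mu r s) i j = (if j = s then ent A i r else 0)"
  by (subst ent_times_single[of r]) (auto simp: ent_mu)
lemma ent_mult_mp: "ent (A * mp g) i j = ent A i (g j)"
  by (subst ent_times_single[of "g j"]) (auto simp: ent_mp)
lemma ent_tp_mult: "inj g \<Longrightarrow> ent (tp g * A) i j = ent A (g i) j"
  by (subst ent_times_single_left[of "g i"]) (auto simp: ent_tp)
lemma ent_mp_mult: "inj g \<Longrightarrow> ent (mp g * A) (g i) j = ent A i j"
  by (subst ent_times_single_left[of i]) (auto simp: ent_mp inj_eq)
lemma ent_mp_mult_0: "i \<notin> range g \<Longrightarrow> ent (mp g * A) i j = 0"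
  by (rule ent_times_zero_left) (auto simp: ent_mp)
lemma ent_mult_tp: "inj g \<Longrightarrow> ent (A * tp g) i (g j) = ent A i j"
  by (subst ent_times_single[of j]) (auto simp: ent_tp inj_eq)
lemma ent_mult_tp_0: "inj g \<Longrightarrow> j \<notin> range g \<Longrightarrow> ent (A * tp g) i j = 0"
  by (subst ent_times_single[of 0]) (auto simp: ent_tp)

lemma cst_commute: "cst c * A = A * cst c"
  by (rule cfm_eqI) (simp add: mult.commute)
lemma cst_add: "cst (c + d) = cst c + cst d"
  by (rule cfm_eqI) (simp add: ent_cst)
lemma cst_mult: "cst (c * d) = cst c * cst d"
  by (rule cfm_eqI) (simp add: ent_cst)
lemma cst_0 [simp]: "cst 0 = 0"
  by (rule cfm_eqI) (simp add: ent_cst)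
lemma cst_1 [simp]: "cst 1 = 1"
  by (rule cfm_eqI) (simp add: ent_cst ent_1)

lemma pr_mult_pr: "pr m * pr n = pr (min m n)"
  by (rule cfm_eqI) (auto simp: ent_pr_mult ent_pr)
lemma pr_idem [simp]: "pr n * pr n = pr n"
  by (simp add: pr_mult_pr)
lemma pr_idem' [simp]: "pr n * (pr n * A) = pr n * A"
  by (simp add: mult.assoc[symmetric])
lemma pr_0 [simp]: "pr 0 = 0"
  by (rule cfm_eqI) (simp add: ent_pr)
lemma pr_Suc: "pr (Suc n) = pr n + mu n n"
  by (rule cfm_eqI) (auto simp: ent_pr ent_mu)
lemma pr_eq_sum: "pr n = (\<Sum>a<n. mu a a)"
  by (induction n) (simp_all add: pr_Suc)
lemma mu_mult_mu: "mu i j * mu k l = (if j = k then mu i l else 0)"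
  by (rule cfm_eqI) (auto simp: ent_mu_mult ent_mu)
lemma mu_mult_mult_mu: "mu r i * A * mu j s = cst (ent A i j) * mu r s"
  by (rule cfm_eqI) (simp add: ent_mult_mu ent_mu_mult ent_mu ent_cst)
lemma pr_mult_mu: "pr n * mu i j = (if i < n then mu i j else 0)"
  by (rule cfm_eqI) (auto simp: ent_pr_mult ent_mu)
lemma mu_mult_pr: "mu i j * pr n = (if j < n then mu i j else 0)"
  by (rule cfm_eqI) (auto simp: ent_mult_pr ent_mu)
lemma tp_mult_mp: "inj g \<Longrightarrow> tp g * mp g = 1"
  by (rule cfm_eqI) (auto simp: ent_tp_mult ent_mp ent_1 inj_eq)
lemma mp_comp: "mp f * mp g = mp (f \<circ> g)"
  by (rule cfm_eqI) (auto simp: ent_mult_mp ent_mp)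

section \<open>Kronecker products on paired indices\<close>

abbreviation en :: "nat \<Rightarrow> nat \<Rightarrow> nat" where "en i a \<equiv> prod_encode (i, a)"

lift_definition kr :: "'a::field cfm \<Rightarrow> 'a cfm \<Rightarrow> 'a cfm" (infixl "\<boxtimes>" 70)
  is "\<lambda>A B p q. A (fst (prod_decode p)) (fst (prod_decode q)) * B (snd (prod_decode p)) (snd (prod_decode q))"
proof -
  fix A B :: "nat \<Rightarrow> nat \<Rightarrow> 'a" and j
  assume A: "\<And>j. finite {i. A i j \<noteq> 0}" and B: "\<And>j. finite {i. B i j \<noteq> 0}"
  let ?a = "fst (prod_decode j)" and ?b = "snd (prod_decode j)"
  have "{i. A (fst (prod_decode i)) ?a * B (snd (prod_decode i)) ?b \<noteq> 0}
      \<subseteq> prod_encode ` ({i. A i ?a \<noteq> 0} \<times> {i. B i ?b \<noteq> 0})"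
  proof
    fix p assume "p \<in> {i. A (fst (prod_decode i)) ?a * B (snd (prod_decode i)) ?b \<noteq> 0}"
    then have "prod_decode p \<in> {i. A i ?a \<noteq> 0} \<times> {i. B i ?b \<noteq> 0}" by (auto simp: mem_Times_iff)
    then have "prod_encode (prod_decode p) \<in> prod_encode ` ({i. A i ?a \<noteq> 0} \<times> {i. B i ?b \<noteq> 0})"
      by (rule imageI)
    then show "p \<in> prod_encode ` ({i. A i ?a \<noteq> 0} \<times> {i. B i ?b \<noteq> 0})" by simp
  qed
  then show "finite {i. A (fst (prod_decode i)) ?a * B (snd (prod_decode i)) ?b \<noteq> 0}"
    by (rule finite_subset) (use A B in auto)
qed

lemma ent_kr [simp]: "ent (A \<boxtimes> B) (en i a) (en j b) = ent A i j * ent B a b"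
  by (simp add: kr.rep_eq)

lemma en_ex: "\<exists>i a. p = en i a"
  by (metis prod.collapse prod_decode_inverse)

lemma cfm_eqI_en:
  assumes "\<And>i a j b. ent A (en i a) (en j b) = ent B (en i a) (en j b)"
  shows "A = B"
proof (rule cfm_eqI)
  fix p q
  obtain i a j b where "p = en i a" "q = en j b" using en_ex by metis
  then show "ent A p q = ent B p q" using assms by simp
qed

lemma kr_mult: "(A \<boxtimes> B) * (C \<boxtimes> D) = (A * C) \<boxtimes> (B * D)"
proof (rule cfm_eqI_en)
  fix i a j b
  let ?S = "{k. ent C k j \<noteq> 0}" and ?T = "{k. ent D k b \<noteq> 0}"
  have "ent ((A \<boxtimes> B) * (C \<boxtimes> D)) (en i a) (en j b) =
     (\<Sum>p\<in>prod_encode ` (?S \<times> ?T). ent (A \<boxtimes> B) (en i a) p * ent (C \<boxtimes> D) p (en j b))"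
  proof (rule ent_times_fin)
    fix p assume "p \<notin> prod_encode ` (?S \<times> ?T)"
    moreover obtain k l where "p = en k l" using en_ex by metis
    ultimately show "ent (C \<boxtimes> D) p (en j b) = 0" by auto
  qed (auto simp: finite_ent)
  also have "\<dots> = (\<Sum>(k, l)\<in>?S \<times> ?T. (ent A i k * ent C k j) * (ent B a l * ent D l b))"
    by (subst sum.reindex) (auto simp: inj_on_def mult_ac intro!: sum.cong)
  also have "\<dots> = (\<Sum>k\<in>?S. ent A i k * ent C k j) * (\<Sum>l\<in>?T. ent B a l * ent D l b)"
    by (simp add: sum_product sum.cartesian_product)
  also have "\<dots> = ent ((A * C) \<boxtimes> (B * D)) (en i a) (en j b)"
    by (simp add: times_cfm.rep_eq)
  finally show "ent ((A \<boxtimes> B) * (C \<boxtimes> D)) (en i a) (en j b) = ent ((A * C) \<boxtimes> (B * D)) (en i a) (en j b)" .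
qed

lemma kr_add_left: "(A + B) \<boxtimes> C = A \<boxtimes> C + B \<boxtimes> C"
  by (rule cfm_eqI_en) (simp add: distrib_right)
lemma kr_add_right: "A \<boxtimes> (B + C) = A \<boxtimes> B + A \<boxtimes> C"
  by (rule cfm_eqI_en) (simp add: distrib_left)
lemma kr_diff_right: "A \<boxtimes> (B - C) = A \<boxtimes> B - A \<boxtimes> C"
  by (rule cfm_eqI_en) (simp add: right_diff_distrib)
lemma kr_0_left [simp]: "0 \<boxtimes> C = 0"
  by (rule cfm_eqI_en) simp
lemma kr_0_right [simp]: "C \<boxtimes> 0 = 0"
  by (rule cfm_eqI_en) simp
lemma kr_sum_left: "(sum f S) \<boxtimes> C = (\<Sum>x\<in>S. f x \<boxtimes> C)"
  by (induction S rule: infinite_finite_induct) (auto simp: kr_add_left)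
lemma kr_sum_right: "C \<boxtimes> (sum f S) = (\<Sum>x\<in>S. C \<boxtimes> f x)"
  by (induction S rule: infinite_finite_induct) (auto simp: kr_add_right)
lemma kr_1 [simp]: "1 \<boxtimes> 1 = 1"
  by (rule cfm_eqI_en) (auto simp: ent_1)
lemma kr_cst_right: "A \<boxtimes> (cst c * B) = cst c * (A \<boxtimes> B)"
  by (rule cfm_eqI_en) (auto simp: mult_ac)

lemma inj_en1: "inj (\<lambda>i. en i a)" and inj_en2: "inj (\<lambda>a. en i a)"
  by (auto simp: inj_on_def)

text \<open>The embedding of the space with basis \<open>e\<^sub>i\<close> as the span of the \<open>e\<^sub>i \<otimes> e\<^sub>a\<close>, for fixed \<open>a\<close>.\<close>

definition io :: "nat \<Rightarrow> 'a::field cfm" where "io a = mp (\<lambda>i. en i a)"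
definition oi :: "nat \<Rightarrow> 'a::field cfm" where "oi a = tp (\<lambda>i. en i a)"

lemma ent_io_mult: "ent (io a * A) (en i b) j = (if a = b then ent A i j else 0)"
proof (cases "a = b")
  case True
  then show ?thesis using ent_mp_mult[OF inj_en1[of b], of A i j] by (simp add: io_def)
next
  case False
  then show ?thesis unfolding io_def by (subst ent_mp_mult_0) auto
qed
lemma ent_mult_io: "ent (A * io a) i j = ent A i (en j a)"
  by (simp add: io_def ent_mult_mp)
lemma ent_oi_mult: "ent (oi a * A) i j = ent A (en i a) j"
  by (simp add: oi_def ent_tp_mult inj_en1)
lemma ent_mult_oi: "ent (A * oi a) i (en j b) = (if a = b then ent A i j else 0)"
proof (cases "a = b")
  case True
  then show ?thesis using ent_mult_tp[OF inj_en1[of b], of A i j] by (simp add: oi_def)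
next
  case False
  then show ?thesis unfolding oi_def by (subst ent_mult_tp_0[OF inj_en1]) auto
qed
lemma oi_mult_io: "oi a * io b = (if a = b then 1 else 0)"
  by (rule cfm_eqI) (auto simp: ent_oi_mult io_def ent_mp ent_1)
lemma io_mult_mult_oi: "io a * X * oi b = X \<boxtimes> mu a b"
  by (rule cfm_eqI_en) (auto simp: ent_mult_oi ent_io_mult ent_mu)
lemma io_mult_oi: "io a * oi b = 1 \<boxtimes> mu a b"
  using io_mult_mult_oi[of a 1 b] by simp
lemma kr_mu_io: "(X \<boxtimes> mu a b) * io c = (if b = c then io a * X else 0)"
  unfolding io_mult_mult_oi[symmetric] mult.assoc oi_mult_io by simp


section \<open>Rank\<close>

lemma cst_left_commute: "A * (cst c * B) = cst c * (A * B)"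
  by (metis cst_commute mult.assoc)

text \<open>Rank as divisibility: the witnesses \<open>P\<close> and \<open>Q\<close> are
  transported by ring computations, reindexing and extension of scalars alike, and no dimension of a
  subspace has to be defined.\<close>

definition rank_ge :: "'a::field cfm \<Rightarrow> nat \<Rightarrow> bool" where
  "rank_ge A s \<longleftrightarrow> (\<exists>P Q. P * A * Q = pr s)"

definition tomat :: "nat \<Rightarrow> nat \<Rightarrow> 'a::field cfm \<Rightarrow> 'a mat" where
  "tomat p q A = mat p q (\<lambda>(i, j). ent A i j)"

lift_definition frmat :: "'a::field mat \<Rightarrow> 'a cfm"
  is "\<lambda>M i j. if i < dim_row M \<and> j < dim_col M then M $$ (i, j) else 0"
  by (rule_tac finite_subset[of _ "{..<dim_row _}"]) auto

lemma tomat_carrier [simp]: "tomat p q A \<in> carrier_mat p q"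
  by (simp add: tomat_def)

lemma tomat_frmat: "M \<in> carrier_mat p q \<Longrightarrow> tomat p q (frmat M) = M"
  by (rule eq_matI) (auto simp: tomat_def frmat.rep_eq)

lemma tomat_index [simp]: "i < p \<Longrightarrow> j < q \<Longrightarrow> tomat p q A $$ (i, j) = ent A i j"
  by (simp add: tomat_def)

lemma tomat_mult: "tomat p q A * tomat q r B = tomat p r (A * pr q * B)"
proof (rule eq_matI)
  fix i j assume ij: "i < dim_row (tomat p r (A * pr q * B))" "j < dim_col (tomat p r (A * pr q * B))"
  have "ent (A * pr q * B) i j = (\<Sum>k<q. ent A i k * ent B k j)"
    unfolding mult.assoc by (subst ent_times_fin[of "{..<q}"]) (auto simp: ent_pr_mult)
  then show "(tomat p q A * tomat q r B) $$ (i, j) = tomat p r (A * pr q * B) $$ (i, j)"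
    using ij by (simp add: tomat_def scalar_prod_def atLeast0LessThan)
qed (auto simp: tomat_def)

lemma tomat_pr: "tomat s s (pr s) = 1\<^sub>m s"
  by (rule eq_matI) (auto simp: tomat_def ent_pr)

lemma tomat_inj:
  assumes "tomat p q A = tomat p q B" shows "pr p * A * pr q = pr p * B * pr q"
proof (rule cfm_eqI)
  fix i j
  show "ent (pr p * A * pr q) i j = ent (pr p * B * pr q) i j"
    using tomat_index[of i p j q A] tomat_index[of i p j q B] assms by (auto simp: ent_mult_pr ent_pr_mult)
qed

lemma frmat_corner: "M \<in> carrier_mat p q \<Longrightarrow> pr p * frmat M = frmat M"
  "M \<in> carrier_mat p q \<Longrightarrow> frmat M * pr q = frmat M"
  by (rule cfm_eqI, auto simp: ent_pr_mult ent_mult_pr frmat.rep_eq)+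

text \<open>Finite dimension enters through square matrices: for \<open>t < s\<close> the one-sided
  inverse \<open>?X * ?Y = 1\<close> of size \<open>s\<close> is two-sided, but row \<open>t\<close>
  of \<open>?Y * ?X\<close> vanishes.\<close>

lemma pr_factor_le:
  assumes "P * pr t * Q = pr s" shows "s \<le> t"
proof (rule ccontr)
  assume "\<not> s \<le> t"
  then have t: "t < s" by simp
  let ?X = "tomat s s (P * pr t)" and ?Y = "tomat s s (pr t * Q)"
  have "?X * ?Y = tomat s s (P * (pr t * pr s * pr t) * Q)"
    by (simp add: tomat_mult mult.assoc)
  also have "pr t * pr s * pr t = (pr t :: 'a cfm)"
    using t by (simp add: pr_mult_pr)
  finally have "?X * ?Y = 1\<^sub>m s" by (simp add: assms tomat_pr)
  then have "?Y * ?X = 1\<^sub>m s"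
    by (rule mat_mult_left_right_inverse[rotated -1]) auto
  then have "(?Y * ?X) $$ (t, t) = 1" using t by simp
  moreover have "?Y * ?X = tomat s s (pr t * Q * pr s * (P * pr t))" by (simp add: tomat_mult)
  ultimately show False using t by (simp add: mult.assoc ent_pr_mult)
qed

lemma rank_ge_factor: "rank_ge (B * pr t * C) s \<Longrightarrow> s \<le> t"
  unfolding rank_ge_def
  by (metis mult.assoc pr_factor_le)

lemma rank_ge_mult: "rank_ge (B * A * C) s \<Longrightarrow> rank_ge A s"
  unfolding rank_ge_def by (metis mult.assoc)

lemma rank_ge_mono: "rank_ge A s \<Longrightarrow> s' \<le> s \<Longrightarrow> rank_ge A s'"
  unfolding rank_ge_def
proof (elim exE)
  fix P Q assume "s' \<le> s" "P * A * Q = pr s"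
  then have "(pr s' * P) * A * Q = pr s'" by (simp add: mult.assoc pr_mult_pr)
  then show "\<exists>P Q. P * A * Q = pr s'" by blast
qed

lemma rank_ge_0 [simp]: "rank_ge A 0"
  unfolding rank_ge_def by (rule exI[of _ 0]) simp

lemma nonzero_entry:
  fixes A :: "'a::field cfm"
  assumes "A \<noteq> 0" obtains i j where "ent A i j \<noteq> 0"
  using assms cfm_eqI[of A 0] by auto

text \<open>The Schur complement of an invertible \<open>r \<times> r\<close> block of \<open>A\<close> is \<open>A - A Q P A\<close>; a nonzero entry of
  it enlarges the block.\<close>

lemma rank_ge_extend:
  assumes PAQ: "P * A * Q = pr r" and ne: "A * Q * P * A \<noteq> A"
  shows "rank_ge A (Suc r)"
proof -
  define P1 Q1 where "P1 = pr r * P" and "Q1 = Q * pr r"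
  have 1: "P1 * (A * Q1) = pr r" using PAQ by (simp add: P1_def Q1_def mult.assoc[symmetric])
     (simp add: mult.assoc PAQ)
  have PP: "pr r * P1 = P1" "Q1 * pr r = Q1" by (simp_all add: P1_def Q1_def mult.assoc)
  have prQ: "pr r * (P * (A * Q)) = pr r" using PAQ by (simp add: mult.assoc)
  have ne': "A - A * (Q1 * (P1 * A)) \<noteq> 0"
  proof
    assume "A - A * (Q1 * (P1 * A)) = 0"
    then have A: "A = A * (Q * (pr r * (P * A)))" by (simp add: P1_def Q1_def mult.assoc)
    have "A * Q * P * A = A * (Q * (P * (A * (Q * (pr r * (P * A))))))"
      using A by (simp add: mult.assoc)
    also have "\<dots> = A * (Q * ((P * A * Q) * (pr r * (P * A))))" by (simp add: mult.assoc)
    also have "\<dots> = A" unfolding PAQ using A by (simp add: mult.assoc)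
    finally show False using ne by simp
  qed
  define E where "E = A - A * (Q1 * (P1 * A))"
  obtain i j where c: "ent E i j \<noteq> 0" using ne' nonzero_entry unfolding E_def by blast
  have EQ: "E * Q1 = 0"
    unfolding E_def left_diff_distrib mult.assoc 1 PP by simp
  have PE: "P1 * E = 0"
    unfolding E_def right_diff_distrib
    using 1 by (simp add: mult.assoc[symmetric] PP)
  \<comment> \<open>A row and a column orthogonal to the old block: the factors
    \<open>1 - A * (Q1 * P1)\<close> and \<open>1 - Q1 * (P1 * A)\<close> perform the elimination,
    and the scalar normalizes the new pivot to one.\<close>
  define p where "p = cst (inverse (ent E i j)) * mu r i * (1 - A * (Q1 * P1))"
  define q where "q = (1 - Q1 * (P1 * A)) * mu j r"
  have pA: "p * A = cst (inverse (ent E i j)) * mu r i * E"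
    by (simp add: p_def E_def algebra_simps mult.assoc)
  have Aq: "A * q = E * mu j r"
    by (simp add: q_def E_def algebra_simps mult.assoc)
  have "p * A * Q1 = 0" by (simp add: pA mult.assoc EQ)
  moreover have "P1 * (A * q) = 0" by (simp add: Aq mult.assoc[symmetric] PE)
  moreover have "p * A * q = mu r r"
  proof -
    have "E * q = E * mu j r"
      unfolding q_def left_diff_distrib right_diff_distrib by (simp add: mult.assoc[symmetric] EQ)
    then have "p * A * q = cst (inverse (ent E i j)) * (mu r i * E * mu j r)"
      by (simp add: pA mult.assoc)
    also have "\<dots> = cst (inverse (ent E i j) * ent E i j) * mu r r"
      unfolding mu_mult_mult_mu by (simp add: cst_mult mult.assoc)
    finally show ?thesis using c by simp
  qed
  ultimately have "(P1 + p) * A * (Q1 + q) = pr (Suc r)"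
    by (simp add: pr_Suc distrib_left distrib_right mult.assoc 1)
  then show ?thesis unfolding rank_ge_def by blast
qed

text \<open>Idempotents of rank \<open>N\<close> together with a splitting. The typical case is
  \<open>pr n \<boxtimes> pr d\<close>, which under the pairing is not an initial projection
  \<open>pr N\<close>.\<close>

definition fin_idem :: "'a::field cfm \<Rightarrow> nat \<Rightarrow> bool" where
  "fin_idem e N \<longleftrightarrow> (\<exists>U V. V * U = pr N \<and> U * V = e \<and> U * pr N = U)"

lemma fin_idem_pr: "fin_idem (pr n) n"
  unfolding fin_idem_def by (rule exI[of _ "pr n"], rule exI[of _ "pr n"]) simp

lemma fin_idem_factor:
  assumes "fin_idem e N" obtains U V where "e = U * pr N * V"
  using assms unfolding fin_idem_def by metis

lemma fin_idem_idem:
  assumes "fin_idem e N" shows "e * e = e"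
  using assms unfolding fin_idem_def by (metis mult.assoc)

lemma rank_ge_fin_idem: "fin_idem e N \<Longrightarrow> rank_ge e s \<longleftrightarrow> s \<le> N"
proof
  assume e: "fin_idem e N" and "rank_ge e s"
  then show "s \<le> N" using rank_ge_factor by (metis fin_idem_factor)
next
  assume e: "fin_idem e N" and s: "s \<le> N"
  obtain U V where "V * U = pr N" "U * V = e" "U * pr N = U" using e unfolding fin_idem_def by blast
  then have "V * e * U = pr N" by (metis mult.assoc pr_idem)
  then have "rank_ge e N" unfolding rank_ge_def by blast
  then show "rank_ge e s" using s rank_ge_mono by blast
qed

lemma rank_ge_corner_le:
  assumes "fin_idem e N" "e * A = A \<or> A * e = A" "rank_ge A s" shows "s \<le> N"
proof -
  have "rank_ge (1 * e * A) s \<or> rank_ge (A * e * 1) s" using assms by auto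
  then have "rank_ge e s" using rank_ge_mult by blast
  then show ?thesis using assms(1) by (simp add: rank_ge_fin_idem)
qed

text \<open>The equation \<open>P * A * Q = pr N\<close> is read as a block
  \<open>P * e * (A * Q)\<close> of \<open>e\<close> instead of \<open>A\<close>. As
  \<open>e\<close> has no larger block, its Schur complement vanishes, and this expresses
  \<open>e\<close> as a right multiple of \<open>A\<close>.\<close>

lemma full_right_inverse:
  assumes e: "fin_idem e N" and eA: "e * A = A" and r: "rank_ge A N"
  obtains R where "A * R = e"
proof -
  obtain P Q where "P * A * Q = pr N" using r unfolding rank_ge_def by blast
  then have 1: "P * e * (A * Q) = pr N" by (simp add: mult.assoc eA mult.assoc[symmetric, of e])
  have "\<not> rank_ge e (Suc N)" using e by (simp add: rank_ge_fin_idem)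
  then have "e * (A * Q) * P * e = e" using rank_ge_extend[OF 1] by blast
  then have "A * (Q * P * e) = e" by (simp add: mult.assoc[symmetric] eA)
  then show thesis by (rule that)
qed

lemma full_left_inverse:
  assumes e: "fin_idem e N" and eA: "A * e = A" and r: "rank_ge A N"
  obtains L where "L * A = e"
proof -
  obtain P Q where "P * A * Q = pr N" using r unfolding rank_ge_def by blast
  then have 1: "(P * A) * e * Q = pr N" by (simp add: mult.assoc eA mult.assoc[symmetric, of A e])
  have "\<not> rank_ge e (Suc N)" using e by (simp add: rank_ge_fin_idem)
  then have "e * Q * (P * A) * e = e" using rank_ge_extend[OF 1] by blast
  then have "(e * Q * P) * A = e" by (simp add: mult.assoc eA)
  then show thesis by (rule that)
qed

text \<open>At the maximal rank the Schur complement is zero, so \<open>Q * P\<close> is a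
  generalized inverse of \<open>A\<close>: the image of \<open>A\<close> is the fixed space of
  \<open>A * Q * P\<close> and its kernel is the image of \<open>1 - Q * P * A\<close>.\<close>

lemma rank_normal_form:
  assumes e: "fin_idem e N" and eA: "e * A = A \<or> A * e = A"
  obtains r P Q where "P * A * Q = pr r" "A * Q * P * A = A" "pr r * P = P" "Q * pr r = Q"
    "\<And>s. rank_ge A s \<longleftrightarrow> s \<le> r" "r \<le> N"
proof -
  let ?R = "{r. rank_ge A r}"
  have sub: "?R \<subseteq> {..N}" using rank_ge_corner_le[OF e eA] by auto
  then have fin: "finite ?R" by (rule finite_subset) simp
  define r where "r = Max ?R"
  have r: "rank_ge A r" using Max_in[OF fin] rank_ge_0[of A] unfolding r_def by blast
  have le: "rank_ge A s \<longleftrightarrow> s \<le> r" for s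
    using Max_ge[OF fin] rank_ge_mono[OF r] unfolding r_def by blast
  obtain P Q where PQ: "P * A * Q = pr r" using r unfolding rank_ge_def by blast
  have 1: "(pr r * P) * A * (Q * pr r) = pr r" using PQ by (simp add: mult.assoc mult.assoc[symmetric, of _ Q])
  have "A * (Q * pr r) * (pr r * P) * A = A" using rank_ge_extend[OF 1] le by fastforce
  moreover have "r \<le> N" using sub r by auto
  ultimately show thesis using that[of "pr r * P" "Q * pr r" r] 1 le by (simp add: mult.assoc)
qed

text \<open>Subadditivity of rank: with the second factorization shifted by \<open>p\<close>
  coordinates, both fit side by side and factor \<open>pr n\<close> through
  \<open>pr (p + a)\<close>.\<close>

lemma pr_sub_additive:
  assumes "B * pr p * C + B' * pr a * C' = pr n"
  shows "n \<le> p + a"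
proof -
  let ?g = "\<lambda>i. i + p"
  have inj: "inj ?g" by (auto simp: inj_on_def)
  define s t :: "'a cfm" where "s = mp ?g" and "t = tp ?g"
  have ts: "t * s = 1" unfolding s_def t_def by (rule tp_mult_mp[OF inj])
  have ps: "pr p * s = 0"
    unfolding s_def by (rule cfm_eqI) (auto simp: ent_pr_mult ent_mp)
  have tp: "t * pr p = 0"
    unfolding t_def by (rule cfm_eqI) (auto simp: ent_mult_pr ent_tp[OF inj])
  have d: "pr (p + a) = pr p + s * pr a * t"
  proof (rule cfm_eqI)
    fix i j
    show "ent (pr (p + a)) i j = ent (pr p + s * pr a * t) i j"
    proof (cases "i < p")
      case True
      then have "i \<notin> range ?g" by auto
      then show ?thesis using True by (auto simp: s_def mult.assoc ent_mp_mult_0 ent_pr)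
    next
      case False
      then have i: "i = ?g (i - p)" by simp
      have "ent (s * (pr a * t)) (?g (i - p)) j = ent (pr a * t) (i - p) j"
        unfolding s_def by (rule ent_mp_mult[OF inj])
      then have "ent (s * pr a * t) i j = ent (pr a * t) (i - p) j"
        using i by (simp add: mult.assoc)
      then show ?thesis using False by (auto simp: ent_pr_mult t_def ent_tp[OF inj] ent_pr)
    qed
  qed
  have tp': "t * (pr p * X) = 0" and ps': "pr p * (s * X) = 0" and ts': "t * (s * X) = X" for X
    using tp ps ts by (simp_all add: mult.assoc[symmetric])
  have "(B * pr p + B' * pr a * t) * pr (p + a) * (pr p * C + s * pr a * C') = pr n"
    unfolding d using assms
    by (simp add: distrib_left distrib_right mult.assoc tp tp' ps ps' ts ts')
  then show ?thesis by (rule pr_factor_le)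
qed

text \<open>Subspaces of \<open>K\<^sup>N\<close> appear as right ideals of matrices with columns in the subspace.\<close>

lemma right_ideal_basis:
  fixes H :: "'a::field cfm set"
  assumes e: "fin_idem e N" and eH: "\<And>u. u \<in> H \<Longrightarrow> e * u = u"
    and add: "\<And>u v. u \<in> H \<Longrightarrow> v \<in> H \<Longrightarrow> u + v \<in> H" and H0: "0 \<in> H"
    and mul: "\<And>u x. u \<in> H \<Longrightarrow> u * x \<in> H"
  obtains b Q S where "Q \<in> H" "Q * pr b = Q" "pr b * S = S" "S * e = S" "S * Q = pr b"
    "\<And>u. u \<in> H \<Longrightarrow> Q * S * u = u"
proof -
  let ?P = "\<lambda>b. \<exists>Q\<in>H. \<exists>S. S * Q = pr b"
  have bd: "b \<le> N" if "?P b" for b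
  proof -
    from that obtain Q S where "Q \<in> H" "S * Q = pr b" by blast
    then have "rank_ge e b" unfolding rank_ge_def using eH by (metis mult.assoc)
    then show ?thesis using e by (simp add: rank_ge_fin_idem)
  qed
  have P0: "?P 0" using H0 by (rule_tac bexI[of _ 0]) auto
  define b where "b = Max {b. ?P b}"
  have fin: "finite {b. ?P b}" by (rule finite_subset[of _ "{..N}"]) (use bd in auto)
  have Pb: "?P b" using Max_in[OF fin] P0 unfolding b_def by blast
  have nP: "\<not> ?P (Suc b)"
  proof
    assume "?P (Suc b)"
    then have "Suc b \<le> b" unfolding b_def by (intro Max_ge[OF fin]) simp
    then show False by simp
  qed
  obtain Q0 S0 where Q0: "Q0 \<in> H" "S0 * Q0 = pr b" using Pb by blast
  define Q S where "Q = Q0 * pr b" and "S = pr b * S0 * e"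
  have QH: "Q \<in> H" and Qb: "Q * pr b = Q" and Sb: "pr b * S = S"
    using mul Q0 by (simp_all add: Q_def S_def mult.assoc)
  have Se: "S * e = S" by (simp add: S_def mult.assoc fin_idem_idem[OF e])
  have SQ: "S * Q = pr b"
  proof -
    have "S * Q = pr b * (S0 * Q)" using eH[OF QH] by (simp add: S_def mult.assoc)
    also have "S0 * Q = pr b" using Q0 by (simp add: Q_def mult.assoc[symmetric])
    finally show ?thesis by simp
  qed
  have "Q * S * u = u" if u: "u \<in> H" for u
  proof (rule ccontr)
    assume "Q * S * u \<noteq> u"
    \<comment> \<open>The part of \<open>u\<close> outside the span of the columns of
      \<open>Q\<close>; normalized at a nonzero entry it supplies one more independent column,
      against the maximality of \<open>b\<close>.\<close>
    define v where "v = u - Q * S * u"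
    have "v \<noteq> 0" using \<open>Q * S * u \<noteq> u\<close> by (simp add: v_def)
    have "v = u + Q * (- (S * u))" by (simp add: v_def mult.assoc)
    then have vH: "v \<in> H" using add u mul[OF QH] by presburger
    have Sv: "S * v = 0" unfolding v_def right_diff_distrib mult.assoc[symmetric] SQ Sb by simp
    obtain i j where c: "ent v i j \<noteq> 0" using \<open>v \<noteq> 0\<close> nonzero_entry by blast
    define q where "q = v * mu j b * cst (inverse (ent v i j))"
    define s where "s = mu b i * (1 - Q * S)"
    have "s * Q = 0" unfolding s_def left_diff_distrib right_diff_distrib mult.assoc SQ Qb by simp
    moreover have "S * q = 0" by (simp add: q_def mult.assoc[symmetric] Sv)
    moreover have "s * q = mu b b"
    proof -
      have "s * v = mu b i * v"
        unfolding s_def left_diff_distrib right_diff_distrib by (simp add: mult.assoc Sv)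
      then have "s * q = (mu b i * v * mu j b) * cst (inverse (ent v i j))"
        by (simp add: q_def mult.assoc[symmetric])
      also have "\<dots> = cst (inverse (ent v i j) * ent v i j) * mu b b"
        unfolding mu_mult_mult_mu by (subst cst_commute[symmetric]) (simp add: cst_mult mult.assoc)
      finally show ?thesis using c by simp
    qed
    ultimately have "(S + s) * (Q + q) = pr (Suc b)"
      by (simp add: distrib_left distrib_right SQ pr_Suc)
    moreover have "Q + q \<in> H" unfolding q_def mult.assoc by (intro add QH mul vH)
    ultimately show False using nP by blast
  qed
  then show thesis using that QH Qb Sb Se SQ by blast
qed

lemma inj_pairing: "inj (\<lambda>c. en (c div d) (c mod d))"
  by (rule injI) (metis Pair_inject div_mult_mod_eq prod_encode_eq)

text \<open>The dictionary between the \<open>div\<close>/\<open>mod\<close> indexing of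
  \<open>kronecker\<close> and the pairing behind \<open>\<boxtimes>\<close>; it shows that the
  corner has rank \<open>n * d\<close>.\<close>

lemma pairing_corner:
  fixes n d :: nat
  defines "g \<equiv> \<lambda>c. en (c div d) (c mod d)"
  shows "mp g * pr (n * d) * tp g = (pr n \<boxtimes> pr d :: 'a::field cfm)"
proof -
  have inj: "inj g" unfolding g_def by (rule inj_pairing)
  show ?thesis
  proof (rule cfm_eqI_en)
    fix i a j b
    show "ent (mp g * pr (n * d) * tp g) (en i a) (en j b) = ent (pr n \<boxtimes> pr d :: 'a cfm) (en i a) (en j b)"
    proof (cases "a < d")
      case True
      then have a: "en i a = g (i * d + a)" by (simp add: g_def)
      have lt: "i * d + a < n * d \<longleftrightarrow> i < n"
      proof
        assume "i * d + a < n * d"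
        then have "i * d < n * d" by linarith
        then show "i < n" by simp
      next
        assume "i < n"
        then have "Suc i * d \<le> n * d" by (intro mult_right_mono) auto
        then show "i * d + a < n * d" using True by simp
      qed
      have "ent (mp g * pr (n * d) * tp g) (en i a) (en j b) = ent (pr (n * d) * tp g :: 'a cfm) (i * d + a) (en j b)"
        unfolding mult.assoc by (subst a, subst ent_mp_mult[OF inj]) simp
      also have "\<dots> = (if i < n \<and> g (i * d + a) = en j b then 1 else 0)"
        using True by (simp add: ent_pr_mult lt ent_tp[OF inj])
      finally show ?thesis using True unfolding a[symmetric] by (auto simp: ent_pr)
    next
      case False
      have "ent (mp g * pr (n * d) * tp g) (en i a) (en j b) = (0 :: 'a)"
      proof (cases "d = 0")
        case True
        then show ?thesis by simp
      next
        case d: False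
        have "en i a \<notin> range g" using False d by (auto simp: g_def)
        then show ?thesis unfolding mult.assoc by (rule ent_mp_mult_0)
      qed
      then show ?thesis using False by (simp add: ent_pr)
    qed
  qed
qed

lemma fin_idem_kr: "fin_idem (pr n \<boxtimes> pr d) (n * d)"
proof -
  let ?g = "\<lambda>c. en (c div d) (c mod d)"
  define U V :: "'a cfm" where "U = mp ?g * pr (n * d)" and "V = pr (n * d) * tp ?g"
  have "V * U = pr (n * d)"
    by (simp add: U_def V_def mult.assoc) (simp add: mult.assoc[symmetric, of _ "mp _"] tp_mult_mp[OF inj_pairing])
  moreover have "U * pr (n * d) = U" by (simp add: U_def mult.assoc)
  moreover have "U * V = pr n \<boxtimes> pr d"
    unfolding pairing_corner[symmetric] by (simp add: U_def V_def mult.assoc)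
  ultimately show ?thesis unfolding fin_idem_def by blast
qed

lemma invertible_square:
  assumes "det (tomat s s B) \<noteq> 0" obtains C where "C * pr s * B * pr s = pr s"
proof -
  have B: "tomat s s B \<in> carrier_mat s s" by simp
  obtain C where C: "C \<in> carrier_mat s s" "C * tomat s s B = 1\<^sub>m s"
    using det_non_zero_imp_unit[OF B assms, of "()"] unfolding Units_def ring_mat_def by auto
  then have "tomat s s (frmat C * pr s * B) = tomat s s (pr s)"
    by (simp add: tomat_mult[symmetric] tomat_frmat tomat_pr)
  then have "pr s * (frmat C * pr s * B) * pr s = pr s * pr s * pr s" by (rule tomat_inj)
  then show thesis using that[of "pr s * frmat C"] by (simp add: mult.assoc)
qed

text \<open>The minor cut out by \<open>P\<close> and \<open>Q\<close> is a polynomial in the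
  parameter that does not vanish at \<open>c\<close>, so it has finitely many roots.\<close>

lemma rank_ge_line:
  assumes "rank_ge (A + cst c * B) s"
  shows "finite {t. \<not> rank_ge (A + cst t * B) s}"
proof -
  obtain P Q where PQ: "P * (A + cst c * B) * Q = pr s" using assms unfolding rank_ge_def by blast
  define M where "M = mat s s (\<lambda>(i, j). [:ent (P * A * Q) i j, ent (P * B * Q) i j:])"
  have M: "map_mat (\<lambda>p. poly p t) M = tomat s s (P * (A + cst t * B) * Q)" for t
  proof -
    have "P * (A + cst t * B) * Q = P * A * Q + cst t * (P * B * Q)"
      by (simp add: distrib_left distrib_right mult.assoc cst_left_commute)
    then show ?thesis by (intro eq_matI) (auto simp: M_def tomat_def)
  qed
  interpret comm_ring_hom "\<lambda>p. poly p t" for t :: 'a by unfold_locales auto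
  have det: "poly (det M) t = det (tomat s s (P * (A + cst t * B) * Q))" for t
    by (simp add: hom_det[symmetric] M)
  have "poly (det M) c \<noteq> 0" unfolding det PQ tomat_pr by simp
  then have "det M \<noteq> 0" by auto
  then have "finite {t. poly (det M) t = 0}" by (rule poly_roots_finite)
  moreover have "{t. \<not> rank_ge (A + cst t * B) s} \<subseteq> {t. poly (det M) t = 0}"
  proof
    fix t assume t: "t \<in> {t. \<not> rank_ge (A + cst t * B) s}"
    show "t \<in> {t. poly (det M) t = 0}"
    proof (rule ccontr)
      assume "t \<notin> {t. poly (det M) t = 0}"
      then have "det (tomat s s (P * (A + cst t * B) * Q)) \<noteq> 0" using det by simp
      then obtain C where "C * pr s * (P * (A + cst t * B) * Q) * pr s = pr s"
        by (rule invertible_square)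
      then have "(C * pr s * P) * (A + cst t * B) * (Q * pr s) = pr s" by (simp add: mult.assoc)
      then show False using t unfolding rank_ge_def by blast
    qed
  qed
  ultimately show ?thesis by (rule rev_finite_subset)
qed

section \<open>Blow-ups and the second Wong sequence\<close>

lemma pr_oi:
  assumes a: "a < d" shows "pr n * oi a = oi a * (pr n \<boxtimes> pr d)"
proof (rule cfm_eqI)
  fix i p
  obtain j b where p: "p = en j b" using en_ex by blast
  show "ent (pr n * oi a) i p = ent (oi a * (pr n \<boxtimes> pr d)) i p"
    unfolding p ent_oi_mult ent_pr_mult ent_kr ent_pr using a by (auto simp: oi_def ent_tp[OF inj_en1])
qed

definition corner :: "nat \<Rightarrow> nat \<Rightarrow> 'a::field cfm \<Rightarrow> bool" where
  "corner p q A \<longleftrightarrow> pr p * A = A \<and> A * pr q = A"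

definition blow :: "nat \<Rightarrow> (nat \<Rightarrow> 'a::field cfm) \<Rightarrow> (nat \<Rightarrow> 'a cfm) \<Rightarrow> 'a cfm" where
  "blow m X T = (\<Sum>k<m. X k \<boxtimes> T k)"

text \<open>The columns of \<open>Q\<close> span a subspace of dimension \<open>b\<close> whose image under all \<open>X\<^sub>k\<close> is annihilated by
  the \<open>a\<close> independent rows of \<open>P\<close>, and so has dimension at most \<open>n - a < b\<close>.\<close>

definition shrunk :: "nat \<Rightarrow> nat \<Rightarrow> (nat \<Rightarrow> 'a::field cfm) \<Rightarrow> bool" where
  "shrunk n m X \<longleftrightarrow> (\<exists>a b P R Q S. n < a + b \<and> P * pr n * R = pr a \<and> S * pr n * Q = pr b \<and>
     (\<forall>k<m. P * X k * Q = 0))"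

lemma blow_mult: "(A \<boxtimes> g) * blow m X T * (B \<boxtimes> h) = blow m (\<lambda>k. A * X k * B) (\<lambda>k. g * T k * h)"
  unfolding blow_def sum_distrib_left sum_distrib_right by (simp add: kr_mult)

lemma blow_mult_left: "(A \<boxtimes> g) * blow m X T = blow m (\<lambda>k. A * X k) (\<lambda>k. g * T k)"
  and blow_mult_right: "blow m X T * (B \<boxtimes> h) = blow m (\<lambda>k. X k * B) (\<lambda>k. T k * h)"
  using blow_mult[of A g m X T 1 1] blow_mult[of 1 1 m X T B h] by simp_all

lemma blow_cong: "(\<And>k. k < m \<Longrightarrow> X k = X' k) \<Longrightarrow> (\<And>k. k < m \<Longrightarrow> T k = T' k) \<Longrightarrow> blow m X T = blow m X' T'"
  unfolding blow_def by (rule sum.cong) auto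

lemma blow_corner:
  assumes "\<And>k. k < m \<Longrightarrow> corner n n' (X k)" "\<And>k. k < m \<Longrightarrow> corner p q (T k)"
  shows "(pr n \<boxtimes> pr p) * blow m X T = blow m X T" "blow m X T * (pr n' \<boxtimes> pr q) = blow m X T"
  unfolding blow_mult_left blow_mult_right
  by (rule blow_cong; use assms in \<open>simp add: corner_def\<close>)+

text \<open>The generators of the second Wong sequence, which alternates between preimages under
  \<open>A\<close> and images under \<open>BB\<close>, starting from the kernel \<open>V\<close>.
  The generalized inverse \<open>G\<close> selects a preimage. Single words are kept because one
  that leaves the image of \<open>A\<close> has to be turned into a block matrix.\<close>

inductive_set words :: "'a::field cfm set \<Rightarrow> 'a cfm \<Rightarrow> 'a cfm set \<Rightarrow> 'a cfm set" for BB G V where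
  base: "B \<in> BB \<Longrightarrow> v \<in> V \<Longrightarrow> B * v \<in> words BB G V"
| step: "B \<in> BB \<Longrightarrow> w \<in> words BB G V \<Longrightarrow> B * (G * w) \<in> words BB G V"

text \<open>Closure under sums is enough to obtain a subspace: the words to which it is applied
  absorb right multiplication, and scalars commute with everything.\<close>

inductive_set add_span :: "'a::field cfm set \<Rightarrow> 'a cfm set" for W where
  zero: "0 \<in> add_span W"
| add: "w \<in> W \<Longrightarrow> u \<in> add_span W \<Longrightarrow> w + u \<in> add_span W"

lemma add_span_incl: "w \<in> W \<Longrightarrow> w \<in> add_span W"
  using add_span.add[OF _ add_span.zero] by fastforce

lemma add_span_add: "u \<in> add_span W \<Longrightarrow> v \<in> add_span W \<Longrightarrow> u + v \<in> add_span W"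
  by (induction rule: add_span.induct) (auto simp: add.assoc intro: add_span.add)

lemma add_span_sum: "(\<And>x. x \<in> I \<Longrightarrow> f x \<in> add_span W) \<Longrightarrow> sum f I \<in> add_span W"
  by (induction I rule: infinite_finite_induct) (auto intro: add_span.zero add_span_add)

lemma add_span_map:
  assumes "u \<in> add_span W" "\<And>w. w \<in> W \<Longrightarrow> c * w * x \<in> add_span W'"
  shows "c * u * x \<in> add_span W'"
  using assms by (induction rule: add_span.induct)
    (auto simp: distrib_left distrib_right intro: add_span.zero add_span_add)

text \<open>The second Wong sequence of \<open>A\<close> in the space of all \<open>\<Sum>k X\<^sub>k \<otimes> S\<^sub>k\<close>: if it never leaves the
  image of \<open>A\<close>, then its limit has the form \<open>W\<^sub>0 \<otimes> K\<^sup>d\<close>, and \<open>W\<^sub>0\<close> contains the image of a space of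
  larger dimension.\<close>

lemma wong_escape:
  fixes X T :: "nat \<Rightarrow> 'a::field cfm"
  assumes X: "\<And>k. k < m \<Longrightarrow> corner n n (X k)" and T: "\<And>k. k < m \<Longrightarrow> corner d d (T k)"
    and d: "d > 0"
    and ns: "\<not> shrunk n m X"
    and A: "A = blow m X T"
    and G: "A * G * A = A" "(pr n \<boxtimes> pr d) * G = G"
    and BB: "BB = {blow m X S |S. \<forall>k<m. corner d d (S k)}"
    and V: "V = {v. A * v = 0 \<and> (pr n \<boxtimes> pr d) * v = v}"
    and ne: "G * A \<noteq> pr n \<boxtimes> pr d"
  shows "\<exists>w\<in>words BB G V. A * G * w \<noteq> w"
proof (rule ccontr)
  assume "\<not> ?thesis"
  then have noesc: "\<And>w. w \<in> words BB G V \<Longrightarrow> A * G * w = w" by blast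
  define W where "W = add_span (words BB G V)"
  have e2: "(pr n \<boxtimes> pr d) * (pr n \<boxtimes> pr d) = (pr n \<boxtimes> pr d :: 'a cfm)" by (simp add: kr_mult)
  have eA: "(pr n \<boxtimes> pr d) * A = A" "A * (pr n \<boxtimes> pr d) = A"
    unfolding A by (rule blow_corner[OF X T]; simp)+
  have AGw: "A * G * w = w" if "w \<in> W" for w
    using that unfolding W_def
    by (induction rule: add_span.induct) (auto simp: distrib_left noesc)
  have wr: "w * x \<in> words BB G V" if "w \<in> words BB G V" for w x
    using that
  proof induction
    case (base B v)
    then have "B * (v * x) \<in> words BB G V"
      by (intro words.base) (auto simp: V mult.assoc[symmetric])
    then show ?case by (simp add: mult.assoc)
  next
    case (step B w)
    then show ?case using words.step[of B BB "w * x" G V] by (simp add: mult.assoc)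
  qed
  have Wr: "w * x \<in> W" if "w \<in> W" for w x
  proof -
    have "1 * w * x \<in> add_span (words BB G V)"
      by (rule add_span_map[where W = "words BB G V"]) (use that wr in \<open>simp_all add: W_def add_span_incl\<close>)
    then show ?thesis by (simp add: W_def)
  qed
  \<comment> \<open>All coefficient tuples occur in \<open>BB\<close>, so \<open>BB\<close> is
    stable under \<open>1 \<boxtimes> g\<close>. The limit \<open>W\<close> inherits this, which
    forces it to be a tensor product with the whole of K^d.\<close>
  have BBl: "(1 \<boxtimes> g) * B \<in> BB" if "B \<in> BB" "corner d d g" for B g
  proof -
    from that(1) obtain S where S: "B = blow m X S" "\<forall>k<m. corner d d (S k)" unfolding BB by blast
    have "\<forall>k<m. corner d d (g * S k)"
      using S(2) that(2) unfolding corner_def by (metis mult.assoc)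
    then show ?thesis unfolding BB S(1) blow_mult_left by auto
  qed
  have wl: "(1 \<boxtimes> g) * w \<in> words BB G V" if "w \<in> words BB G V" "corner d d g" for w g
    using that(1)
  proof cases
    case (base B v)
    then show ?thesis using words.base[OF BBl[OF base(2) that(2)] base(3)] by (simp add: mult.assoc)
  next
    case (step B w)
    then show ?thesis using words.step[OF BBl[OF step(2) that(2)] step(3)] by (simp add: mult.assoc)
  qed
  have Wl: "(1 \<boxtimes> g) * w \<in> W" if "w \<in> W" "corner d d g" for w g
  proof -
    have "(1 \<boxtimes> g) * w * 1 \<in> add_span (words BB G V)"
      by (rule add_span_map[where W = "words BB G V"]) (use that wl in \<open>simp_all add: W_def add_span_incl\<close>)
    then show ?thesis by (simp add: W_def)
  qed
  have WB: "B * (G * w) \<in> W" if "B \<in> BB" "w \<in> W" for B w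
  proof -
    have "(B * G) * w * 1 \<in> add_span (words BB G V)"
      by (rule add_span_map[where W = "words BB G V"])
        (use that in \<open>simp_all add: W_def add_span_incl mult.assoc words.step\<close>)
    then show ?thesis by (simp add: W_def mult.assoc)
  qed
  have WV: "B * v \<in> W" if "B \<in> BB" "v \<in> V" for B v
    using words.base[OF that] add_span_incl unfolding W_def by blast
  have cmu: "corner d d (mu a b)" if "a < d" "b < d" for a b
    using that by (simp add: corner_def pr_mult_mu mu_mult_pr)
  \<comment> \<open>\<open>W0\<close> is the slice of \<open>W\<close> at coordinate 0 of K^d; by
    \<open>Wl\<close> it determines every other slice. \<open>U0\<close> is the largest subspace
    that every X_k maps into \<open>W0\<close>, hence the candidate for a shrunk subspace.\<close>
  define W0 where "W0 = {x. pr n * x = x \<and> io 0 * x \<in> W}"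
  define U0 where "U0 = {u. pr n * u = u \<and> (\<forall>k<m. X k * u \<in> W0)}"
  have W0z: "0 \<in> W0" unfolding W0_def W_def by (simp add: add_span.zero)
  have W0a: "u + v \<in> W0" if "u \<in> W0" "v \<in> W0" for u v
    using that unfolding W0_def W_def by (auto simp: distrib_left intro: add_span_add)
  have W0m: "u * x \<in> W0" if "u \<in> W0" for u x
    using that Wr[of "io 0 * u" x] unfolding W0_def by (auto simp: mult.assoc[symmetric])
  obtain p Wm Sw where Wm: "Wm \<in> W0" "Wm * pr p = Wm" "pr p * Sw = Sw" "Sw * pr n = Sw" "Sw * Wm = pr p"
    and Wmu: "\<And>u. u \<in> W0 \<Longrightarrow> Wm * Sw * u = u"
    by (rule right_ideal_basis[OF fin_idem_pr[of n], of W0]) (use W0z W0a W0m in \<open>auto simp: W0_def\<close>)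
  obtain b Qm S where Qm: "Qm \<in> U0" "Qm * pr b = Qm" "pr b * S = S" "S * pr n = S" "S * Qm = pr b"
    and Qmu: "\<And>u. u \<in> U0 \<Longrightarrow> Qm * S * u = u"
    by (rule right_ideal_basis[OF fin_idem_pr[of n], of U0])
      (use W0z W0a W0m in \<open>auto simp: U0_def distrib_left mult.assoc[symmetric]\<close>)
  have Qn: "pr n * Qm = Qm" and Wn: "pr n * Wm = Wm" using Qm(1) Wm(1) by (auto simp: U0_def W0_def)
  \<comment> \<open>If \<open>BB\<close> maps \<open>u\<close> into \<open>W\<close>, then
    \<open>u\<close> lies in U0 \<otimes> K^d: the element of \<open>BB\<close> built from
    \<open>X k\<close> and the matrix unit \<open>mu 0 a\<close> isolates slice \<open>a\<close> of
    \<open>u\<close> and applies \<open>X k\<close> to it.\<close>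
  have slices: "(Qm * S \<boxtimes> pr d) * u = u"
    if u: "(pr n \<boxtimes> pr d) * u = u" and Bu: "\<And>B. B \<in> BB \<Longrightarrow> B * u \<in> W" for u
  proof -
    have "oi a * u \<in> U0" if a: "a < d" for a
    proof -
      have "pr n * oi a * u = oi a * (pr n \<boxtimes> pr d) * u"
      proof -
        have "pr n * oi a = oi a * (pr n \<boxtimes> pr d :: 'a cfm)" by (rule pr_oi[OF a])
        then show ?thesis by simp
      qed
      then have 1: "pr n * (oi a * u) = oi a * u" using u by (simp add: mult.assoc)
      have "X k * (oi a * u) \<in> W0" if k: "k < m" for k
      proof -
        have "io 0 * X k * oi a = blow m X (\<lambda>j. if j = k then mu 0 a else 0)"
          using k unfolding io_mult_mult_oi blow_def by (simp add: if_distrib cong: if_cong)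
        also have "\<dots> \<in> BB" unfolding BB using cmu[of 0 a] d a by (auto simp: corner_def)
        finally have "io 0 * X k * oi a * u \<in> W" by (rule Bu)
        moreover have "pr n * X k = X k" using X[OF k] by (simp add: corner_def)
        ultimately show ?thesis unfolding W0_def by (simp add: mult.assoc) (metis mult.assoc)
      qed
      then show ?thesis using 1 unfolding U0_def by blast
    qed
    then have sl: "Qm * S * (oi a * u) = oi a * u" if "a < d" for a using that Qmu by blast
    have "(Qm * S \<boxtimes> pr d) * u = (\<Sum>a<d. io a * (Qm * S * (oi a * u)))"
      unfolding pr_eq_sum kr_sum_right sum_distrib_right
      by (rule sum.cong) (auto simp: io_mult_mult_oi[symmetric] mult.assoc)
    also have "\<dots> = (\<Sum>a<d. io a * (oi a * u))" by (rule sum.cong) (auto simp: sl)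
    also have "\<dots> = (1 \<boxtimes> pr d) * u"
      unfolding pr_eq_sum kr_sum_right sum_distrib_right
      by (rule sum.cong) (auto simp: io_mult_oi[symmetric] mult.assoc)
    also have "\<dots> = (1 \<boxtimes> pr d) * (pr n \<boxtimes> pr d) * u" using u by (simp add: mult.assoc)
    also have "\<dots> = u" using u by (simp add: kr_mult)
    finally show ?thesis .
  qed
  have WmW: "Wm \<boxtimes> pr d \<in> W"
  proof -
    have "Wm \<boxtimes> mu a a \<in> W" if a: "a < d" for a
    proof -
      have "(1 \<boxtimes> mu a 0) * (io 0 * Wm) \<in> W"
        by (rule Wl) (use Wm(1) cmu a d in \<open>auto simp: W0_def\<close>)
      then have "(1 \<boxtimes> mu a 0) * (io 0 * Wm) * oi a \<in> W" by (rule Wr)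
      also have "(1 \<boxtimes> mu a 0) * (io 0 * Wm) * oi a = Wm \<boxtimes> mu a a"
        using kr_mu_io[of "1 :: 'a cfm" a 0 0] by (simp add: mult.assoc[symmetric] io_mult_mult_oi)
      finally show ?thesis .
    qed
    then show ?thesis unfolding pr_eq_sum kr_sum_right W_def by (intro add_span_sum) auto
  qed
  \<comment> \<open>The restriction of \<open>A\<close> to U0 \<otimes> K^d, with values in W0
    \<otimes> K^d, written in the bases \<open>Qm\<close> and \<open>Wm\<close>.\<close>
  define A' where "A' = blow m (\<lambda>k. Sw * X k * Qm) T"
  have AQ: "A * (Qm \<boxtimes> pr d) = (Wm \<boxtimes> pr d) * A'"
    unfolding A A'_def blow_mult_left blow_mult_right
  proof (rule blow_cong)
    fix k assume k: "k < m"
    then have "X k * Qm \<in> W0" using Qm(1) by (auto simp: U0_def)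
    then show "X k * Qm = Wm * (Sw * X k * Qm)" using Wmu by (simp add: mult.assoc)
    show "T k * pr d = pr d * T k" using T[OF k] by (simp add: corner_def)
  qed
  have A'c: "(pr p \<boxtimes> pr d) * A' = A'" "A' * (pr b \<boxtimes> pr d) = A'"
  proof -
    have "corner p b (Sw * X k * Qm)" for k
      using Wm(3) Qm(2) by (simp add: corner_def mult.assoc) (simp add: mult.assoc[symmetric])
    then show "(pr p \<boxtimes> pr d) * A' = A'" "A' * (pr b \<boxtimes> pr d) = A'"
      unfolding A'_def using blow_corner[of m p b "\<lambda>k. Sw * X k * Qm" d d T] T by blast+
  qed
  \<comment> \<open>\<open>u\<close> lifts W0 \<otimes> K^d through \<open>A\<close>. The lift stays
    in U0 \<otimes> K^d because \<open>BB\<close> maps it back into \<open>W\<close>; in coordinates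
    it is a right inverse \<open>C\<close> of \<open>A'\<close>.\<close>
  define u where "u = G * (Wm \<boxtimes> pr d)"
  define C where "C = (S \<boxtimes> pr d) * u"
  have u: "(Qm * S \<boxtimes> pr d) * u = u"
    unfolding u_def
  proof (rule slices)
    show "(pr n \<boxtimes> pr d) * (G * (Wm \<boxtimes> pr d)) = G * (Wm \<boxtimes> pr d)"
      by (simp add: mult.assoc[symmetric] G)
  qed (rule WB[OF _ WmW])
  have Au: "A * u = Wm \<boxtimes> pr d" using AGw[OF WmW] by (simp add: u_def mult.assoc)
  have "(Wm \<boxtimes> pr d) * A' * C = A * ((Qm \<boxtimes> pr d) * (S \<boxtimes> pr d) * u)"
    unfolding AQ[symmetric] C_def by (simp add: mult.assoc)
  also have "\<dots> = Wm \<boxtimes> pr d" using u Au by (simp add: kr_mult)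
  finally have "(Sw \<boxtimes> pr d) * ((Wm \<boxtimes> pr d) * A' * C) = (Sw \<boxtimes> pr d) * (Wm \<boxtimes> pr d)" by simp
  then have A'C: "A' * C = pr p \<boxtimes> pr d" using A'c Wm by (simp add: mult.assoc[symmetric] kr_mult)
  \<comment> \<open>As \<open>A'\<close> is surjective, \<open>b \<le> p\<close> would make it
    invertible. But the kernel of \<open>A\<close> lies in U0 \<otimes> K^d, so \<open>A\<close>
    would be injective on its corner, contrary to \<open>ne\<close>.\<close>
  have "p < b"
  proof (rule ccontr)
    assume "\<not> p < b"
    obtain U1 V1 :: "'a cfm" where UV: "V1 * U1 = pr (p * d)" "U1 * V1 = pr p \<boxtimes> pr d" "U1 * pr (p * d) = U1"
      using fin_idem_kr[of p d] unfolding fin_idem_def by blast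
    have "(V1 * A') * (pr b \<boxtimes> pr d) * (C * U1) = pr (p * d)"
      by (metis A'C A'c(2) UV mult.assoc pr_idem)
    then have "(pr b \<boxtimes> pr d) * (C * U1) * (V1 * A') * (pr b \<boxtimes> pr d) = pr b \<boxtimes> pr d"
    proof (rule contrapos_pp)
      assume "(pr b \<boxtimes> pr d) * (C * U1) * (V1 * A') * (pr b \<boxtimes> pr d) \<noteq> pr b \<boxtimes> pr d"
      then show "V1 * A' * (pr b \<boxtimes> pr d) * (C * U1) \<noteq> pr (p * d)"
        using rank_ge_extend[of "V1 * A'" "pr b \<boxtimes> pr d" "C * U1" "p * d"]
          rank_ge_fin_idem[OF fin_idem_kr[of b d]] \<open>\<not> p < b\<close> mult_le_mono1[of b p d] by fastforce
    qed
    then have CA: "(pr b \<boxtimes> pr d) * C * A' = pr b \<boxtimes> pr d"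
      using A'c UV(2) by (metis mult.assoc)
    have "v = 0" if v: "v \<in> V" for v
    proof -
      have v1: "(Qm * S \<boxtimes> pr d) * v = v" by (rule slices) (use v WV in \<open>auto simp: V\<close>)
      define v' where "v' = (S \<boxtimes> pr d) * v"
      have bv: "(pr b \<boxtimes> pr d) * v' = v'"
        unfolding v'_def mult.assoc[symmetric] kr_mult by (simp add: Qm)
      have Qv: "(Qm \<boxtimes> pr d) * v' = v"
        using v1 unfolding v'_def mult.assoc[symmetric] kr_mult by simp
      have "(Wm \<boxtimes> pr d) * (A' * v') = 0"
        using v Qv AQ unfolding V by (metis (mono_tags, lifting) mem_Collect_eq mult.assoc)
      then have "(Sw \<boxtimes> pr d) * (Wm \<boxtimes> pr d) * (A' * v') = 0" by (simp add: mult.assoc)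
      then have "A' * v' = 0" using A'c Wm by (simp add: mult.assoc[symmetric] kr_mult)
      then have "v' = 0" using CA bv by (metis mult.assoc mult_zero_right)
      then show ?thesis using Qv by simp
    qed
    moreover have "pr n \<boxtimes> pr d - G * A \<in> V"
      unfolding V by (simp add: right_diff_distrib eA e2 G mult.assoc[symmetric])
    ultimately have "pr n \<boxtimes> pr d - G * A = 0" by blast
    then show False using ne by simp
  qed
  \<comment> \<open>A projection with kernel W0. Its rank \<open>a\<close> is at least
    \<open>n - p\<close>, its rows annihilate all the images X_k U0, and \<open>p < b\<close> then
    gives \<open>n < a + b\<close>.\<close>
  define E where "E = pr n - Wm * Sw"
  have En: "pr n * E = E" by (simp add: E_def right_diff_distrib mult.assoc[symmetric] Wn)
  have EW: "E * Wm = 0" by (simp add: E_def left_diff_distrib mult.assoc Wm Wn)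
  have En': "E * pr n = E" by (simp add: E_def left_diff_distrib mult.assoc Wm)
  have EE: "E * E = E" by (subst (2) E_def) (simp add: right_diff_distrib En' mult.assoc[symmetric] EW)
  obtain a P' Q' where N: "P' * E * Q' = pr a" "E * Q' * P' * E = E" "pr a * P' = P'" "Q' * pr a = Q'"
    using rank_normal_form[OF fin_idem_pr disjI1[OF En]] by metis
  have "(Wm * Sw) + E * Q' * P' * E = pr n" unfolding N by (simp add: E_def)
  then have "Wm * pr p * Sw + (E * Q') * pr a * (P' * E) = pr n"
    using Wm N by (simp add: mult.assoc)
  then have "n \<le> p + a" by (rule pr_sub_additive)
  then have "n < a + b" using \<open>p < b\<close> by simp
  moreover have "(P' * E) * pr n * (E * Q') = pr a" using N by (simp add: mult.assoc) (metis EE En mult.assoc)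
  moreover have "S * pr n * Qm = pr b" using Qm by simp
  moreover have "(P' * E) * X k * Qm = 0" if "k < m" for k
  proof -
    have "X k * Qm = Wm * Sw * (X k * Qm)" using Wmu Qm(1) that by (auto simp: U0_def)
    then have "(P' * E) * X k * Qm = P' * (E * Wm) * Sw * (X k * Qm)" by (metis mult.assoc)
    then show ?thesis by (simp add: EW)
  qed
  ultimately show False using ns unfolding shrunk_def by blast
qed

section \<open>Block matrices built from a path\<close>

lemma words_path:
  assumes "w \<in> words BB G V"
  shows "\<exists>c B u. (\<forall>b\<le>c. B b \<in> BB) \<and> u 0 \<in> V \<and> (\<forall>b<c. u (Suc b) = G * (B b * u b)) \<and> w = B c * u c"
  using assms
proof induction
  case (base B v)
  then show ?case by (intro exI[of _ 0] exI[of _ "\<lambda>_. B"] exI[of _ "\<lambda>_. v"]) auto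
next
  case (step B w)
  from step.IH obtain c Bs u where IH: "\<forall>b\<le>c. Bs b \<in> BB" "u 0 \<in> V"
    "\<forall>b<c. u (Suc b) = G * (Bs b * u b)" "w = Bs c * u c" by blast
  show ?case
    by (rule exI[of _ "Suc c"], rule exI[of _ "Bs(Suc c := B)"], rule exI[of _ "u(Suc c := G * w)"])
      (use IH step.hyps in \<open>auto simp: less_Suc_eq le_Suc_eq\<close>)
qed

lemma nilpotent_left_inverse:
  fixes N :: "'a::ring_1"
  assumes "N ^ c = 0" obtains L where "L * (1 - N) = 1"
proof -
  have "(\<Sum>i<c. N ^ i) * (1 - N) = 1 - N ^ c"
  proof (induction c)
    case (Suc c)
    have "(\<Sum>i<Suc c. N ^ i) * (1 - N) = (\<Sum>i<c. N ^ i) * (1 - N) + N ^ c * (1 - N)"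
      by (simp add: distrib_right)
    also have "\<dots> = 1 - N ^ Suc c" unfolding Suc by (simp add: right_diff_distrib power_Suc2 del: power_Suc)
    finally show ?case .
  qed simp
  then show thesis using that assms by simp
qed

lemma io_ext:
  assumes "\<And>b. Z * io b = (Z' * io b :: 'a::field cfm)" shows "Z = Z'"
proof (rule cfm_eqI)
  fix i p
  obtain j b where p: "p = en j b" using en_ex by blast
  show "ent Z i p = ent Z' i p"
    using arg_cong[OF assms[of b], of "\<lambda>A. ent A i j"] by (simp add: p ent_mult_io)
qed

lemma pr_mu_io: "b < c \<Longrightarrow> (X \<boxtimes> pr c) * io b = io b * X"
  unfolding pr_eq_sum kr_sum_right sum_distrib_right by (simp add: kr_mu_io)

lemma shift_io: "(\<Sum>b<c. B b \<boxtimes> mu (Suc b) b) * io a = (if a < c then io (Suc a) * B a else 0)"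
  unfolding sum_distrib_right by (simp add: kr_mu_io)

text \<open>Every application raises the block index by one, and index \<open>c\<close> is sent to
  zero.\<close>

lemma shift_nilpotent: "(\<Sum>b<c. B b \<boxtimes> mu (Suc b) b) ^ Suc c = (0 :: 'a::field cfm)"
proof (rule io_ext)
  let ?N = "\<Sum>b<c. B b \<boxtimes> mu (Suc b) b"
  have "\<forall>a. c \<le> a + j \<longrightarrow> ?N ^ Suc j * io a = 0" for j
  proof (induction j)
    case (Suc j)
    show ?case
    proof (intro allI impI)
      fix a assume "c \<le> a + Suc j"
      then have "?N ^ Suc j * io (Suc a) = 0" using Suc by simp
      moreover have "?N ^ Suc (Suc j) * io a = ?N ^ Suc j * (?N * io a)"
        unfolding power_Suc2[of ?N "Suc j"] mult.assoc ..
      ultimately show "?N ^ Suc (Suc j) * io a = 0"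
        unfolding shift_io by (simp add: mult.assoc[symmetric] del: power_Suc)
    qed
  qed (simp add: shift_io)
  then show "?N ^ Suc c * io b = 0 * io b" for b by (simp del: power_Suc)
qed

text \<open>The pairing function is not associative, so the two bracketings of a triple product
  differ by a permutation \<alpha> of the coordinates.\<close>

lemma kr_assoc:
  obtains \<alpha> \<alpha>' :: "'a::field cfm" where "\<alpha> * \<alpha>' = 1" "\<And>X T E. ((X \<boxtimes> T) \<boxtimes> E) * \<alpha> = \<alpha> * (X \<boxtimes> (T \<boxtimes> E))"
proof -
  define f where "f = (\<lambda>p. case prod_decode p of (i, q) \<Rightarrow> case prod_decode q of (a, b) \<Rightarrow> en (en i a) b)"
  define g where "g = (\<lambda>p. case prod_decode p of (q, b) \<Rightarrow> case prod_decode q of (i, a) \<Rightarrow> en i (en a b))"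
  have f: "f (en i (en a b)) = en (en i a) b" and g: "g (en (en i a) b) = en i (en a b)" for i a b
    by (simp_all add: f_def g_def)
  have gf: "g (f p) = p" for p using en_ex f g by metis
  have fg: "f (g p) = p" for p using en_ex f g by metis
  have inj: "inj f" using gf by (rule inj_on_inverseI)
  have "mp f * mp g = (1 :: 'a cfm)"
    unfolding mp_comp by (rule cfm_eqI) (simp add: ent_mp fg ent_1)
  moreover have "((X \<boxtimes> T) \<boxtimes> E) * mp f = (mp f * (X \<boxtimes> (T \<boxtimes> E)) :: 'a cfm)" for X T E
  proof (rule cfm_eqI)
    fix p q
    obtain i a b j a' b' where p: "p = en (en i a) b" and q: "q = en j (en a' b')" using en_ex by metis
    have "ent (mp f * (X \<boxtimes> (T \<boxtimes> E))) p q = ent (X \<boxtimes> (T \<boxtimes> E)) (en i (en a b)) q"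
      unfolding p f[symmetric] by (rule ent_mp_mult[OF inj])
    then show "ent (((X \<boxtimes> T) \<boxtimes> E) * mp f) p q = ent (mp f * (X \<boxtimes> (T \<boxtimes> E))) p q"
      by (simp add: ent_mult_mp q f p mult.assoc)
  qed
  ultimately show thesis by (rule that)
qed

lemma blow_unnest:
  fixes X Th :: "nat \<Rightarrow> 'a::field cfm"
  assumes Th: "\<And>k. k < m \<Longrightarrow> Th k = (pr d \<boxtimes> pr c) * Th k * (pr d \<boxtimes> pr c)"
    and rk: "rank_ge (blow m X Th) s"
  obtains T' where "\<And>k. corner (d * c) (d * c) (T' k)" "rank_ge (blow m X T') s"
proof -
  let ?ed = "pr d \<boxtimes> pr c :: 'a cfm"
  obtain Ud Vd where Ud: "Vd * Ud = pr (d * c)" "Ud * Vd = ?ed" "Ud * pr (d * c) = Ud"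
    using fin_idem_kr[of d c] unfolding fin_idem_def by blast
  define T' where "T' = (\<lambda>k. pr (d * c) * Vd * Th k * Ud)"
  have "blow m X Th = blow m (\<lambda>k. 1 * X k * 1) (\<lambda>k. Ud * T' k * Vd)"
  proof (rule blow_cong)
    fix k assume "k < m"
    have "Ud * T' k * Vd = (Ud * pr (d * c)) * Vd * Th k * (Ud * Vd)" by (simp add: T'_def mult.assoc)
    also have "\<dots> = ?ed * Th k * ?ed" by (simp only: Ud)
    finally show "Th k = Ud * T' k * Vd" using Th[OF \<open>k < m\<close>] by simp
  qed simp
  then have "blow m X Th = (1 \<boxtimes> Ud) * blow m X T' * (1 \<boxtimes> Vd)" by (simp add: blow_mult)
  then have "rank_ge (blow m X T') s" using rk by (metis rank_ge_mult)
  moreover have "corner (d * c) (d * c) (T' k)" for k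
    unfolding corner_def T'_def by (simp add: mult.assoc Ud)
  ultimately show thesis using that by blast
qed

text \<open>A path through which the Wong sequence leaves the image of \<open>A\<close> becomes the subdiagonal of a
  larger block matrix with diagonal \<open>A, \<dots>, A\<close>; the vector \<open>vh\<close> below witnesses that its rank
  exceeds the rank of the diagonal.\<close>

lemma rank_increment:
  fixes X T :: "nat \<Rightarrow> 'a::field cfm"
  assumes X: "\<And>k. k < m \<Longrightarrow> corner n n (X k)" and T: "\<And>k. k < m \<Longrightarrow> corner d d (T k)"
    and ns: "\<not> shrunk n m X"
    and rk: "\<And>t. rank_ge (blow m X T) t \<longleftrightarrow> t \<le> s" and s: "s < n * d"
  obtains c T' where "c > 0" "\<And>k. k < m \<Longrightarrow> corner (d * c) (d * c) (T' k)" "rank_ge (blow m X T') (Suc (s * c))"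
proof -
  define A where "A = blow m X T"
  let ?e = "pr n \<boxtimes> pr d :: 'a cfm"
  have d: "d > 0" using s by (cases d) auto
  have eA: "?e * A = A" "A * ?e = A" unfolding A_def by (rule blow_corner[OF X T]; simp)+
  obtain r P Q where N: "P * A * Q = pr r" "A * Q * P * A = A" "pr r * P = P" "Q * pr r = Q"
    "\<And>t. rank_ge A t \<longleftrightarrow> t \<le> r" using rank_normal_form[OF fin_idem_kr disjI1[OF eA(1)]] by metis
  have rs: "r = s" using N(5) rk unfolding A_def by (metis le_antisym order_refl)
  define G where "G = ?e * Q * P"
  have AG: "A * G = A * Q * P" using eA by (simp add: G_def mult.assoc[symmetric])
  have AGA: "A * G * A = A" using N by (simp add: AG)
  have PAG: "P * A * G = P" using N by (simp add: mult.assoc AG) (simp add: mult.assoc[symmetric])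
  have eG: "?e * G = G" by (simp add: G_def mult.assoc[symmetric] kr_mult)
  have ne: "G * A \<noteq> ?e"
  proof
    assume "G * A = ?e"
    then have "?e * Q * pr r * (P * A) = ?e" using N by (simp add: G_def mult.assoc)
    moreover have "rank_ge ?e (n * d)" using rank_ge_fin_idem[OF fin_idem_kr] by blast
    ultimately have "n * d \<le> r" using rank_ge_factor by metis
    then show False using s rs by simp
  qed
  define BB where "BB = {blow m X S |S. \<forall>k<m. corner d d (S k)}"
  define V where "V = {v. A * v = 0 \<and> ?e * v = v}"
  obtain w where w: "w \<in> words BB G V" "A * G * w \<noteq> w"
    using wong_escape[OF X T d ns A_def AGA eG BB_def V_def ne] by blast
  obtain c0 B u where B: "\<forall>b\<le>c0. B b \<in> BB" and u0: "u 0 \<in> V"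
    and u: "\<forall>b<c0. u (Suc b) = G * (B b * u b)" and wB: "w = B c0 * u c0"
    using words_path[OF w(1)] by blast
  \<comment> \<open>The path uses \<open>c0 + 1\<close> matrices \<open>B b\<close>, hence
    \<open>Suc c\<close> diagonal blocks. The additional last vector of \<open>u'\<close> is the
    attempted lift \<open>G * w\<close>, and only its block reveals that \<open>w\<close> is not in
    the image of \<open>A\<close>.\<close>
  define c where "c = Suc c0"
  define u' where "u' = (\<lambda>b. if b \<le> c0 then u b else G * (B c0 * u c0))"
  have u': "u' (Suc b) = G * (B b * u' b)" if "b < c" for b
    using that u by (auto simp: u'_def c_def less_Suc_eq)
  define M where "M = A \<boxtimes> pr (Suc c) - (\<Sum>b<c. B b \<boxtimes> mu (Suc b) b)"
  define vh where "vh = (\<Sum>b<Suc c. io b * u' b)"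
  \<comment> \<open>The defect of \<open>B b * u' b\<close> relative to the image of
    \<open>A\<close>. It is annihilated by \<open>P\<close> for every \<open>b\<close>, and it is
    nonzero for \<open>b = c0\<close>.\<close>
  define D where "D = (\<lambda>b. (A * G - 1) * (B b * u' b))"
  have Mio: "M * io b = io b * A - (if b < c then io (Suc b) * B b else 0)" if "b < Suc c" for b
    unfolding M_def left_diff_distrib shift_io using that by (simp add: pr_mu_io)
  have "M * vh = (\<Sum>b<Suc c. io b * (A * u' b)) - (\<Sum>b<Suc c. if b < c then io (Suc b) * (B b * u' b) else 0)"
    unfolding vh_def sum_distrib_left sum_subtractf[symmetric]
    by (rule sum.cong) (auto simp: mult.assoc[symmetric] Mio left_diff_distrib)
  also have "(\<Sum>b<Suc c. if b < c then io (Suc b) * (B b * u' b) else 0) = (\<Sum>b<c. io (Suc b) * (B b * u' b))"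
    by (subst sum.lessThan_Suc) auto
  also have "(\<Sum>b<Suc c. io b * (A * u' b)) = io 0 * (A * u' 0) + (\<Sum>b<c. io (Suc b) * (A * u' (Suc b)))"
    by (rule sum.lessThan_Suc_shift)
  also have "A * u' 0 = 0" using u0 by (simp add: u'_def V_def)
  also have "(\<Sum>b<c. io (Suc b) * (A * u' (Suc b))) = (\<Sum>b<c. io (Suc b) * (A * G * (B b * u' b)))"
    by (rule sum.cong) (auto simp: u' mult.assoc)
  finally have Mv: "M * vh = (\<Sum>b<c. io (Suc b) * D b)"
    by (simp add: D_def sum_subtractf[symmetric] right_diff_distrib[symmetric] left_diff_distrib)
  have "oi c * (M * vh) = D c0"
    unfolding Mv sum_distrib_left mult.assoc[symmetric] oi_mult_io by (simp add: c_def)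
  also have "\<dots> \<noteq> 0" using w wB by (simp add: D_def u'_def left_diff_distrib)
  finally have Mv0: "M * vh \<noteq> 0" by auto
  have PMv: "(P \<boxtimes> pr (Suc c)) * (M * vh) = 0"
    unfolding Mv sum_distrib_left
  proof (rule sum.neutral, rule ballI)
    fix b assume "b \<in> {..<c}"
    then have "(P \<boxtimes> pr (Suc c)) * (io (Suc b) * D b) = io (Suc b) * ((P * A * G - P) * (B b * u' b))"
      by (simp add: mult.assoc[symmetric] pr_mu_io D_def right_diff_distrib)
    then show "(P \<boxtimes> pr (Suc c)) * (io (Suc b) * D b) = 0" by (simp add: PAG)
  qed
  \<comment> \<open>Compressed by \<open>P\<close> and \<open>Q\<close>, the matrix \<open>M\<close>
    becomes the identity minus a nilpotent matrix, so it contains an invertible block of size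
    \<open>r * Suc c\<close>.\<close>
  define N' where "N' = (\<Sum>b<c. (P * B b * Q) \<boxtimes> mu (Suc b) b)"
  let ?es = "pr r \<boxtimes> pr (Suc c) :: 'a cfm"
  have "N' = (P \<boxtimes> pr (Suc c)) * (\<Sum>b<c. B b \<boxtimes> mu (Suc b) b) * (Q \<boxtimes> pr (Suc c))"
    unfolding N'_def sum_distrib_left sum_distrib_right
    by (rule sum.cong) (auto simp: kr_mult pr_mult_mu mu_mult_pr)
  then have PMQ: "(P \<boxtimes> pr (Suc c)) * M * (Q \<boxtimes> pr (Suc c)) = ?es - N'"
    unfolding M_def right_diff_distrib left_diff_distrib by (simp add: kr_mult N)
  have N'e: "N' * ?es = N'"
    unfolding N'_def sum_distrib_right
    by (rule sum.cong) (auto simp: kr_mult pr_mult_mu mu_mult_pr mult.assoc N)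
  obtain L where "L * (1 - N') = 1"
    using nilpotent_left_inverse[OF shift_nilpotent[of "\<lambda>b. P * B b * Q" c]] unfolding N'_def by blast
  then have L: "L * (?es - N') = ?es"
    using N'e by (metis left_diff_distrib mult.assoc mult_1_left)
  obtain U V' where UV: "V' * U = pr (r * Suc c)" "U * V' = ?es" "U * pr (r * Suc c) = U"
    using fin_idem_kr[of r "Suc c"] unfolding fin_idem_def by blast
  define P2 Q2 where "P2 = V' * L * (P \<boxtimes> pr (Suc c))" and "Q2 = (Q \<boxtimes> pr (Suc c)) * U"
  have "P2 * M * Q2 = V' * (L * ((P \<boxtimes> pr (Suc c)) * M * (Q \<boxtimes> pr (Suc c)))) * U"
    by (simp add: P2_def Q2_def mult.assoc)
  also have "\<dots> = V' * ?es * U" unfolding PMQ L ..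
  also have "\<dots> = V' * U * (V' * U)" unfolding UV(2)[symmetric] by (simp add: mult.assoc)
  also have "\<dots> = pr (r * Suc c)" unfolding UV by simp
  finally have P2: "P2 * M * Q2 = pr (r * Suc c)" .
  \<comment> \<open>The projection on the block found so far kills \<open>M * vh\<close>, which is
    nonzero; so the Schur complement is nonzero and the rank grows by one.\<close>
  have "M * Q2 * P2 * M * vh = 0" using PMv by (simp add: P2_def mult.assoc)
  then have "M * Q2 * P2 * M \<noteq> M" using Mv0 by auto
  then have rkM: "rank_ge M (Suc (r * Suc c))" using rank_ge_extend[OF P2] by blast
  from B have "\<forall>b. \<exists>S. b < c \<longrightarrow> B b = blow m X S \<and> (\<forall>k<m. corner d d (S k))"
    unfolding BB_def c_def by (auto simp: less_Suc_eq_le)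
  then obtain S where S: "\<And>b. b < c \<Longrightarrow> B b = blow m X (S b)"
    and Sc: "\<And>b k. b < c \<Longrightarrow> k < m \<Longrightarrow> corner d d (S b k)" by metis
  \<comment> \<open>Collecting the coefficients of each X_k shows that \<open>M\<close> is itself a
    blow-up, up to the reassociation \<alpha>.\<close>
  define Th where "Th = (\<lambda>k. T k \<boxtimes> pr (Suc c) - (\<Sum>b<c. S b k \<boxtimes> mu (Suc b) b))"
  obtain \<alpha> \<alpha>' :: "'a cfm" where al: "\<alpha> * \<alpha>' = 1"
    "\<And>X T E. ((X \<boxtimes> T) \<boxtimes> E) * \<alpha> = \<alpha> * (X \<boxtimes> (T \<boxtimes> E))" using kr_assoc by metis
  have bal: "(blow m X S \<boxtimes> E) * \<alpha> = \<alpha> * blow m X (\<lambda>k. S k \<boxtimes> E)" for S E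
    unfolding blow_def kr_sum_left sum_distrib_left sum_distrib_right by (simp add: al)
  have "M * \<alpha> = \<alpha> * blow m X (\<lambda>k. T k \<boxtimes> pr (Suc c)) - (\<Sum>b<c. \<alpha> * blow m X (\<lambda>k. S b k \<boxtimes> mu (Suc b) b))"
    unfolding M_def left_diff_distrib sum_distrib_right A_def bal
    by (rule arg_cong2[of _ _ _ _ "(-)"], simp, rule sum.cong) (auto simp: S bal)
  also have "\<dots> = \<alpha> * blow m X Th"
    unfolding Th_def blow_def kr_diff_right kr_sum_right sum_subtractf right_diff_distrib sum_distrib_left
    by (subst sum.swap) simp
  finally have "M * \<alpha> * \<alpha>' = \<alpha> * blow m X Th * \<alpha>'" by simp
  then have M: "M = \<alpha> * blow m X Th * \<alpha>'" using al by (simp add: mult.assoc)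
  have rkT: "rank_ge (blow m X Th) (Suc (r * Suc c))"
    using rkM unfolding M by (rule rank_ge_mult)
  let ?ed = "pr d \<boxtimes> pr (Suc c) :: 'a cfm"
  have Th: "Th k = ?ed * Th k * ?ed" if k: "k < m" for k
  proof -
    have 1: "?ed * (S b k \<boxtimes> mu (Suc b) b) * ?ed = S b k \<boxtimes> mu (Suc b) b" if "b < c" for b
      using Sc[OF that k] that by (simp add: kr_mult corner_def pr_mult_mu mu_mult_pr)
    have "?ed * Th k * ?ed = T k \<boxtimes> pr (Suc c) - (\<Sum>b<c. ?ed * (S b k \<boxtimes> mu (Suc b) b) * ?ed)"
      using T[OF k] unfolding Th_def right_diff_distrib left_diff_distrib sum_distrib_left sum_distrib_right
      by (simp add: kr_mult corner_def)
    also have "\<dots> = Th k" unfolding Th_def by (simp add: 1)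
    finally show ?thesis by simp
  qed
  obtain T' where "\<And>k. corner (d * Suc c) (d * Suc c) (T' k)" "rank_ge (blow m X T') (Suc (r * Suc c))"
    using blow_unnest[OF Th rkT] by blast
  then show thesis using that[of "Suc c" T'] rs by simp
qed

section \<open>Regularity of the rank of blow-ups\<close>

text \<open>Entrywise application. The case split keeps columns finite when \<open>h\<close> is not
  known to preserve zero.\<close>

lift_definition mapc :: "('a::field \<Rightarrow> 'b::field) \<Rightarrow> 'a cfm \<Rightarrow> 'b cfm"
  is "\<lambda>h A i j. if A i j = 0 then 0 else h (A i j)"
proof -
  fix h :: "'a \<Rightarrow> 'b" and A :: "nat \<Rightarrow> nat \<Rightarrow> 'a" and j
  assume "\<And>j. finite {i. A i j \<noteq> 0}"
  then have "finite {i. A i j \<noteq> 0}" .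
  then show "finite {i. (if A i j = 0 then 0 else h (A i j)) \<noteq> 0}" by (rule rev_finite_subset) auto
qed

context field_hom begin

lemma ent_mapc [simp]: "ent (mapc hom A) i j = hom (ent A i j)"
  by (simp add: mapc.rep_eq)

lemma mapc_add: "mapc hom (A + B) = mapc hom A + mapc hom B"
  by (rule cfm_eqI) (simp add: hom_distribs)
lemma mapc_diff: "mapc hom (A - B) = mapc hom A - mapc hom B"
  by (rule cfm_eqI) (simp add: hom_distribs)
lemma mapc_0: "mapc hom 0 = 0"
  by (rule cfm_eqI) simp
lemma mapc_1: "mapc hom 1 = 1"
  by (rule cfm_eqI) (simp add: ent_1)
lemma mapc_sum: "mapc hom (sum f I) = (\<Sum>x\<in>I. mapc hom (f x))"
  by (induction I rule: infinite_finite_induct) (auto simp: mapc_add mapc_0)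
lemma mapc_mult: "mapc hom (A * B) = mapc hom A * mapc hom B"
proof (rule cfm_eqI)
  fix i j
  let ?S = "{k. ent B k j \<noteq> 0}"
  have "ent (A * B) i j = (\<Sum>k\<in>?S. ent A i k * ent B k j)"
    by (rule ent_times_fin) (auto simp: finite_ent)
  moreover have "ent (mapc hom A * mapc hom B) i j = (\<Sum>k\<in>?S. ent (mapc hom A) i k * ent (mapc hom B) k j)"
    by (rule ent_times_fin) (auto simp: finite_ent)
  ultimately show "ent (mapc hom (A * B)) i j = ent (mapc hom A * mapc hom B) i j"
    by (simp add: hom_distribs)
qed
lemma mapc_kr: "mapc hom (A \<boxtimes> B) = mapc hom A \<boxtimes> mapc hom B"
  by (rule cfm_eqI_en) (simp add: hom_distribs)
lemma mapc_pr: "mapc hom (pr n) = pr n"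
  by (rule cfm_eqI) (simp add: ent_pr)
lemma mapc_mu: "mapc hom (mu i j) = mu i j"
  by (rule cfm_eqI) (simp add: ent_mu)
lemma mapc_cst: "mapc hom (cst c) = cst (hom c)"
  by (rule cfm_eqI) (simp add: ent_cst)
lemma mapc_mp: "mapc hom (mp g) = mp g"
  by (rule cfm_eqI) (simp add: ent_mp)
lemma mapc_tp: "inj g \<Longrightarrow> mapc hom (tp g) = tp g"
  by (rule cfm_eqI) (simp add: ent_tp)
lemma mapc_blow: "mapc hom (blow m X T) = blow m (\<lambda>k. mapc hom (X k)) (\<lambda>k. mapc hom (T k))"
  unfolding blow_def by (simp add: mapc_sum mapc_kr)
lemma mapc_corner: "corner p q A \<Longrightarrow> corner p q (mapc hom A)"
  unfolding corner_def by (metis mapc_mult mapc_pr)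

text \<open>If \<open>t\<close> is the rank over the smaller field, then \<open>A\<close> factors
  through \<open>pr t\<close>, and this factorization survives the extension.\<close>

lemma rank_ge_mapc_iff:
  assumes "fin_idem e N" "e * A = A"
  shows "rank_ge (mapc hom A) s \<longleftrightarrow> rank_ge A s"
proof
  assume "rank_ge A s"
  then show "rank_ge (mapc hom A) s" unfolding rank_ge_def by (metis mapc_mult mapc_pr)
next
  assume r: "rank_ge (mapc hom A) s"
  obtain t P Q where N: "P * A * Q = pr t" "A * Q * P * A = A" "pr t * P = P"
    "\<And>s. rank_ge A s \<longleftrightarrow> s \<le> t" using rank_normal_form[OF assms(1) disjI1[OF assms(2)]] by metis
  have "A = (A * Q) * pr t * (P * A)" using N by (simp add: mult.assoc) (simp add: mult.assoc[symmetric])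
  then have "mapc hom A = mapc hom (A * Q) * pr t * mapc hom (P * A)" by (metis mapc_mult mapc_pr)
  then show "rank_ge A s" using r rank_ge_factor N(4) by metis
qed

end

text \<open>The coefficients are moved into \<open>S\<close> one at a time; along each line the rank
  drops for finitely many parameters only. This brings scalars of the extension field down to the
  infinite field \<open>K\<close>.\<close>

lemma rank_ge_specialize:
  assumes "finite I" "infinite S" "rank_ge (A + (\<Sum>i\<in>I. cst (c i) * B i)) s"
  shows "\<exists>c'. (\<forall>i. c' i \<in> S) \<and> rank_ge (A + (\<Sum>i\<in>I. cst (c' i) * B i)) s"
  using assms(1,3)
proof (induction I arbitrary: A)
  case empty
  obtain t where "t \<in> S" using assms(2) by (metis finite.emptyI ex_in_conv)
  then show ?case using empty by (intro exI[of _ "\<lambda>_. t"]) auto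
next
  case (insert i I)
  have "rank_ge ((A + cst (c i) * B i) + (\<Sum>i\<in>I. cst (c i) * B i)) s"
    using insert by (simp add: add.assoc)
  then obtain c' where c': "\<forall>i. c' i \<in> S" "rank_ge ((A + cst (c i) * B i) + (\<Sum>i\<in>I. cst (c' i) * B i)) s"
    using insert.IH by blast
  then have "rank_ge ((A + (\<Sum>i\<in>I. cst (c' i) * B i)) + cst (c i) * B i) s" by (simp add: add_ac)
  then have "finite {t. \<not> rank_ge ((A + (\<Sum>i\<in>I. cst (c' i) * B i)) + cst t * B i) s}"
    by (rule rank_ge_line)
  then obtain t where t: "t \<in> S" "rank_ge ((A + (\<Sum>i\<in>I. cst (c' i) * B i)) + cst t * B i) s"
    using assms(2) by (metis (mono_tags, lifting) mem_Collect_eq rev_finite_subset subsetI)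
  have "(\<Sum>j\<in>I. cst ((c'(i := t)) j) * B j) = (\<Sum>i\<in>I. cst (c' i) * B i)"
    by (rule sum.cong) (use insert in auto)
  then show ?case using t c' insert
    by (intro exI[of _ "c'(i := t)"]) (auto simp: add_ac)
qed

lemma blow_lincomb:
  "blow m X (\<lambda>k. \<Sum>j\<in>J. cst (c k j) * D j) = (\<Sum>i\<in>{..<m} \<times> J. cst (case i of (k, j) \<Rightarrow> c k j) * (X (fst i) \<boxtimes> D (snd i)))"
  unfolding blow_def by (simp add: kr_sum_right kr_cst_right sum.cartesian_product case_prod_beta)

lemma corner_expand:
  assumes "corner e e T"
  shows "T = (\<Sum>j\<in>{..<e} \<times> {..<e}. cst (ent T (fst j) (snd j)) * mu (fst j) (snd j))"
proof -
  have "T = (\<Sum>a<e. mu a a) * T * (\<Sum>b<e. mu b b)"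
    using assms unfolding corner_def pr_eq_sum by simp
  also have "\<dots> = (\<Sum>a<e. \<Sum>b<e. mu a a * T * mu b b)"
    unfolding sum_distrib_left sum_distrib_right by (rule sum.swap)
  finally show ?thesis by (simp add: mu_mult_mult_mu sum.cartesian_product case_prod_beta)
qed

text \<open>The matrices \<open>M\<close> with \<open>(1 \<otimes> Z) M = \<sigma>(M) (1 \<otimes> Z)\<close> are those whose blocks lie in the division
  ring \<open>D = {M. Z M = \<sigma>(M) Z}\<close>.  Since \<open>D\<close> spans the full matrix ring, the maximal rank of a blow-up is
  attained over \<open>D\<close>, where Gaussian elimination by blocks applies.\<close>

locale division_blocks = h: field_hom h + \<sigma>: field_hom \<sigma>
  for h :: "'a::field \<Rightarrow> 'f::field" and \<sigma> :: "'f \<Rightarrow> 'f" +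
  fixes Z :: "'f cfm" and e :: nat and J :: "'j set" and D :: "'j \<Rightarrow> 'f cfm"
  assumes e: "e > 0" and inf: "infinite (UNIV :: 'a set)"
    and \<sigma>h: "\<And>x. \<sigma> (h x) = h x"
    and Zc: "corner e e Z"
    and divis: "\<And>A. corner e e A \<Longrightarrow> A \<noteq> 0 \<Longrightarrow> Z * A = mapc \<sigma> A * Z \<Longrightarrow> \<exists>B. corner e e B \<and> A * B = pr e \<and> B * A = pr e"
    and J: "finite J"
    and D: "\<And>j. j \<in> J \<Longrightarrow> corner e e (D j)" "\<And>j. j \<in> J \<Longrightarrow> Z * D j = mapc \<sigma> (D j) * Z"
    and span: "\<And>T. corner e e T \<Longrightarrow> \<exists>c. T = (\<Sum>j\<in>J. cst (c j) * D j)"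
begin

definition twisted :: "'f cfm \<Rightarrow> bool" where "twisted M \<longleftrightarrow> (1 \<boxtimes> Z) * M = mapc \<sigma> M * (1 \<boxtimes> Z)"

lemma twisted_mult: "twisted A \<Longrightarrow> twisted B \<Longrightarrow> twisted (A * B)"
  unfolding twisted_def by (metis mult.assoc \<sigma>.mapc_mult)
lemma twisted_add: "twisted A \<Longrightarrow> twisted B \<Longrightarrow> twisted (A + B)"
  unfolding twisted_def by (simp add: distrib_left distrib_right \<sigma>.mapc_add)
lemma twisted_diff: "twisted A \<Longrightarrow> twisted B \<Longrightarrow> twisted (A - B)"
  unfolding twisted_def by (simp add: left_diff_distrib right_diff_distrib \<sigma>.mapc_diff)
lemma twisted_1: "twisted 1"
  unfolding twisted_def by (simp add: \<sigma>.mapc_1)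
lemma twisted_0: "twisted 0"
  unfolding twisted_def by (simp add: \<sigma>.mapc_0)
lemma twisted_kr: "mapc \<sigma> X = X \<Longrightarrow> Z * T = mapc \<sigma> T * Z \<Longrightarrow> twisted (X \<boxtimes> T)"
  unfolding twisted_def by (simp add: kr_mult \<sigma>.mapc_kr)
lemma twisted_sum: "(\<And>i. i \<in> I \<Longrightarrow> twisted (f i)) \<Longrightarrow> twisted (sum f I)"
  by (induction I rule: infinite_finite_induct) (auto simp: twisted_0 twisted_add)
lemma Zpr: "Z * pr e = mapc \<sigma> (pr e) * Z"
  using Zc by (simp add: corner_def \<sigma>.mapc_pr)

text \<open>The argument of \<open>rank_ge_extend\<close> with blocks of size \<open>e\<close> in
  place of entries. The Schur complement of a twisted matrix is twisted, so a nonzero block of it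
  lies in the division ring, is invertible, and extends the pivot by a whole block.\<close>

lemma block_normal_form:
  assumes A: "twisted A" "(pr n \<boxtimes> pr e) * A = A" "A * (pr n \<boxtimes> pr e) = A"
  obtains r P Q where "P * A * Q = pr r \<boxtimes> pr e" "A * Q * P * A = A" "(pr r \<boxtimes> pr e) * P = P"
proof -
  let ?ok = "\<lambda>r. \<exists>P Q. twisted P \<and> twisted Q \<and> P * A * Q = pr r \<boxtimes> pr e"
  have bd: "r \<le> n" if r: "?ok r" for r
  proof -
    from r obtain P Q where "P * A * Q = pr r \<boxtimes> pr e" by blast
    moreover have "rank_ge (pr r \<boxtimes> pr e :: 'f cfm) (r * e)"
      using rank_ge_fin_idem[OF fin_idem_kr] by blast
    ultimately have "rank_ge A (r * e)" by (metis rank_ge_mult)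
    then have "r * e \<le> n * e" using rank_ge_corner_le[OF fin_idem_kr disjI1[OF A(2)]] by blast
    then show ?thesis using e by simp
  qed
  define r where "r = Max {r. ?ok r}"
  have fin: "finite {r. ?ok r}" by (rule finite_subset[of _ "{..n}"]) (use bd in auto)
  have "?ok 0" by (rule exI[of _ 0], rule exI[of _ 0]) (simp add: twisted_0)
  then have ok: "?ok r" using Max_in[OF fin] unfolding r_def by blast
  have nok: "\<not> ?ok (Suc r)"
  proof
    assume "?ok (Suc r)"
    then have "Suc r \<le> r" unfolding r_def by (intro Max_ge[OF fin]) simp
    then show False by simp
  qed
  let ?r = "pr r \<boxtimes> pr e :: 'f cfm"
  have str: "twisted ?r" by (rule twisted_kr[OF \<sigma>.mapc_pr Zpr])
  have rr: "?r * ?r = ?r" by (simp add: kr_mult)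
  obtain P0 Q0 where P0: "twisted P0" "twisted Q0" "P0 * A * Q0 = ?r" using ok by blast
  define P Q where "P = ?r * P0" and "Q = Q0 * ?r"
  have stP: "twisted P" "twisted Q" using P0 str twisted_mult unfolding P_def Q_def by blast+
  have rP: "?r * P = P" "Q * ?r = Q" by (simp_all add: P_def Q_def mult.assoc rr, simp add: mult.assoc[symmetric] rr)
  have PAQ: "P * A * Q = ?r"
    unfolding P_def Q_def using P0(3) rr by (metis mult.assoc)
  have "A * Q * P * A = A"
  proof (rule ccontr)
    assume ne: "A * Q * P * A \<noteq> A"
    define E where "E = A - A * Q * P * A"
    have stE: "twisted E" unfolding E_def by (intro twisted_diff twisted_mult A stP)
    have EQ: "E * Q = 0"
      unfolding E_def left_diff_distrib mult.assoc using PAQ rP by (simp add: mult.assoc)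
    have PE: "P * E = 0"
      unfolding E_def right_diff_distrib mult.assoc[symmetric] PAQ rP by simp
    have "E \<noteq> 0" using ne by (simp add: E_def)
    have En: "(pr n \<boxtimes> pr e) * E = E" "E * (pr n \<boxtimes> pr e) = E"
      unfolding E_def left_diff_distrib right_diff_distrib
      by (simp_all add: mult.assoc A, simp add: mult.assoc[symmetric] A)
    obtain i0 j0 where "ent E i0 j0 \<noteq> 0" using \<open>E \<noteq> 0\<close> by (rule nonzero_entry)
    then obtain i a j b where iajb: "ent E (en i a) (en j b) \<noteq> 0" by (metis en_ex)
    \<comment> \<open>\<open>k i\<close> inserts and \<open>k' i\<close> extracts the block with
      first index \<open>i\<close>; in contrast, \<open>io\<close> and \<open>oi\<close> fix the
      second index.\<close>
    define k where "k = (\<lambda>i. mp (\<lambda>a. en i a) :: 'f cfm)"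
    define k' where "k' = (\<lambda>i. tp (\<lambda>a. en i a) :: 'f cfm)"
    have kZ: "(1 \<boxtimes> Z) * k i = k i * Z" and k'Z: "k' i * (1 \<boxtimes> Z) = Z * k' i" for i
    proof -
      show "(1 \<boxtimes> Z) * k i = k i * Z"
      proof (rule cfm_eqI)
        fix p q obtain i' a' where p: "p = en i' a'" using en_ex by blast
        show "ent ((1 \<boxtimes> Z) * k i) p q = ent (k i * Z) p q"
        proof (cases "i' = i")
          case True
          then show ?thesis using ent_mp_mult[OF inj_en2[of i], of Z a' q]
            by (simp add: k_def ent_mult_mp p ent_1)
        next
          case False
          have "ent (k i * Z) p q = 0"
            unfolding k_def by (rule ent_mp_mult_0) (use False p in auto)
          then show ?thesis using False by (simp add: k_def ent_mult_mp p ent_1)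
        qed
      qed
      show "k' i * (1 \<boxtimes> Z) = Z * k' i"
      proof (rule cfm_eqI)
        fix q p obtain i' a' where p: "p = en i' a'" using en_ex by blast
        show "ent (k' i * (1 \<boxtimes> Z)) q p = ent (Z * k' i) q p"
        proof (cases "i' = i")
          case True
          then show ?thesis using ent_mult_tp[OF inj_en2[of i], of Z q a']
            by (simp add: k'_def ent_tp_mult[OF inj_en2] p ent_1)
        next
          case False
          have "ent (Z * k' i) q p = 0"
            unfolding k'_def by (rule ent_mult_tp_0[OF inj_en2]) (use False p in auto)
          then show ?thesis using False by (simp add: k'_def ent_tp_mult[OF inj_en2] p ent_1)
        qed
      qed
    qed
    define ep where "ep = k' i * E * k j"
    have ep: "ent ep a b \<noteq> 0"
      using iajb by (simp add: ep_def k_def k'_def ent_mult_mp ent_tp_mult[OF inj_en2])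
    then have ep0: "ep \<noteq> 0" by auto
    have prk: "pr e * k' i = k' i * (1 \<boxtimes> pr e)" "k i * pr e = (1 \<boxtimes> pr e) * k i" for i
    proof -
      show "pr e * k' i = k' i * (1 \<boxtimes> pr e)"
      proof (rule cfm_eqI)
        fix q p obtain i' a' where p: "p = en i' a'" using en_ex by blast
        show "ent (pr e * k' i) q p = ent (k' i * (1 \<boxtimes> pr e)) q p"
          by (auto simp: p ent_pr_mult k'_def ent_tp[OF inj_en2] ent_tp_mult[OF inj_en2] ent_1 ent_pr)
      qed
      show "k i * pr e = (1 \<boxtimes> pr e) * k i"
      proof (rule cfm_eqI)
        fix p q obtain i' a' where p: "p = en i' a'" using en_ex by blast
        show "ent (k i * pr e) p q = ent ((1 \<boxtimes> pr e) * k i) p q"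
          by (auto simp: p ent_mult_pr k_def ent_mp ent_mult_mp ent_1 ent_pr)
      qed
    qed
    have E1: "(1 \<boxtimes> pr e) * E = E" "E * (1 \<boxtimes> pr e) = E"
    proof -
      have "(1 \<boxtimes> pr e) * ((pr n \<boxtimes> pr e) * E) = (pr n \<boxtimes> pr e) * E"
        by (simp add: mult.assoc[symmetric] kr_mult)
      moreover have "(E * (pr n \<boxtimes> pr e)) * (1 \<boxtimes> pr e) = E * (pr n \<boxtimes> pr e)"
        by (simp add: mult.assoc kr_mult)
      ultimately show "(1 \<boxtimes> pr e) * E = E" "E * (1 \<boxtimes> pr e) = E" unfolding En by blast+
    qed
    have epc: "corner e e ep"
      unfolding corner_def ep_def by (simp add: mult.assoc[symmetric] prk, simp add: mult.assoc E1 prk, simp add: mult.assoc[symmetric] E1)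
    have mk: "mapc \<sigma> (k i) = k i" "mapc \<sigma> (k' i) = k' i" for i
      by (simp_all add: k_def k'_def \<sigma>.mapc_mp \<sigma>.mapc_tp[OF inj_en2])
    have Zep: "Z * ep = mapc \<sigma> ep * Z"
    proof -
      have "Z * ep = k' i * ((1 \<boxtimes> Z) * E) * k j"
        by (simp add: ep_def mult.assoc[symmetric] k'Z)
      also have "\<dots> = k' i * mapc \<sigma> E * ((1 \<boxtimes> Z) * k j)" using stE by (simp add: twisted_def mult.assoc)
      also have "\<dots> = mapc \<sigma> ep * Z" by (simp add: ep_def kZ \<sigma>.mapc_mult mk mult.assoc)
      finally show ?thesis .
    qed
    obtain ei where ei: "corner e e ei" "ep * ei = pr e" "ei * ep = pr e" using divis[OF epc ep0 Zep] by blast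
    have Zei: "Z * ei = mapc \<sigma> ei * Z"
    proof -
      have "mapc \<sigma> ei * (Z * ep) * ei = mapc \<sigma> ei * (mapc \<sigma> ep * Z) * ei" using Zep by simp
      then have "mapc \<sigma> ei * (Z * (ep * ei)) = mapc \<sigma> (ei * ep) * Z * ei" by (simp add: \<sigma>.mapc_mult mult.assoc)
      then show ?thesis using Zc by (simp add: ei \<sigma>.mapc_pr corner_def)
    qed
    have kk: "k i * T * k' j = mu i j \<boxtimes> T" for i j T
    proof (rule cfm_eqI_en)
      fix i1 a1 j1 b1
      have L: "ent (k i * (T * k' j)) (en i1 a1) p = (if i1 = i then ent (T * k' j) a1 p else 0)" for p
      proof (cases "i1 = i")
        case True
        then show ?thesis using ent_mp_mult[OF inj_en2[of i], of "T * k' j" a1 p] by (simp add: k_def)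
      next
        case False
        then show ?thesis unfolding k_def by (subst ent_mp_mult_0) auto
      qed
      have R: "ent (T * k' j) a1 (en j1 b1) = (if j1 = j then ent T a1 b1 else 0)"
      proof (cases "j1 = j")
        case True
        then show ?thesis using ent_mult_tp[OF inj_en2[of j], of T a1 b1] by (simp add: k'_def)
      next
        case False
        then show ?thesis unfolding k'_def by (subst ent_mult_tp_0[OF inj_en2]) auto
      qed
      show "ent (k i * T * k' j) (en i1 a1) (en j1 b1) = ent (mu i j \<boxtimes> T) (en i1 a1) (en j1 b1)"
        unfolding mult.assoc L R by (simp add: ent_mu)
    qed
    define p where "p = (mu r i \<boxtimes> ei) * (1 - A * (Q * P))"
    define q where "q = (1 - Q * (P * A)) * (mu j r \<boxtimes> pr e)"
    have stp: "twisted p" unfolding p_def by (intro twisted_mult twisted_diff twisted_1 A stP twisted_kr \<sigma>.mapc_mu Zei)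
    have stq: "twisted q" unfolding q_def by (intro twisted_mult twisted_diff twisted_1 A stP twisted_kr \<sigma>.mapc_mu Zpr)
    have pA: "p * A = (mu r i \<boxtimes> ei) * E"
      by (simp add: p_def E_def left_diff_distrib right_diff_distrib mult.assoc)
    have Aq: "A * q = E * (mu j r \<boxtimes> pr e)"
      by (simp add: q_def E_def left_diff_distrib right_diff_distrib mult.assoc)
    have 1: "p * A * Q = 0" by (simp add: pA mult.assoc EQ)
    have 2: "P * (A * q) = 0" by (simp add: Aq mult.assoc[symmetric] PE)
    have 3: "p * A * q = mu r r \<boxtimes> pr e"
    proof -
      have "E * q = E * (mu j r \<boxtimes> pr e)"
        unfolding q_def left_diff_distrib right_diff_distrib by (simp add: mult.assoc[symmetric] EQ)
      then have "p * A * q = (mu r i \<boxtimes> ei) * E * (mu j r \<boxtimes> pr e)" by (simp add: pA mult.assoc)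
      also have "\<dots> = k r * ei * ep * pr e * k' r"
        unfolding kk[symmetric] ep_def by (simp add: mult.assoc)
      also have "\<dots> = mu r r \<boxtimes> pr e" using ei by (simp add: mult.assoc) (simp add: mult.assoc[symmetric] ei kk)
      finally show ?thesis .
    qed
    have "(P + p) * A * (Q + q) = pr (Suc r) \<boxtimes> pr e"
      using 1 2 3 PAQ by (simp add: distrib_left distrib_right pr_Suc kr_add_left mult.assoc)
    then show False using nok twisted_add[OF stP(1) stp] twisted_add[OF stP(2) stq] by blast
  qed
  then show thesis using that PAQ rP by blast
qed

text \<open>There are two specializations. With the coefficients expanded in the \<open>D j\<close>,
  moving the scalars into \<open>K\<close> keeps the rank large and puts all blocks into the
  division ring, where the rank is a multiple of \<open>e\<close>. The entries of the new
  coefficients still lie in the extension field; expanding in matrix units and specializing again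
  returns to \<open>K\<close>.\<close>

lemma regularity:
  fixes X T :: "nat \<Rightarrow> 'a cfm"
  assumes X: "\<And>k. k < m \<Longrightarrow> corner n n (X k)" and T: "\<And>k. k < m \<Longrightarrow> corner e e (T k)"
    and rk: "rank_ge (blow m X T) (Suc (\<rho> * e))"
  obtains T' where "\<And>k. k < m \<Longrightarrow> corner e e (T' k)" "rank_ge (blow m X T') (Suc \<rho> * e)"
proof -
  let ?X = "\<lambda>k. mapc h (X k)"
  let ?S = "range h"
  have infS: "infinite ?S" using inf h.injectivity finite_imageD[of h UNIV] by (metis injI)
  have Xc: "corner n n (?X k)" if "k < m" for k using X[OF that] by (rule h.mapc_corner)
  have eT: "(pr n \<boxtimes> pr e) * blow m X T = blow m X T" by (rule blow_corner(1)[OF X T])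
  have "\<forall>k. \<exists>c. k < m \<longrightarrow> mapc h (T k) = (\<Sum>j\<in>J. cst (c j) * D j)"
    using span h.mapc_corner T by metis
  then obtain c where c: "\<And>k. k < m \<Longrightarrow> mapc h (T k) = (\<Sum>j\<in>J. cst (c k j) * D j)" by metis
  have "mapc h (blow m X T) = blow m ?X (\<lambda>k. \<Sum>j\<in>J. cst (c k j) * D j)"
    unfolding h.mapc_blow by (rule blow_cong) (auto simp: c)
  moreover have "rank_ge (mapc h (blow m X T)) (Suc (\<rho> * e))"
    using rk h.rank_ge_mapc_iff[OF fin_idem_kr eT] by blast
  ultimately have r1: "rank_ge (0 + (\<Sum>i\<in>{..<m} \<times> J. cst (case i of (k, j) \<Rightarrow> c k j) * (?X (fst i) \<boxtimes> D (snd i)))) (Suc (\<rho> * e))"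
    unfolding blow_lincomb by simp
  obtain c' where c': "\<forall>i. c' i \<in> ?S"
      "rank_ge (0 + (\<Sum>i\<in>{..<m} \<times> J. cst (c' i) * (?X (fst i) \<boxtimes> D (snd i)))) (Suc (\<rho> * e))"
    using rank_ge_specialize[OF finite_SigmaI[OF finite_lessThan J] infS r1] by blast
  define T1 where "T1 = (\<lambda>k. \<Sum>j\<in>J. cst (c' (k, j)) * D j)"
  define A where "A = blow m ?X T1"
  have rkA: "rank_ge A (Suc (\<rho> * e))"
    using c'(2) blow_lincomb[where m = m and X = ?X and J = J and c = "\<lambda>k j. c' (k, j)" and D = D]
    unfolding A_def T1_def by simp
  have T1c: "corner e e (T1 k)" for k
    using D(1) unfolding corner_def T1_def sum_distrib_left sum_distrib_right
    by (auto intro!: sum.cong simp: cst_left_commute mult.assoc)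
  \<comment> \<open>Scalars from \<open>K\<close> are fixed by \<sigma>; for this reason the
    specialized combination of the \<open>D j\<close> commutes with \<open>Z\<close> up to \<sigma>,
    which fails for arbitrary scalars of the extension.\<close>
  have \<sigma>c: "\<sigma> (c' i) = c' i" for i using c'(1) \<sigma>h by (metis rangeE)
  have T1Z: "Z * T1 k = mapc \<sigma> (T1 k) * Z" for k
    using D(2) unfolding T1_def sum_distrib_left sum_distrib_right \<sigma>.mapc_sum
    by (auto intro!: sum.cong simp: cst_left_commute mult.assoc \<sigma>.mapc_mult \<sigma>.mapc_cst \<sigma>c)
  have mX: "mapc \<sigma> (?X k) = ?X k" for k by (rule cfm_eqI) (simp add: \<sigma>h)
  have stA: "twisted A" unfolding A_def blow_def by (intro twisted_sum twisted_kr mX T1Z)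
  have Ac: "(pr n \<boxtimes> pr e) * A = A" "A * (pr n \<boxtimes> pr e) = A"
    unfolding A_def by (rule blow_corner[OF Xc T1c]; assumption)+
  obtain r P Q where N: "P * A * Q = pr r \<boxtimes> pr e" "A * Q * P * A = A" "(pr r \<boxtimes> pr e) * P = P"
    using block_normal_form[OF stA Ac] by blast
  have "A = (A * Q) * (pr r \<boxtimes> pr e) * (P * A)" using N by (simp add: mult.assoc) (simp add: mult.assoc[symmetric])
  then have "rank_ge (pr r \<boxtimes> pr e :: 'f cfm) (Suc (\<rho> * e))" using rkA by (metis rank_ge_mult)
  then have "Suc (\<rho> * e) \<le> r * e" using rank_ge_fin_idem[OF fin_idem_kr] by blast
  then have "\<rho> * e < r * e" by (simp only: Suc_le_eq)
  then have "Suc \<rho> \<le> r" by simp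
  then have le: "Suc \<rho> * e \<le> r * e" by (rule mult_le_mono1)
  have "rank_ge (pr r \<boxtimes> pr e :: 'f cfm) (r * e)" using rank_ge_fin_idem[OF fin_idem_kr] by blast
  then have "rank_ge A (r * e)" unfolding N(1)[symmetric] by (rule rank_ge_mult)
  then have rk2: "rank_ge A (Suc \<rho> * e)" using le by (rule rank_ge_mono)
  let ?I = "{..<e} \<times> {..<e}"
  have "A = blow m ?X (\<lambda>k. \<Sum>j\<in>?I. cst (ent (T1 k) (fst j) (snd j)) * mu (fst j) (snd j))"
    unfolding A_def by (rule blow_cong) (use corner_expand[OF T1c] in auto)
  then have r2: "rank_ge (0 + (\<Sum>i\<in>{..<m} \<times> ?I. cst (case i of (k, j) \<Rightarrow> ent (T1 k) (fst j) (snd j)) *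
      (?X (fst i) \<boxtimes> mu (fst (snd i)) (snd (snd i))))) (Suc \<rho> * e)"
    using rk2 unfolding blow_lincomb by simp
  have "\<exists>c2. (\<forall>i. c2 i \<in> ?S) \<and> rank_ge (0 + (\<Sum>i\<in>{..<m} \<times> ?I. cst (c2 i) *
      (?X (fst i) \<boxtimes> mu (fst (snd i)) (snd (snd i))))) (Suc \<rho> * e)"
    by (rule rank_ge_specialize[OF _ infS r2]) simp
  then obtain c2 where "(\<forall>i. c2 i \<in> ?S) \<and> rank_ge (0 + (\<Sum>i\<in>{..<m} \<times> ?I. cst (c2 i) *
      (?X (fst i) \<boxtimes> mu (fst (snd i)) (snd (snd i))))) (Suc \<rho> * e)" ..
  note c2 = conjunct1[OF this] conjunct2[OF this]
  define g where "g = (\<lambda>i. inv_into UNIV h (c2 i))"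
  have g: "c2 i = h (g i)" for i
    unfolding g_def by (rule f_inv_into_f[symmetric]) (rule spec[OF c2(1)])
  define T' where "T' = (\<lambda>k. \<Sum>j\<in>?I. cst (g (k, j)) * mu (fst j) (snd j))"
  have "mapc h (blow m X T') = blow m ?X (\<lambda>k. \<Sum>j\<in>?I. cst (c2 (k, j)) * mu (fst j) (snd j))"
    unfolding h.mapc_blow T'_def by (simp add: h.mapc_sum h.mapc_mult h.mapc_cst h.mapc_mu g)
  also have "\<dots> = (\<Sum>i\<in>{..<m} \<times> ?I. cst (c2 i) * (?X (fst i) \<boxtimes> mu (fst (snd i)) (snd (snd i))))"
    unfolding blow_lincomb by (rule sum.cong) auto
  finally have rk3: "rank_ge (mapc h (blow m X T')) (Suc \<rho> * e)" using c2(2) by simp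
  have T'c: "corner e e (T' k)" for k
    unfolding corner_def T'_def sum_distrib_left sum_distrib_right
    by (auto intro!: sum.cong simp: cst_left_commute mult.assoc pr_mult_mu mu_mult_pr)
  have eT': "(pr n \<boxtimes> pr e) * blow m X T' = blow m X T'" by (rule blow_corner(1)[OF X T'c])
  have "rank_ge (blow m X T') (Suc \<rho> * e)"
    using rk3 h.rank_ge_mapc_iff[OF fin_idem_kr eT'] by blast
  then show thesis using that T'c by blast
qed

end

section \<open>Cyclic division algebras\<close>

definition fls_map :: "('a::field \<Rightarrow> 'a) \<Rightarrow> 'a fls \<Rightarrow> 'a fls" where
  "fls_map \<tau> f = Abs_fls (\<lambda>n. \<tau> (fls_nth f n))"

lemma fls_nth_map:
  assumes "field_hom \<tau>" shows "fls_nth (fls_map \<tau> f) n = \<tau> (fls_nth f n)"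
proof -
  interpret field_hom \<tau> by fact
  show ?thesis unfolding fls_map_def
    by (rule nth_Abs_fls_lower_bound[of "fls_subdegree f"]) simp
qed

lemma fls_subdegree_map:
  assumes "field_hom \<tau>" shows "fls_subdegree (fls_map \<tau> f) = fls_subdegree f"
proof -
  interpret field_hom \<tau> by fact
  show ?thesis
  proof (cases "f = 0")
    case True
    then show ?thesis by (metis assms fls_eq_iff fls_nth_map fls_zero_nth hom_zero)
  next
    case False
    show ?thesis by (rule fls_subdegree_eqI) (use False in \<open>auto simp: fls_nth_map[OF assms]\<close>)
  qed
qed

lemma field_hom_fls_map:
  assumes "field_hom \<tau>" shows "field_hom (fls_map \<tau>)"
proof -
  interpret field_hom \<tau> by fact
  note n = fls_nth_map[OF assms]
  have "fls_map \<tau> (x * y) = fls_map \<tau> x * fls_map \<tau> y" for x y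
    by (simp add: fls_eq_iff n fls_times_nth(2) fls_subdegree_map[OF assms] hom_distribs)
  then show ?thesis
    by unfold_locales (simp_all add: fls_eq_iff n hom_distribs)
qed

text \<open>The generator \<open>Z\<close> of the cyclic algebra; its \<open>e\<close>-th power is the Laurent variable \<open>w\<close>.\<close>

definition cycZ :: "nat \<Rightarrow> 'l::field fls cfm" where
  "cycZ e = (\<Sum>i<e - 1. mu i (Suc i)) + cst fls_X * mu (e - 1) 0"

lemma ent_cycZ_mult:
  assumes "e > 0" "i < e"
  shows "ent (cycZ e * A) i j = (if Suc i < e then ent A (Suc i) j else fls_X * ent A 0 j)"
proof -
  have "ent (\<Sum>k<e - 1. mu k (Suc k) * A) i j = (\<Sum>k<e - 1. if i = k then ent A (Suc k) j else 0)"
    unfolding ent_sum ent_mu_mult ..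
  also have "\<dots> = (if Suc i < e then ent A (Suc i) j else 0)" using assms by auto
  finally have 1: "ent (\<Sum>k<e - 1. mu k (Suc k) * A) i j = (if Suc i < e then ent A (Suc i) j else 0)" .
  show ?thesis
    unfolding cycZ_def distrib_right sum_distrib_right ent_add 1 mult.assoc ent_cst_mult ent_mu_mult
    using assms by auto
qed

lemma ent_mult_cycZ:
  assumes "e > 0" "j < e"
  shows "ent (A * cycZ e) i j = (if j = 0 then ent A i (e - 1) * fls_X else ent A i (j - 1))"
proof -
  have "ent (\<Sum>k<e - 1. A * mu k (Suc k)) i j = (\<Sum>k<e - 1. if j = Suc k then ent A i k else 0)"
    unfolding ent_sum ent_mult_mu ..
  also have "\<dots> = (\<Sum>k<e - 1. if k = j - 1 then (if j = 0 then 0 else ent A i k) else 0)"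
    by (rule sum.cong) auto
  also have "\<dots> = (if j = 0 then 0 else ent A i (j - 1))" using assms by auto
  finally have 1: "ent (\<Sum>k<e - 1. A * mu k (Suc k)) i j = (if j = 0 then 0 else ent A i (j - 1))" .
  show ?thesis
    unfolding cycZ_def distrib_left sum_distrib_left ent_add 1 cst_left_commute ent_cst_mult ent_mult_mu
    by (auto simp: mult.commute)
qed

lemma corner_cycZ: "e > 0 \<Longrightarrow> corner e e (cycZ e)"
  unfolding corner_def cycZ_def distrib_left distrib_right sum_distrib_left sum_distrib_right
  by (auto simp: cst_left_commute mult.assoc pr_mult_mu mu_mult_pr intro!: arg_cong2[of _ _ _ _ "(+)"] sum.cong)

text \<open>The valuation of the division ring: an entry \<open>(i, j)\<close> of a matrix in \<open>D\<close> with \<open>w\<close>-valuation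
  \<open>k\<close> contributes in degree \<open>e k + j - i\<close> of the uniformizer \<open>Z\<close>, and this degree is constant along
  cyclic diagonals.  In a product with a vector the contributions of different columns have different
  degrees modulo \<open>e\<close>, so they cannot cancel.\<close>

lemma cyclic_division_kernel:
  assumes \<tau>: "field_hom \<tau>" and e: "e > 0"
    and A: "cycZ e * A = mapc (fls_map \<tau>) A * cycZ e" and A0: "corner e e A" "A \<noteq> 0"
    and v: "\<And>i. i < e \<Longrightarrow> (\<Sum>j<e. ent A i j * v j) = 0" and j1: "j1 < e"
  shows "v j1 = 0"
proof (rule ccontr)
  assume v1: "v j1 \<noteq> 0"
  interpret \<sigma>: field_hom "fls_map \<tau>" by (rule field_hom_fls_map[OF \<tau>])
  note sub = fls_subdegree_map[OF \<tau>]
  \<comment> \<open>\<open>U\<close> cancels the summand \<open>j\<close> of \<open>wt\<close>, so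
    \<open>wt i j + U j\<close> is \<open>e\<close> times the valuation of
    \<open>ent A i j * v j\<close>, minus \<open>i\<close>. Within a row, comparing these sums
    compares valuations.\<close>
  define wt where "wt = (\<lambda>i j. int e * fls_subdegree (ent A i j) + int j - int i)"
  define U where "U = (\<lambda>j. int e * fls_subdegree (v j) - int j)"
  have rel: "(if Suc i < e then ent A (Suc i) j else fls_X * ent A 0 j) =
      (if j = 0 then fls_map \<tau> (ent A i (e - 1)) * fls_X else fls_map \<tau> (ent A i (j - 1)))"
    if "i < e" "j < e" for i j
    using arg_cong[OF A, of "\<lambda>M. ent M i j"] that e by (simp add: ent_cycZ_mult ent_mult_cycZ)
  have nz: "fls_map \<tau> x = 0 \<longleftrightarrow> x = 0" for x by simp
  have shift: "ent A (Suc i mod e) (Suc j mod e) \<noteq> 0 \<and> wt (Suc i mod e) (Suc j mod e) = wt i j"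
    if ij: "i < e" "j < e" "ent A i j \<noteq> 0" for i j
  proof -
    consider "Suc i < e" "Suc j < e" | "Suc i < e" "Suc j = e" | "Suc i = e" "Suc j < e" | "Suc i = e" "Suc j = e"
      using ij by linarith
    then show ?thesis
    proof cases
      case 1
      then show ?thesis using rel[of i "Suc j"] ij by (simp add: wt_def sub)
    next
      case 2
      then have j: "j = e - 1" by simp
      have r: "ent A (Suc i) 0 = fls_map \<tau> (ent A i j) * fls_X" using rel[of i 0] 2 e j by simp
      have "fls_subdegree (ent A (Suc i) 0) = fls_subdegree (ent A i j) + 1"
        unfolding r using ij by (simp add: sub)
      then show ?thesis using 2 e ij r by (simp add: wt_def j algebra_simps)
    next
      case 3
      have r: "fls_X * ent A 0 (Suc j) = fls_map \<tau> (ent A i j)" using rel[of i "Suc j"] 3 ij by simp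
      then have n: "ent A 0 (Suc j) \<noteq> 0" using ij by (metis mult_zero_right nz)
      have "fls_subdegree (fls_X * ent A 0 (Suc j)) = fls_subdegree (ent A i j)" unfolding r by (rule sub)
      then have m: "fls_subdegree (ent A i j) = fls_subdegree (ent A 0 (Suc j)) + 1" using n by simp
      moreover have "i = e - 1" using 3 by simp
      ultimately show ?thesis using 3 e n by (simp add: wt_def algebra_simps)
    next
      case 4
      have j: "j = e - 1" using 4 by simp
      have "fls_X * ent A 0 0 = fls_map \<tau> (ent A i (e - 1)) * fls_X" using rel[of i 0] e ij 4(1) by simp
      then have r: "ent A 0 0 = fls_map \<tau> (ent A i j)" unfolding j by (simp add: mult.commute)
      then show ?thesis using 4 ij by (simp add: wt_def sub)
    qed
  qed
  have shiftk: "ent A ((i + k) mod e) ((j + k) mod e) \<noteq> 0 \<and> wt ((i + k) mod e) ((j + k) mod e) = wt i j"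
    if ij: "i < e" "j < e" "ent A i j \<noteq> 0" for i j k
  proof (induction k)
    case 0
    then show ?case using ij by simp
  next
    case (Suc k)
    then show ?case using shift[of "(i + k) mod e" "(j + k) mod e"] e by (simp add: mod_Suc_eq)
  qed
  define P where "P = {(i, j). i < e \<and> j < e \<and> ent A i j \<noteq> 0}"
  have finP: "finite P" by (rule finite_subset[of _ "{..<e} \<times> {..<e}"]) (auto simp: P_def)
  have "P \<noteq> {}"
  proof -
    obtain i j where ij: "ent A i j \<noteq> 0" using A0(2) nonzero_entry by blast
    have "ent (pr e * A) i j \<noteq> 0" "ent (A * pr e) i j \<noteq> 0" using ij A0(1) by (simp_all add: corner_def)
    then have "i < e" "j < e" by (auto simp: ent_pr_mult ent_mult_pr split: if_splits)
    then show ?thesis using ij unfolding P_def by auto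
  qed
  then obtain i0 j0 where p0: "(i0, j0) \<in> P" and min0: "\<And>i j. (i, j) \<in> P \<Longrightarrow> wt i0 j0 \<le> wt i j"
    using finP by (metis (no_types, lifting) arg_min_if_finite(1) arg_min_least case_prod_conv prod.collapse)
  define N where "N = {j. j < e \<and> v j \<noteq> 0}"
  have "finite N" "N \<noteq> {}" using v1 j1 by (auto simp: N_def)
  then obtain js where js: "js \<in> N" and minU: "\<And>j. j \<in> N \<Longrightarrow> U js \<le> U j"
    by (metis arg_min_if_finite(1) arg_min_least)
  have jse: "js < e" "v js \<noteq> 0" using js by (auto simp: N_def)
  \<comment> \<open>The row in which the cyclic diagonal of minimal weight meets column
    \<open>js\<close>. The term at \<open>js\<close> has the unique least valuation there, because
    the values \<open>U j\<close> differ modulo \<open>e\<close>.\<close>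
  define i where "i = (i0 + (js + e - j0)) mod e"
  have j0e: "i0 < e" "j0 < e" "ent A i0 j0 \<noteq> 0" using p0 by (auto simp: P_def)
  have "(j0 + (js + e - j0)) mod e = js" using j0e jse by simp
  then have i: "ent A i js \<noteq> 0" "wt i js = wt i0 j0"
    using shiftk[OF j0e, of "js + e - j0"] unfolding i_def by auto
  have ie: "i < e" using e by (simp add: i_def)
  define n0 where "n0 = fls_subdegree (ent A i js * v js)"
  have "fls_nth (ent A i j * v j) n0 = 0" if j: "j < e" "j \<noteq> js" for j
  proof (cases "ent A i j = 0 \<or> v j = 0")
    case False
    then have "U js \<le> U j" using minU j by (simp add: N_def)
    moreover have "U js \<noteq> U j"
    proof
      assume "U js = U j"
      then have "int js - int j = int e * (fls_subdegree (v js) - fls_subdegree (v j))"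
        by (simp add: U_def algebra_simps)
      then have "int e dvd int js - int j" by simp
      moreover have "\<bar>int js - int j\<bar> < int e" using j jse by linarith
      ultimately have "int js - int j = 0" by (metis abs_of_nat dvd_imp_le_int linorder_not_less)
      then show False using j by simp
    qed
    moreover have "wt i js \<le> wt i j" using min0[of i j] i False j ie by (simp add: P_def)
    ultimately have "wt i js + U js < wt i j + U j" by linarith
    then have "int e * (fls_subdegree (ent A i js) + fls_subdegree (v js)) < int e * (fls_subdegree (ent A i j) + fls_subdegree (v j))"
      by (simp add: wt_def U_def algebra_simps)
    then have "fls_subdegree (ent A i js) + fls_subdegree (v js) < fls_subdegree (ent A i j) + fls_subdegree (v j)"
      using e by (simp add: mult_less_cancel_left)
    then have "n0 < fls_subdegree (ent A i j * v j)" using False i jse by (simp add: n0_def)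
    then show ?thesis by simp
  qed auto
  then have "fls_nth (\<Sum>j<e. ent A i j * v j) n0 = fls_nth (ent A i js * v js) n0"
    using jse(1) unfolding fls_nth_sum by (subst sum.remove[of _ js]) auto
  also have "\<dots> \<noteq> 0" unfolding n0_def using i jse by (intro nth_fls_subdegree_nonzero) simp
  finally show False using v[OF ie] by simp
qed

lemma cyclic_division:
  assumes \<tau>: "field_hom \<tau>" and e: "e > 0"
    and A: "cycZ e * A = mapc (fls_map \<tau>) A * cycZ e" and A0: "corner e e A" "A \<noteq> 0"
  shows "\<exists>B. corner e e B \<and> A * B = pr e \<and> B * A = pr e"
proof -
  let ?M = "tomat e e A"
  have "det ?M \<noteq> 0"
  proof
    assume "det ?M = 0"
    then obtain v where v: "v \<in> carrier_vec e" "v \<noteq> 0\<^sub>v e" "?M *\<^sub>v v = 0\<^sub>v e"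
      using det_0_iff_vec_prod_zero_field[of ?M e] by auto
    have "(\<Sum>j<e. ent A i j * v $ j) = 0" if "i < e" for i
      using arg_cong[OF v(3), of "\<lambda>u. vec_index u i"] that v(1)
      by (simp add: tomat_def scalar_prod_def atLeast0LessThan)
    then have "v $ j = 0" if "j < e" for j using cyclic_division_kernel[OF \<tau> e A A0] that by blast
    then show False using v by auto
  qed
  then obtain C where "C * pr e * A * pr e = pr e" by (rule invertible_square)
  then have C: "(pr e * C * pr e) * A = pr e" using A0(1) by (simp add: corner_def mult.assoc)
  then have "rank_ge A e" unfolding rank_ge_def by (metis mult_1_right)
  then obtain R where R: "A * R = pr e"
    using full_right_inverse[OF fin_idem_pr, of e A] A0(1) unfolding corner_def by blast
  define B where "B = pr e * C * pr e"
  have "B = B * (A * R)" by (simp add: R B_def mult.assoc)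
  also have "\<dots> = pr e * R" using C by (simp add: B_def mult.assoc[symmetric])
  finally have "A * B = pr e" using R A0(1) by (simp add: corner_def mult.assoc[symmetric])
  moreover have "corner e e B" by (simp add: corner_def B_def mult.assoc)
  ultimately show ?thesis using C unfolding B_def by blast
qed

definition diagm :: "nat \<Rightarrow> (nat \<Rightarrow> 'l::field) \<Rightarrow> 'l cfm" where
  "diagm e f = (\<Sum>a<e. cst (f a) * mu a a)"

lemma ent_diagm: "ent (diagm e f) i j = (if i = j \<and> i < e then f i else 0)"
proof -
  have "ent (diagm e f) i j = (\<Sum>a<e. if a = i then (if i = j then f a else 0) else 0)"
    unfolding diagm_def ent_sum ent_cst_mult ent_mu by (rule sum.cong) auto
  then show ?thesis by auto
qed

text \<open>Lagrange interpolation: the polynomial vanishing at all points \<open>x b\<close> except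
  \<open>x a\<close>, evaluated at the diagonal matrix of the \<open>x b\<close>, is a multiple of
  \<open>mu a a\<close>.\<close>

lemma diagonal_interpolation:
  fixes x :: "nat \<Rightarrow> 'l::field"
  assumes inj: "inj_on x {..<e}" and a: "a < e"
  shows "\<exists>c. mu a a = (\<Sum>l<e. cst (c l) * diagm e (\<lambda>b. x b ^ l))"
proof -
  define p where "p = (\<Prod>b\<in>{..<e} - {a}. [:- x b, 1:])"
  have deg: "degree p \<le> e - 1"
    using degree_prod_sum_le[of "{..<e} - {a}" "\<lambda>b. [:- x b, 1:]"] a by (simp add: p_def)
  have p0: "poly p (x b) = 0 \<longleftrightarrow> b \<noteq> a" if "b < e" for b
    using that inj a by (auto simp: p_def poly_prod inj_on_def)
  have pe: "poly p y = (\<Sum>l<e. coeff p l * y ^ l)" for y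
  proof -
    have "poly p y = (\<Sum>l\<le>degree p. coeff p l * y ^ l)" by (rule poly_altdef)
    also have "\<dots> = (\<Sum>l<e. coeff p l * y ^ l)"
      by (rule sum.mono_neutral_left) (use deg a in \<open>auto simp: coeff_eq_0\<close>)
    finally show ?thesis .
  qed
  define c where "c = (\<lambda>l. coeff p l / poly p (x a))"
  have "mu a a = (\<Sum>l<e. cst (c l) * diagm e (\<lambda>b. x b ^ l))"
  proof (rule cfm_eqI)
    fix i j
    have "ent (\<Sum>l<e. cst (c l) * diagm e (\<lambda>b. x b ^ l)) i j =
        (\<Sum>l<e. c l * (if i = j \<and> i < e then x i ^ l else 0))"
      unfolding ent_sum ent_cst_mult ent_diagm ..
    also have "\<dots> = (if i = j \<and> i < e then (\<Sum>l<e. c l * x i ^ l) else 0)"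
      by (cases "i = j \<and> i < e", simp, simp only: if_False mult_zero_right sum.neutral_const)
    also have "(\<Sum>l<e. c l * x i ^ l) = poly p (x i) / poly p (x a)"
      unfolding pe[of "x i"] by (simp add: c_def sum_divide_distrib)
    finally show "ent (mu a a) i j = ent (\<Sum>l<e. cst (c l) * diagm e (\<lambda>b. x b ^ l)) i j"
      using p0 a by (auto simp: ent_mu)
  qed
  then show ?thesis by blast
qed

text \<open>Right multiplication by \<open>cycZ e\<close> moves a matrix unit cyclically along its
  row; \<open>s\<close> collects one factor \<open>fls_X\<close> for every wrap-around.\<close>

lemma mu_cycZ_power:
  assumes e: "e > 0" and a: "a < e"
  shows "\<exists>s. s \<noteq> 0 \<and> mu a a * cycZ e ^ k = cst s * (mu a ((a + k) mod e) :: 'l::field fls cfm)"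
proof (induction k)
  case 0
  show ?case using a by (intro exI[of _ 1]) simp
next
  case (Suc k)
  then obtain s :: "'l fls" where s: "s \<noteq> 0" "mu a a * cycZ e ^ k = cst s * mu a ((a + k) mod e)" by blast
  let ?b = "(a + k) mod e"
  have b: "?b < e" using e by simp
  have 1: "mu a a * cycZ e ^ Suc k = cst s * (mu a ?b * cycZ e)"
    using s(2) by (simp add: power_Suc2 mult.assoc[symmetric] del: power_Suc)
  let ?Z = "cycZ e :: 'l fls cfm"
  have 2: "mu a ?b * ?Z = (cst (if Suc ?b < e then 1 else fls_X) * mu a (Suc ?b mod e) :: 'l fls cfm)"
  proof (rule cfm_eqI)
    fix i j
    have "ent ?Z ?b j = ent (?Z * (pr e :: 'l fls cfm)) ?b j"
      using corner_cycZ[OF e, where ?'a = 'l] by (simp add: corner_def)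
    then have "ent (mu a ?b * ?Z) i j = (if i = a \<and> j < e then ent ?Z ?b j else (0 :: 'l fls))"
      by (cases "j < e") (simp_all add: ent_mu_mult ent_mult_pr)
    moreover have "ent ?Z ?b j = (if Suc ?b < e then (if j = Suc ?b then 1 else 0) else fls_X * (if j = 0 then 1 else 0))"
      using ent_cycZ_mult[OF e b, of 1 j] by (auto simp: ent_1)
    ultimately show "ent (mu a ?b * ?Z) i j = ent (cst (if Suc ?b < e then 1 else fls_X) * mu a (Suc ?b mod e)) i j"
      using b by (auto simp: ent_mu not_less le_Suc_eq mod_Suc)
  qed
  have "mu a a * cycZ e ^ Suc k = cst (s * (if Suc ?b < e then 1 else fls_X)) * mu a ((a + Suc k) mod e)"
    unfolding 1 2 cst_mult mult.assoc by (simp add: mod_Suc_eq)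
  then show ?case using s(1) by (intro exI[of _ "s * (if Suc ?b < e then 1 else fls_X)"]) auto
qed

text \<open>Diagonal matrix units come from interpolation, and powers of \<open>cycZ e\<close> move
  them to any other position. These are the standard \<open>e * e\<close> basis products of a cyclic
  algebra.\<close>

lemma cyclic_span:
  fixes x :: "nat \<Rightarrow> 'l::field fls"
  assumes inj: "inj_on x {..<e}" and e: "e > 0" and T: "corner e e T"
  shows "\<exists>c. T = (\<Sum>j\<in>{..<e} \<times> {..<e}. cst (c j) * (diagm e (\<lambda>b. x b ^ fst j) * cycZ e ^ snd j))"
proof -
  let ?J = "{..<e} \<times> {..<e}"
  let ?D = "\<lambda>j. diagm e (\<lambda>b. x b ^ fst j) * cycZ e ^ snd j"
  let ?s = "\<lambda>M. \<exists>c. M = (\<Sum>j\<in>?J. cst (c j) * ?D j)"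
  have s_scale: "?s (cst t * M)" if M: "?s M" for t M
  proof -
    obtain c where "M = (\<Sum>j\<in>?J. cst (c j) * ?D j)" using M by blast
    then have "cst t * M = (\<Sum>j\<in>?J. cst (t * c j) * ?D j)" by (simp add: sum_distrib_left cst_mult mult.assoc)
    then show ?thesis by (rule exI[of _ "\<lambda>j. t * c j"])
  qed
  have s_add: "?s (M + M')" if M: "?s M" "?s M'" for M M'
  proof -
    obtain c c' where "M = (\<Sum>j\<in>?J. cst (c j) * ?D j)" "M' = (\<Sum>j\<in>?J. cst (c' j) * ?D j)" using M by blast
    then have "M + M' = (\<Sum>j\<in>?J. cst (c j + c' j) * ?D j)" by (simp add: sum.distrib cst_add distrib_right)
    then show ?thesis by (rule exI[of _ "\<lambda>j. c j + c' j"])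
  qed
  have s_sum: "?s (sum f I)" if "\<And>i. i \<in> I \<Longrightarrow> ?s (f i)" for f and I :: "(nat \<times> nat) set"
    using that
  proof (induction I rule: infinite_finite_induct)
    case (insert i I)
    then show ?case using s_add by simp
  qed (auto intro!: exI[of _ "\<lambda>_. 0"])
  have s_mu: "?s (mu a b)" if ab: "a < e" "b < e" for a b
  proof -
    let ?k = "(b + e - a) mod e"
    have k: "?k < e" using e by simp
    have "(a + ?k) mod e = b" using ab by (simp add: mod_add_right_eq)
    then obtain s :: "'l fls" where s: "s \<noteq> 0" "mu a a * cycZ e ^ ?k = cst s * mu a b"
      using mu_cycZ_power[OF e ab(1), of ?k] by auto
    obtain c where c: "mu a a = (\<Sum>l<e. cst (c l) * diagm e (\<lambda>b. x b ^ l))"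
      using diagonal_interpolation[OF inj ab(1)] by blast
    have "mu a a * cycZ e ^ ?k = (\<Sum>l<e. \<Sum>k<e. if k = ?k then cst (c l) * ?D (l, k) else 0)"
      unfolding c sum_distrib_right using k by (simp add: mult.assoc)
    also have "\<dots> = (\<Sum>j\<in>?J. cst (if snd j = ?k then c (fst j) else 0) * ?D j)"
      unfolding sum.cartesian_product by (rule sum.cong) auto
    finally have "cst s * mu a b = (\<Sum>j\<in>?J. cst (if snd j = ?k then c (fst j) else 0) * ?D j)"
      unfolding s(2) .
    then have "?s (cst s * mu a b)" by (rule exI[of _ "\<lambda>j. if snd j = ?k then c (fst j) else 0"])
    then have "?s (cst (inverse s) * (cst s * mu a b))" by (rule s_scale)
    moreover have "cst (inverse s) * (cst s * mu a b) = mu a b"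
      using s(1) by (simp add: mult.assoc[symmetric] cst_mult[symmetric])
    ultimately show ?thesis by simp
  qed
  have "?s (\<Sum>j\<in>?J. cst (ent T (fst j) (snd j)) * mu (fst j) (snd j))"
    by (rule s_sum, rule s_scale, rule s_mu) auto
  then show ?thesis using corner_expand[OF T] by simp
qed

section \<open>A cyclic algebra over an extension of a given field\<close>

abbreviation "keys \<equiv> Poly_Mapping.keys"
abbreviation "lookup \<equiv> Poly_Mapping.lookup"
abbreviation "single \<equiv> Poly_Mapping.single"

lemma poly_mapping_add_induct [case_names zero single add]:
  fixes p :: "'a \<Rightarrow>\<^sub>0 'b::comm_monoid_add"
  assumes "P 0" "\<And>k v. P (single k v)" "\<And>p q. P p \<Longrightarrow> P q \<Longrightarrow> P (p + q)"
  shows "P p"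
proof (induction p rule: Poly_Mapping.update_induct)
  case (update f a b)
  have "Poly_Mapping.update a b f = f + single a b"
    by (rule poly_mapping_eqI)
      (use update in \<open>auto simp: lookup_add lookup_update lookup_single when_def in_keys_iff\<close>)
  then show ?case using assms update by simp
qed (use assms in \<open>simp add: zero_poly_mapping_def[symmetric]\<close>)

text \<open>Reindexing monomials by an additive bijection respects products; by additivity in both
  arguments it suffices to check single terms.\<close>

lemma map_key_times:
  fixes f g :: "'k \<Rightarrow> 'k::monoid_add" and p q :: "'k \<Rightarrow>\<^sub>0 'a::semiring_0"
  assumes fg: "\<And>x. f (g x) = x" and gf: "\<And>x. g (f x) = x" and add: "\<And>x y. f (x + y) = f x + f y"
  shows "Poly_Mapping.map_key f (p * q) = Poly_Mapping.map_key f p * Poly_Mapping.map_key f q"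
proof -
  have inj: "inj f" by (rule inj_on_inverseI[of _ g]) (rule gf)
  have s: "Poly_Mapping.map_key f (single k v) = single (g k) v" for k and v :: 'a
    using map_key_single[OF inj, of "g k" v] by (simp add: fg)
  have gadd: "g (x + y) = g x + g y" for x y by (metis add fg gf)
  show ?thesis
  proof (induction p rule: poly_mapping_add_induct)
    case (single k v)
    show ?case
      by (induction q rule: poly_mapping_add_induct)
        (simp_all add: inj mult_single s gadd distrib_left map_key_plus)
  qed (simp_all add: inj distrib_right map_key_plus)
qed

section \<open>The cyclic shift of variables\<close>

type_synonym 'a mpoly = "(nat \<Rightarrow>\<^sub>0 nat) \<Rightarrow>\<^sub>0 'a"

definition cyc :: "nat \<Rightarrow> nat \<Rightarrow> nat" where
  "cyc e i = (if i < e then Suc i mod e else i)"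

definition mvar :: "nat \<Rightarrow> 'a::field mpoly" where
  "mvar i = single (single i 1) 1"

text \<open>\<open>map_key\<close> is a pullback. Pulling back twice, on variables and then on
  monomials, is covariant again, so variable \<open>i\<close> goes to variable
  \<open>cyc e i\<close>.\<close>

definition mshift :: "nat \<Rightarrow> 'a::field mpoly \<Rightarrow> 'a mpoly" where
  "mshift e = Poly_Mapping.map_key (Poly_Mapping.map_key (cyc e))"

lemma cyc_inverse: "cyc e (if i < e then (i + e - 1) mod e else i) = i"
  "(if cyc e i < e then (cyc e i + e - 1) mod e else cyc e i) = i"
  by (auto simp: cyc_def mod_Suc_eq mod_Suc) (auto simp: mod_if split: if_splits)

lemma inj_cyc: "inj (cyc e)"
  by (rule inj_on_inverseI) (rule cyc_inverse(2))

lemma bij_monomial_shift: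
  fixes e :: nat
  defines "d \<equiv> \<lambda>i. if i < e then (i + e - 1) mod e else i"
  shows "Poly_Mapping.map_key (cyc e) (Poly_Mapping.map_key d \<mu>) = \<mu>"
    "Poly_Mapping.map_key d (Poly_Mapping.map_key (cyc e) \<mu>) = \<mu>"
proof -
  have injd: "inj d" by (rule inj_on_inverseI[of _ "cyc e"]) (unfold d_def, rule cyc_inverse(1))
  have "d \<circ> cyc e = (\<lambda>x. x)" "cyc e \<circ> d = (\<lambda>x. x)"
    using cyc_inverse[of e] by (auto simp: d_def fun_eq_iff)
  then show "Poly_Mapping.map_key (cyc e) (Poly_Mapping.map_key d \<mu>) = \<mu>"
    "Poly_Mapping.map_key d (Poly_Mapping.map_key (cyc e) \<mu>) = \<mu>"
    by (simp_all add: map_key_compose inj_cyc injd map_key_id)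
qed

lemma inj_monomial_shift: "inj (Poly_Mapping.map_key (cyc e) :: (nat \<Rightarrow>\<^sub>0 nat) \<Rightarrow> _)"
  by (rule inj_on_inverseI) (rule bij_monomial_shift(2))

lemma mshift_add: "mshift e (p + q) = mshift e p + mshift e q"
  unfolding mshift_def by (rule map_key_plus[OF inj_monomial_shift])

lemma mshift_mult: "mshift e (p * q) = mshift e p * mshift e q"
  unfolding mshift_def
  by (rule map_key_times[OF bij_monomial_shift map_key_plus[OF inj_cyc]])

lemma mshift_single: "mshift e (single (Poly_Mapping.map_key (cyc e) \<mu>) a) = single \<mu> a"
  unfolding mshift_def by (rule map_key_single[OF inj_monomial_shift])

lemma mshift_const: "mshift e (single 0 a) = single 0 a"
  using mshift_single[of e 0 a] by (simp add: inj_cyc)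

lemma mshift_var: "mshift e (mvar i) = mvar (cyc e i)"
  using mshift_single[of e "single (cyc e i) 1" 1]
  by (simp add: mvar_def map_key_single[OF inj_cyc])

lemma mshift_eq_0: "mshift e p = 0 \<longleftrightarrow> p = 0"
proof
  assume 0: "mshift e p = 0"
  have "lookup p \<mu> = 0" for \<mu>
  proof -
    have "lookup (mshift e p) (Poly_Mapping.map_key (\<lambda>i. if i < e then (i + e - 1) mod e else i) \<mu>)
        = lookup p \<mu>"
      unfolding mshift_def map_key.rep_eq[OF inj_monomial_shift] o_def bij_monomial_shift(1) ..
    then show ?thesis unfolding 0 by simp
  qed
  then show "p = 0" by (intro poly_mapping_eqI) simp
qed (simp add: mshift_def inj_monomial_shift)

text \<open>A representative is chosen by \<open>SOME\<close>; the result does not depend on it once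
  \<phi> is multiplicative and vanishes only at zero.\<close>

definition fract_map :: "('r::idom \<Rightarrow> 'r) \<Rightarrow> 'r fract \<Rightarrow> 'r fract" where
  "fract_map \<phi> q = (case (SOME p. snd p \<noteq> 0 \<and> q = Fract (fst p) (snd p)) of (a, b) \<Rightarrow> Fract (\<phi> a) (\<phi> b))"

lemma fract_map_Fract:
  assumes mult: "\<And>x y. \<phi> (x * y) = \<phi> x * \<phi> y" and nz: "\<And>x. \<phi> x = 0 \<longleftrightarrow> x = 0" and b: "b \<noteq> 0"
  shows "fract_map \<phi> (Fract a b) = Fract (\<phi> a) (\<phi> b)"
proof -
  obtain c d where cd: "(SOME p. snd p \<noteq> 0 \<and> Fract a b = Fract (fst p) (snd p)) = (c, d)"
    by (cases "SOME p. snd p \<noteq> 0 \<and> Fract a b = Fract (fst p) (snd p)")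
  have "snd (c, d) \<noteq> 0 \<and> Fract a b = Fract (fst (c, d)) (snd (c, d))"
    unfolding cd[symmetric] by (rule someI[of _ "(a, b)"]) (use b in simp)
  then have d: "d \<noteq> 0" "a * d = c * b" using b by (auto simp: eq_fract)
  have "\<phi> a * \<phi> d = \<phi> c * \<phi> b" using arg_cong[OF d(2), of \<phi>] by (simp only: mult)
  then have "Fract (\<phi> c) (\<phi> d) = Fract (\<phi> a) (\<phi> b)"
    using d(1) b by (simp add: eq_fract nz)
  then show ?thesis unfolding fract_map_def cd by simp
qed

lemma field_hom_fract_map:
  assumes mult: "\<And>x y. \<phi> (x * y) = \<phi> x * \<phi> y" and add: "\<And>x y. \<phi> (x + y) = \<phi> x + \<phi> y"
    and one: "\<phi> 1 = 1" and nz: "\<And>x. \<phi> x = 0 \<longleftrightarrow> x = 0"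
  shows "field_hom (fract_map \<phi>)"
proof -
  note F = fract_map_Fract[OF mult nz]
  have 0: "\<phi> 0 = 0" using nz by simp
  have m: "fract_map \<phi> (x * y) = fract_map \<phi> x * fract_map \<phi> y" for x y
    by (cases x, cases y) (simp add: F mult nz)
  have a: "fract_map \<phi> (x + y) = fract_map \<phi> x + fract_map \<phi> y" for x y
    by (cases x, cases y) (simp add: F mult nz add)
  have "fract_map \<phi> 0 = 0" "fract_map \<phi> 1 = 1"
    by (simp_all add: Zero_fract_def One_fract_def F one 0)
  then show ?thesis by unfold_locales (simp_all add: m a)
qed

text \<open>Laurent series over K(x_0, x_1, ...). With infinitely many variables one field serves
  all sizes \<open>e\<close>; only the automorphism depends on \<open>e\<close>.\<close>

type_synonym 'a cycfield = "'a mpoly fract fls"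

definition cemb :: "'a::field \<Rightarrow> 'a cycfield" where
  "cemb a = fls_const (Fract (single 0 a) 1)"

definition cvar :: "nat \<Rightarrow> 'a::field cycfield" where
  "cvar i = fls_const (Fract (mvar i) 1)"

definition cshift :: "nat \<Rightarrow> 'a::field cycfield \<Rightarrow> 'a cycfield" where
  "cshift e = fls_map (fract_map (mshift e))"

lemma field_hom_fract_mshift: "field_hom (fract_map (mshift e) :: 'a::field mpoly fract \<Rightarrow> _)"
proof (rule field_hom_fract_map)
  show "mshift e 1 = (1 :: 'a mpoly)" using mshift_const[of e "1::'a"] by simp
qed (simp_all add: mshift_mult mshift_add mshift_eq_0)

lemma field_hom_cshift: "field_hom (cshift e :: 'a::field cycfield \<Rightarrow> _)"
  unfolding cshift_def by (rule field_hom_fls_map[OF field_hom_fract_mshift])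

lemma field_hom_cemb: "field_hom (cemb :: 'a::field \<Rightarrow> _)"
  unfolding cemb_def
  by unfold_locales (simp_all add: fls_plus_const fls_const_mult_const single_add mult_single
    Zero_fract_def[symmetric] One_fract_def[symmetric])

lemma fls_map_const: "field_hom \<tau> \<Longrightarrow> fls_map \<tau> (fls_const c) = fls_const (\<tau> c)"
proof -
  assume \<tau>: "field_hom \<tau>"
  interpret field_hom \<tau> by fact
  show ?thesis by (simp add: fls_eq_iff fls_nth_map[OF \<tau>])
qed

lemma mshift_1: "mshift e 1 = (1 :: 'a::field mpoly)"
  using mshift_const[of e "1::'a"] by simp

lemma fract_map_mshift: "fract_map (mshift e) (Fract a 1) = Fract (mshift e a) 1"
  by (subst fract_map_Fract) (simp_all add: mshift_mult mshift_eq_0 mshift_1)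

lemma cshift_cemb: "cshift e (cemb a) = cemb a"
  unfolding cshift_def cemb_def fls_map_const[OF field_hom_fract_mshift]
  by (simp add: fract_map_mshift mshift_const)

lemma cshift_cvar: "cshift e (cvar i) = cvar (cyc e i)"
  unfolding cshift_def cvar_def fls_map_const[OF field_hom_fract_mshift]
  by (simp add: fract_map_mshift mshift_var)

lemma inj_cvar: "inj (cvar :: nat \<Rightarrow> 'a::field cycfield)"
proof (rule injI)
  fix i j assume "cvar i = (cvar j :: 'a cycfield)"
  then have "fls_nth (cvar i) 0 = fls_nth (cvar j :: 'a cycfield) 0" by simp
  then have "mvar i = (mvar j :: 'a mpoly)" by (simp add: cvar_def eq_fract)
  then have "keys (mvar i :: 'a mpoly) = keys (mvar j :: 'a mpoly)" by simp
  then have "keys (single i (1::nat)) = keys (single j (1::nat))"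
    by (simp add: mvar_def)
  then show "i = j" by simp
qed

lemma mu_mult_diagm: "j < e \<Longrightarrow> mu i j * diagm e f = cst (f j) * mu i j"
  by (rule cfm_eqI) (auto simp: ent_mu_mult ent_diagm ent_mu ent_cst)

lemma diagm_mult_mu: "i < e \<Longrightarrow> diagm e f * mu i j = cst (f i) * mu i j"
  by (rule cfm_eqI) (auto simp: ent_mult_mu ent_diagm ent_mu ent_cst)

text \<open>The division algebra is generated over the fixed field of \<open>cshift e\<close> by the
  diagonal matrix of x_0, ..., x_(e-1) and by \<open>cycZ e\<close>. Moving the diagonal matrix past
  \<open>cycZ e\<close> shifts its entries cyclically, exactly as \<open>cshift e\<close>
  does.\<close>

lemma regularity_infinite:
  fixes X T :: "nat \<Rightarrow> 'a::field cfm"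
  assumes inf: "infinite (UNIV :: 'a set)" and e: "e > 0"
    and X: "\<And>k. k < m \<Longrightarrow> corner n n (X k)" and T: "\<And>k. k < m \<Longrightarrow> corner e e (T k)"
    and rk: "rank_ge (blow m X T) (Suc (\<rho> * e))"
  obtains T' where "\<And>k. k < m \<Longrightarrow> corner e e (T' k)" "rank_ge (blow m X T') (Suc \<rho> * e)"
proof -
  let ?Z = "cycZ e :: 'a cycfield cfm"
  let ?\<sigma> = "cshift e :: 'a cycfield \<Rightarrow> _"
  let ?D = "\<lambda>j. diagm e (\<lambda>b. cvar b ^ fst j) * ?Z ^ snd j"
  interpret h: field_hom "cemb :: 'a \<Rightarrow> _" by (rule field_hom_cemb)
  interpret \<sigma>: field_hom ?\<sigma> by (rule field_hom_cshift)
  have wX: "?\<sigma> fls_X = fls_X"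
  proof -
    interpret t: field_hom "fract_map (mshift e) :: 'a mpoly fract \<Rightarrow> _" by (rule field_hom_fract_mshift)
    show ?thesis unfolding cshift_def by (simp add: fls_eq_iff fls_nth_map[OF field_hom_fract_mshift])
  qed
  have mZ: "mapc ?\<sigma> ?Z = ?Z"
    unfolding cycZ_def by (simp add: \<sigma>.mapc_add \<sigma>.mapc_sum \<sigma>.mapc_mult \<sigma>.mapc_mu \<sigma>.mapc_cst wX)
  have Zdiag: "?Z * diagm e f = mapc ?\<sigma> (diagm e f) * ?Z" if f: "\<And>i. i < e \<Longrightarrow> ?\<sigma> (f i) = f (cyc e i)" for f
  proof -
    have mf: "mapc ?\<sigma> (diagm e f) = diagm e (\<lambda>i. f (cyc e i))"
      unfolding diagm_def by (simp add: \<sigma>.mapc_sum \<sigma>.mapc_mult \<sigma>.mapc_mu \<sigma>.mapc_cst f)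
    have "mu i (Suc i) * diagm e f = diagm e (\<lambda>i. f (cyc e i)) * mu i (Suc i)" if "i < e - 1" for i
    proof -
      have "i < e" "Suc i < e" using that by simp_all
      then show ?thesis by (simp add: mu_mult_diagm diagm_mult_mu cyc_def)
    qed
    moreover have "mu (e - 1) 0 * diagm e f = diagm e (\<lambda>i. f (cyc e i)) * mu (e - 1) 0"
      using e by (simp add: mu_mult_diagm diagm_mult_mu cyc_def)
    ultimately show ?thesis
      unfolding mf cycZ_def distrib_left distrib_right sum_distrib_left sum_distrib_right
      by (simp add: mult.assoc cst_left_commute)
  qed
  have Zc: "corner e e ?Z" by (rule corner_cycZ[OF e])
  have Dc: "corner e e (?D j)" for j
  proof -
    have d: "pr e * diagm e f = diagm e f" "diagm e f * pr e = diagm e f" for f :: "nat \<Rightarrow> 'a cycfield"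
      by (rule cfm_eqI, auto simp: ent_pr_mult ent_mult_pr ent_diagm)+
    have "diagm e f * ?Z ^ k * pr e = diagm e f * ?Z ^ k" for f k
      by (induction k) (use Zc in \<open>simp_all add: d corner_def power_Suc2 mult.assoc del: power_Suc\<close>)
    then show ?thesis by (simp add: corner_def d mult.assoc[symmetric])
  qed
  have DZ: "?Z * ?D j = mapc ?\<sigma> (?D j) * ?Z" for j
  proof -
    have mpow: "mapc ?\<sigma> (?Z ^ k) = ?Z ^ k" for k
      by (induction k) (simp_all add: \<sigma>.mapc_1 \<sigma>.mapc_mult mZ)
    have "?Z * ?D j = mapc ?\<sigma> (diagm e (\<lambda>b. cvar b ^ fst j)) * (?Z * ?Z ^ snd j)"
      unfolding mult.assoc[symmetric]
      by (subst Zdiag) (simp_all add: cshift_cvar \<sigma>.hom_power)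
    then show ?thesis by (simp add: \<sigma>.mapc_mult mpow power_commutes mult.assoc)
  qed
  interpret division_blocks "cemb :: 'a \<Rightarrow> _" ?\<sigma> ?Z e "{..<e} \<times> {..<e}" ?D
  proof unfold_locales
    fix A :: "'a cycfield cfm" assume "corner e e A" "A \<noteq> 0" "?Z * A = mapc ?\<sigma> A * ?Z"
    then show "\<exists>B. corner e e B \<and> A * B = pr e \<and> B * A = pr e"
      unfolding cshift_def by (intro cyclic_division[OF field_hom_fract_mshift e])
  next
    fix T :: "'a cycfield cfm" assume "corner e e T"
    then show "\<exists>c. T = (\<Sum>j\<in>{..<e} \<times> {..<e}. cst (c j) * ?D j)"
      by (intro cyclic_span e inj_on_subset[OF inj_cvar]) auto
  qed (use e inf in \<open>auto simp: cshift_cemb Zc Dc DZ\<close>)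
  show thesis using regularity[OF X T rk] that by blast
qed

section \<open>Blow-ups of full rank\<close>

lemma pr_1: "pr (Suc 0) = mu 0 0"
  by (simp add: pr_Suc)

text \<open>A common kernel vector spans a line with image zero, which is a shrunk subspace with
  \<open>a = n\<close> and \<open>b = 1\<close>.\<close>

lemma not_shrunk_kernel:
  assumes ns: "\<not> shrunk n m X" and v: "pr n * v = v" "v \<noteq> 0"
  shows "\<exists>k<m. X k * v \<noteq> 0"
proof (rule ccontr)
  assume "\<not> ?thesis"
  then have Xv: "X k * v = 0" if "k < m" for k using that by blast
  obtain i j where ij: "ent v i j \<noteq> 0" using v nonzero_entry by blast
  define Q where "Q = v * mu j 0 * cst (inverse (ent v i j))"
  have "mu 0 i * pr n * Q = mu 0 i * v * mu j 0 * cst (inverse (ent v i j))"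
    by (simp add: Q_def mult.assoc) (simp add: v mult.assoc[symmetric])
  also have "\<dots> = pr 1"
    unfolding mu_mult_mult_mu using ij
    by (simp add: mult.assoc cst_commute[symmetric]) (simp add: mult.assoc[symmetric] cst_mult[symmetric] pr_1)
  finally have "mu 0 i * pr n * Q = pr 1" .
  moreover have "pr n * X k * Q = 0" if "k < m" for k
    using Xv[OF that] by (simp add: Q_def mult.assoc) (simp add: mult.assoc[symmetric])
  ultimately have "shrunk n m X"
    unfolding shrunk_def
    by (intro exI[of _ n] exI[of _ 1] exI[of _ "pr n"] exI[of _ "mu 0 i"] exI[of _ Q]) auto
  then show False using ns by blast
qed

lemma full_blowup_exists:
  fixes X :: "nat \<Rightarrow> 'a::field cfm"
  assumes inf: "infinite (UNIV :: 'a set)" and X: "\<And>k. k < m \<Longrightarrow> corner n n (X k)"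
    and ns: "\<not> shrunk n m X"
  obtains d T where "d > 0" "\<And>k. k < m \<Longrightarrow> corner d d (T k)" "rank_ge (blow m X T) (n * d)"
proof -
  let ?ok = "\<lambda>\<rho>. \<exists>d T. d > 0 \<and> (\<forall>k<m. corner d d (T k)) \<and> rank_ge (blow m X T) (\<rho> * d)"
  have bd: "\<rho> \<le> n" if \<rho>: "?ok \<rho>" for \<rho>
  proof -
    obtain d T where d: "d > 0" and T: "\<forall>k<m. corner d d (T k)" and r: "rank_ge (blow m X T) (\<rho> * d)"
      using \<rho> by blast
    have eT: "(pr n \<boxtimes> pr d) * blow m X T = blow m X T" by (rule blow_corner[OF X]) (use T in auto)
    have "\<rho> * d \<le> n * d" using rank_ge_corner_le[OF fin_idem_kr disjI1[OF eT] r] .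
    then show ?thesis using d by simp
  qed
  define \<rho> where "\<rho> = Max {\<rho>. ?ok \<rho>}"
  have fin: "finite {\<rho>. ?ok \<rho>}" by (rule finite_subset[of _ "{..n}"]) (use bd in auto)
  have "?ok 0" by (rule exI[of _ 1], rule exI[of _ "\<lambda>_. 0"]) (simp add: corner_def)
  then have ok: "?ok \<rho>" using Max_in[OF fin] unfolding \<rho>_def by blast
  have nok: "\<not> ?ok (Suc \<rho>)"
  proof
    assume "?ok (Suc \<rho>)"
    then have "Suc \<rho> \<le> \<rho>" unfolding \<rho>_def by (intro Max_ge[OF fin]) simp
    then show False by simp
  qed
  \<comment> \<open>Maximality of \<rho> bounds the rank at every size \<open>d\<close>: one unit
    above \<open>\<rho> * d\<close> would be rounded up to \<open>Suc \<rho> * d\<close> by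
    regularity.\<close>
  have nreg: "\<not> rank_ge (blow m X T) (Suc (\<rho> * d))" if d: "d > 0" and T: "\<And>k. k < m \<Longrightarrow> corner d d (T k)" for d T
  proof
    assume r: "rank_ge (blow m X T) (Suc (\<rho> * d))"
    obtain T' where T': "\<And>k. k < m \<Longrightarrow> corner d d (T' k)" "rank_ge (blow m X T') (Suc \<rho> * d)"
      by (rule regularity_infinite[OF inf d X T r]; (assumption | blast intro: that))
    have "?ok (Suc \<rho>)" by (rule exI[of _ d], rule exI[of _ T']) (use T' d in blast)
    then show False using nok by contradiction
  qed
  obtain d T where d: "d > 0" and T: "\<forall>k<m. corner d d (T k)" and r: "rank_ge (blow m X T) (\<rho> * d)"
    using ok by blast
  have T': "corner d d (T k)" if "k < m" for k using T that by blast
  show thesis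
  proof (cases "\<rho> = n")
    case True
    then show thesis using that d T r by blast
  next
    case False
    then have "\<rho> * d < n * d" using bd[OF ok] d by simp
    moreover have "rank_ge (blow m X T) t \<longleftrightarrow> t \<le> \<rho> * d" for t
    proof
      assume "rank_ge (blow m X T) t"
      then show "t \<le> \<rho> * d" using nreg[OF d T'] rank_ge_mono by (meson not_less_eq_eq)
    qed (use rank_ge_mono[OF r] in blast)
    ultimately have lt: "\<rho> * d < n * d" and rk: "\<And>t. rank_ge (blow m X T) t \<longleftrightarrow> t \<le> \<rho> * d" by blast+
    obtain c T2 where "c > 0" "\<And>k. k < m \<Longrightarrow> corner (d * c) (d * c) (T2 k)"
      "rank_ge (blow m X T2) (Suc (\<rho> * d * c))"
      by (rule rank_increment[OF X T' ns rk lt]; (assumption | blast intro: that))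
    then have False using nreg[of "d * c" T2] d by (simp add: mult.assoc)
    then show thesis ..
  qed
qed

text \<open>Each coefficient \<open>T k\<close> is tensored with an identity matrix of size
  \<open>c\<close>, which multiplies the rank by \<open>c\<close>.\<close>

lemma full_blowup_multiple:
  fixes X T :: "nat \<Rightarrow> 'a::field cfm"
  assumes X: "\<And>k. k < m \<Longrightarrow> corner n n (X k)" and T: "\<And>k. k < m \<Longrightarrow> corner d d (T k)"
    and rk: "rank_ge (blow m X T) (n * d)"
  obtains T' where "\<And>k. corner (d * c) (d * c) (T' k)" "rank_ge (blow m X T') (n * d * c)"
proof -
  let ?e = "pr n \<boxtimes> pr d :: 'a cfm"
  have eT: "?e * blow m X T = blow m X T" by (rule blow_corner[OF X T])
  obtain R where R: "blow m X T * R = ?e" by (rule full_right_inverse[OF fin_idem_kr eT rk]) (rule that)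
  obtain U V where UV: "V * U = pr (n * d)" "U * V = ?e" "U * pr (n * d) = U"
    using fin_idem_kr[of n d] unfolding fin_idem_def by blast
  have "(V \<boxtimes> 1) * (blow m X T \<boxtimes> pr c) * (R * U \<boxtimes> pr c) = pr (n * d) \<boxtimes> pr c"
    unfolding kr_mult using R UV by (simp add: mult.assoc) (metis UV mult.assoc pr_idem)
  moreover have "rank_ge (pr (n * d) \<boxtimes> pr c :: 'a cfm) (n * d * c)"
    using rank_ge_fin_idem[OF fin_idem_kr] by blast
  ultimately have r: "rank_ge (blow m X T \<boxtimes> pr c) (n * d * c)" by (metis rank_ge_mult)
  obtain \<alpha> \<alpha>' :: "'a cfm" where al: "\<alpha> * \<alpha>' = 1"
    "\<And>X T E. ((X \<boxtimes> T) \<boxtimes> E) * \<alpha> = \<alpha> * (X \<boxtimes> (T \<boxtimes> E))" using kr_assoc by metis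
  have "(blow m X T \<boxtimes> pr c) * \<alpha> = \<alpha> * blow m X (\<lambda>k. T k \<boxtimes> pr c)"
    unfolding blow_def kr_sum_left sum_distrib_left sum_distrib_right by (simp add: al)
  then have "(blow m X T \<boxtimes> pr c) * \<alpha> * \<alpha>' = \<alpha> * blow m X (\<lambda>k. T k \<boxtimes> pr c) * \<alpha>'" by simp
  then have "blow m X T \<boxtimes> pr c = \<alpha> * blow m X (\<lambda>k. T k \<boxtimes> pr c) * \<alpha>'" using al by (simp add: mult.assoc)
  then have r2: "rank_ge (blow m X (\<lambda>k. T k \<boxtimes> pr c)) (n * d * c)" using r by (metis rank_ge_mult)
  have "T k \<boxtimes> pr c = (pr d \<boxtimes> pr c) * (T k \<boxtimes> pr c) * (pr d \<boxtimes> pr c)" if "k < m" for k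
    using T[OF that] by (simp add: kr_mult corner_def)
  then show thesis using blow_unnest[OF _ r2, where d = d and c = c] that by blast
qed

section \<open>Linear combinations of the X_k and the descent in size\<close>

definition comb :: "nat \<Rightarrow> (nat \<Rightarrow> 'a::field cfm) \<Rightarrow> (nat \<Rightarrow> 'a) \<Rightarrow> 'a cfm" where
  "comb m X \<beta> = (\<Sum>k<m. cst (\<beta> k) * X k)"

lemma comb_unit: "k < m \<Longrightarrow> comb m X (\<lambda>l. if l = k then 1 else 0) = X k"
proof -
  assume k: "k < m"
  have "comb m X (\<lambda>l. if l = k then 1 else 0) = (\<Sum>l<m. if l = k then X l else 0)"
    unfolding comb_def by (rule sum.cong) auto
  then show ?thesis using k by simp
qed

lemma comb_add: "comb m X (\<lambda>k. \<beta> k + \<beta>' k) = comb m X \<beta> + comb m X \<beta>'"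
  unfolding comb_def by (simp add: cst_add distrib_right sum.distrib)

lemma comb_corner:
  assumes "\<And>k. k < m \<Longrightarrow> corner n n (X k)" shows "corner n n (comb m X \<beta>)"
  using assms unfolding corner_def comb_def sum_distrib_left sum_distrib_right
  by (auto intro!: sum.cong simp: cst_left_commute mult.assoc)

text \<open>A matrix of rank at most one is a column times a row, so all columns of
  \<open>B * x\<close> and \<open>B * y\<close> are multiples of the same column and the two-by-two
  minors vanish.\<close>

lemma rank_one_minors:
  assumes B: "corner n n B" and r: "\<not> rank_ge B 2"
  shows "ent (B * x) i p * ent (B * y) k q = ent (B * x) k p * ent (B * y) i q"
proof -
  have "pr n * B = B" using B by (simp add: corner_def)
  then obtain s P Q where N: "B * Q * P * B = B" "Q * pr s = Q" "\<And>t. rank_ge B t \<longleftrightarrow> t \<le> s"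
    using rank_normal_form[OF fin_idem_pr disjI1] by metis
  have "s \<le> 1" using N(3)[of 2] r by simp
  then have "Q * pr 1 = Q" using N(2) by (metis mult.assoc pr_mult_pr min.absorb1)
  then have e: "ent (B * z) i p = ent (B * Q) i 0 * ent (P * B * z) 0 p" for z i p
  proof -
    have "B * z = (B * Q * pr 1) * (P * B * z)"
      using N(1) \<open>Q * pr 1 = Q\<close> by (simp add: mult.assoc) (metis mult.assoc)
    also have "ent \<dots> i p = ent (B * Q * pr 1) i 0 * ent (P * B * z) 0 p"
      by (rule ent_times_single_left) (simp add: ent_mult_pr)
    finally show ?thesis using \<open>Q * pr 1 = Q\<close> by (simp add: mult.assoc)
  qed
  show ?thesis unfolding e[of x] e[of y] by (simp add: mult_ac)
qed

text \<open>A space of matrices of rank at most one has a common kernel hyperplane or a common image line.\<close>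

lemma rank_two_exists:
  fixes X :: "nat \<Rightarrow> 'a::field cfm"
  assumes X: "\<And>k. k < m \<Longrightarrow> corner n n (X k)" and ns: "\<not> shrunk n m X" and n: "n \<ge> 2"
  shows "\<exists>\<beta>. rank_ge (comb m X \<beta>) 2"
proof (rule ccontr)
  assume no: "\<not> ?thesis"
  define S where "S = range (comb m X)"
  have XS: "X k \<in> S" if "k < m" for k using comb_unit[OF that, of X] unfolding S_def by (metis rangeI)
  have Sadd: "A + B \<in> S" if AB: "A \<in> S" "B \<in> S" for A B
  proof -
    obtain \<beta> \<beta>' where "A = comb m X \<beta>" "B = comb m X \<beta>'" using AB unfolding S_def by auto
    then have "A + B = comb m X (\<lambda>k. \<beta> k + \<beta>' k)" by (simp add: comb_add)
    then show ?thesis unfolding S_def by simp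
  qed
  have min: "ent (B * x) i p * ent (B * y) k q = ent (B * x) k p * ent (B * y) i q" if "B \<in> S" for B x y i k p q
    using that no unfolding S_def by (auto intro!: rank_one_minors comb_corner[OF X])
  have "ent (pr n :: 'a cfm) 0 0 \<noteq> 0" using n by (simp add: ent_pr)
  then have "pr n \<noteq> (0 :: 'a cfm)" by auto
  then obtain k0 where k0: "k0 < m" "X k0 * pr n \<noteq> 0" using not_shrunk_kernel[OF ns, of "pr n"] by auto
  define A where "A = X k0"
  have A: "A \<in> S" "pr n * A = A" "A * pr n = A" "A \<noteq> 0" using k0 X[OF k0(1)] XS by (auto simp: A_def corner_def)
  obtain i0 j where ij: "ent A i0 j \<noteq> 0" using A(4) nonzero_entry by blast
  obtain s P Q where N: "A * Q * P * A = A" "Q * pr s = Q" "\<And>t. rank_ge A t \<longleftrightarrow> t \<le> s"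
    using rank_normal_form[OF fin_idem_pr disjI1[OF A(2)]] by metis
  have "\<not> rank_ge A 2" using no A(1) unfolding S_def by blast
  then have s: "s \<le> 1" using N(3)[of 2] by simp
  define v where "v = pr n - pr n * Q * P * A"
  have Av: "A * v = 0"
    unfolding v_def right_diff_distrib using A N by (simp add: mult.assoc[symmetric])
  have "v \<noteq> 0"
  proof
    assume "v = 0"
    then have "pr n * Q * pr s * (P * A) = pr n" using N(2) by (simp add: v_def mult.assoc)
    then have "n \<le> s" by (rule pr_factor_le)
    then show False using s n by simp
  qed
  moreover have "pr n * v = v" by (simp add: v_def right_diff_distrib mult.assoc)
  ultimately obtain k1 where k1: "k1 < m" "X k1 * v \<noteq> 0" using not_shrunk_kernel[OF ns] by blast
  define B where "B = X k1"
  have B: "B \<in> S" using XS k1 by (simp add: B_def)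
  obtain i1 q where b1: "ent (B * v) i1 q \<noteq> 0" using k1 nonzero_entry unfolding B_def by blast
  \<comment> \<open>Polarization of the minors of \<open>A + C\<close>. As \<open>A * v = 0\<close>,
    only the mixed term survives, and it says that \<open>C * v\<close> is proportional to column
    \<open>j\<close> of \<open>A\<close>.\<close>
  have c1: "ent A i j * ent (C * v) k q = ent A k j * ent (C * v) i q" if C: "C \<in> S" for C i k
  proof -
    have "ent ((A + C) * 1) i j * ent ((A + C) * v) k q = ent ((A + C) * 1) k j * ent ((A + C) * v) i q"
      by (rule min[OF Sadd[OF A(1) C]])
    moreover have "ent (C * 1) i j * ent (C * v) k q = ent (C * 1) k j * ent (C * v) i q" by (rule min[OF C])
    ultimately show ?thesis by (simp add: distrib_right Av)
  qed
  \<comment> \<open>\<open>B * v\<close> is nonzero and spans the same line. Polarizing the minors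
    of \<open>B + C\<close> shows that the image of every \<open>C\<close> in the space lies in this
    line; the case of a common kernel hyperplane was excluded by the choice of
    \<open>k1\<close>.\<close>
  have c2: "ent (B * v) i q * ent C k z = ent (B * v) k q * ent C i z" if C: "C \<in> S" for C i k z
  proof -
    let ?a = "\<lambda>i. ent A i j" and ?b = "\<lambda>i. ent (B * v) i q" and ?c = "\<lambda>i. ent (C * v) i q"
    have b0: "?b i0 \<noteq> 0" using c1[OF B, of i0 i1] ij b1 by auto
    have cb: "?c i * ?b i0 = ?c i0 * ?b i" for i
    proof -
      have "?a i0 * (?c i * ?b i0) = ?a i0 * (?c i0 * ?b i)"
      proof -
        have "?a i0 * (?c i * ?b i0) = (?a i0 * ?c i) * ?b i0" by (simp add: mult.assoc)
        also have "\<dots> = (?a i * ?b i0) * ?c i0" unfolding c1[OF C, of i0 i] by (simp add: mult_ac)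
        also have "\<dots> = ?a i0 * (?c i0 * ?b i)" unfolding c1[OF B, of i0 i, symmetric] by (simp add: mult_ac)
        finally show ?thesis .
      qed
      then show ?thesis using ij by simp
    qed
    have "ent ((B + C) * v) i q * ent ((B + C) * 1) k z = ent ((B + C) * v) k q * ent ((B + C) * 1) i z"
      by (rule min[OF Sadd[OF B C]])
    moreover have mB: "?b i * ent (B * 1) k z = ?b k * ent (B * 1) i z" by (rule min[OF B])
    moreover have "?c i * ent (C * 1) k z = ?c k * ent (C * 1) i z" by (rule min[OF C])
    moreover have "?c i * ent B k z = ?c k * ent B i z"
    proof -
      have "?b i0 * (?c i * ent B k z) = ?c i0 * (?b i * ent B k z)" using cb[of i] by (simp add: mult_ac)
      also have "\<dots> = ?c i0 * (?b k * ent B i z)" using mB by simp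
      also have "\<dots> = ?b i0 * (?c k * ent B i z)" using cb[of k] by (simp add: mult_ac)
      finally show ?thesis using b0 by simp
    qed
    ultimately show ?thesis by (simp add: distrib_left distrib_right)
  qed
  have "pr n * (B * v) = B * v" using X[OF k1(1)] by (simp add: corner_def B_def mult.assoc[symmetric])
  then have "ent (pr n * (B * v)) i1 q \<noteq> 0" using b1 by simp
  then have i1: "i1 < n" by (auto simp: ent_pr_mult split: if_splits)
  \<comment> \<open>Any index other than \<open>i1\<close>, available since
    \<open>n \<ge> 2\<close>. The row \<open>P'\<close> is nonzero and annihilates the common image
    line, so the whole space is shrunk, with \<open>a = 1\<close> and \<open>b = n\<close>.\<close>
  define k2 :: nat where "k2 = (if i1 = 0 then 1 else 0)"
  have k2: "k2 < n" "k2 \<noteq> i1" using n by (auto simp: k2_def)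
  define P' where "P' = mu 0 k2 - cst (ent (B * v) k2 q / ent (B * v) i1 q) * mu 0 i1"
  have "P' * pr n * mu k2 0 = pr 1"
    using k2 i1 by (simp add: P'_def left_diff_distrib mult.assoc pr_mult_mu mu_mult_mu pr_1)
  moreover have "P' * X k * pr n = 0" if k: "k < m" for k
  proof -
    have "P' * X k = 0"
    proof (rule cfm_eqI)
      fix r z
      show "ent (P' * X k) r z = ent 0 r z"
        using c2[OF XS[OF k], of i1 k2 z] b1
        by (simp add: P'_def left_diff_distrib ent_mu_mult mult.assoc field_simps)
    qed
    then show ?thesis by simp
  qed
  ultimately have "shrunk n m X"
    unfolding shrunk_def
    by (intro exI[of _ 1] exI[of _ n] exI[of _ P'] exI[of _ "mu k2 0"] exI[of _ "pr n"]) auto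
  then show False using ns by blast
qed

text \<open>A nonzero kernel vector of the stack is not killed by some X_k, and stacking that matrix
  raises the rank. Starting from rank two rather than one saves a combination: \<open>n - 1\<close>
  of them have no common kernel.\<close>

lemma common_kernel_trivial:
  fixes X :: "nat \<Rightarrow> 'a::field cfm"
  assumes X: "\<And>k. k < m \<Longrightarrow> corner n n (X k)" and ns: "\<not> shrunk n m X" and n: "n \<ge> 2"
  shows "\<exists>\<beta>. rank_ge (\<Sum>a<Suc j. io a * comb m X (\<beta> a)) (min n (j + 2))"
proof (induction j)
  case 0
  obtain \<beta> where "rank_ge (comb m X \<beta>) 2" using rank_two_exists[OF X ns n] by blast
  moreover have "comb m X \<beta> = oi 0 * (io 0 * comb m X \<beta>) * 1" by (simp add: mult.assoc[symmetric] oi_mult_io)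
  ultimately have "rank_ge (io 0 * comb m X \<beta>) 2" by (metis rank_ge_mult)
  then show ?case using n by (intro exI[of _ "\<lambda>_. \<beta>"]) (simp add: min_def eval_nat_numeral)
next
  case (Suc j)
  then obtain \<beta> where \<beta>: "rank_ge (\<Sum>a<Suc j. io a * comb m X (\<beta> a)) (min n (j + 2))" by blast
  define M where "M = (\<Sum>a<Suc j. io a * comb m X (\<beta> a))"
  have Mn: "M * pr n = M"
    using comb_corner[OF X, of m] unfolding M_def sum_distrib_right corner_def by (simp add: mult.assoc)
  obtain r P Q where N: "P * M * Q = pr r" "M * Q * P * M = M" "Q * pr r = Q" "pr r * P = P" "\<And>t. rank_ge M t \<longleftrightarrow> t \<le> r" "r \<le> n"
    using rank_normal_form[OF fin_idem_pr disjI2[OF Mn]] by metis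
  have r: "min n (j + 2) \<le> r" using \<beta> N(5) unfolding M_def by blast
  have upd: "(\<Sum>a<Suc (Suc j). io a * comb m X ((\<beta>(Suc j := \<gamma>)) a)) = M + io (Suc j) * comb m X \<gamma>" for \<gamma>
  proof -
    have "(\<Sum>a<Suc j. io a * comb m X ((\<beta>(Suc j := \<gamma>)) a)) = M"
      unfolding M_def by (rule sum.cong) auto
    then show ?thesis by (subst sum.lessThan_Suc) simp
  qed
  show ?case
  proof (cases "min n (Suc j + 2) \<le> r")
    case True
    then have "rank_ge M (min n (Suc j + 2))" using N(5) by blast
    moreover have "comb m X (\<lambda>_. 0) = 0" by (simp add: comb_def)
    ultimately have "rank_ge (M + io (Suc j) * comb m X (\<lambda>_. 0)) (min n (Suc j + 2))" by simp
    then show ?thesis unfolding upd[symmetric] by (rule exI[of _ "\<beta>(Suc j := \<lambda>_. 0)"])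
  next
    case False
    then have rn: "r < n" "Suc r = Suc j + 2" using r by auto
    define v where "v = pr n - pr n * Q * P * M"
    have Mv: "M * v = 0"
      unfolding v_def right_diff_distrib using Mn N by (simp add: mult.assoc[symmetric])
    have "v \<noteq> 0"
    proof
      assume "v = 0"
      then have "pr n * Q * pr r * (P * M) = pr n" using N(3) by (simp add: v_def mult.assoc)
      then have "n \<le> r" by (rule pr_factor_le)
      then show False using rn by simp
    qed
    moreover have "pr n * v = v" by (simp add: v_def right_diff_distrib mult.assoc)
    ultimately obtain k where k: "k < m" "X k * v \<noteq> 0" using not_shrunk_kernel[OF ns] by blast
    define M2 where "M2 = M + io (Suc j) * X k"
    define \<pi> where "\<pi> = (1 \<boxtimes> pr (Suc j) :: 'a cfm)"
    have pio: "\<pi> * io a = (if a < Suc j then io a else 0)" for a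
      unfolding \<pi>_def pr_eq_sum kr_sum_right sum_distrib_right by (simp add: kr_mu_io)
    have "\<pi> * M = M" unfolding M_def sum_distrib_left by (rule sum.cong) (auto simp: mult.assoc[symmetric] pio)
    then have \<pi>M: "\<pi> * M2 = M" unfolding M2_def distrib_left by (simp add: mult.assoc[symmetric] pio)
    define Q2 where "Q2 = pr n * Q"
    have PMQ: "(P * \<pi>) * M2 * Q2 = pr r"
      using N(1) \<pi>M Mn by (simp add: Q2_def mult.assoc) (metis mult.assoc)
    have "M2 * Q2 * (P * \<pi>) * M2 \<noteq> M2"
    proof
      assume "M2 * Q2 * (P * \<pi>) * M2 = M2"
      then have "M2 * (pr n * Q * P * M) = M2" using \<pi>M by (simp add: Q2_def mult.assoc)
      moreover have "M2 * pr n = M2"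
        using Mn X[OF k(1)] by (simp add: M2_def distrib_right mult.assoc corner_def)
      ultimately have "M2 * v = 0" by (simp add: v_def right_diff_distrib)
      then have "io (Suc j) * (X k * v) = 0" using Mv by (simp add: M2_def distrib_right mult.assoc)
      then have "oi (Suc j) * io (Suc j) * (X k * v) = 0" by (simp add: mult.assoc)
      then show False using k(2) by (simp add: oi_mult_io)
    qed
    then have "rank_ge M2 (Suc r)" using rank_ge_extend[OF PMQ] by blast
    then have "rank_ge M2 (min n (Suc j + 2))" by (rule rank_ge_mono) (use rn in simp)
    then have "rank_ge (M + io (Suc j) * comb m X (\<lambda>l. if l = k then 1 else 0)) (min n (Suc j + 2))"
      by (simp only: M2_def comb_unit[OF k(1)])
    then show ?thesis unfolding upd[symmetric] by (rule exI[of _ "\<beta>(Suc j := \<lambda>l. if l = k then 1 else 0)"])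
  qed
qed

lemma mp_mult_mu: "mp s * mu l i = mu (s l) i"
  by (rule cfm_eqI) (simp add: ent_mult_mu ent_mp ent_mu)

text \<open>Basis extension by columns of \<open>A\<close>: a nonzero entry of the Schur complement
  names the column to add, and the columns already chosen remain.\<close>

lemma column_selection:
  fixes A :: "'a::field cfm"
  assumes rk: "rank_ge A N" and s0: "P0 * A * mp s0 * pr r0 = pr r0" and r: "r0 \<le> r" "r \<le> N"
  shows "\<exists>s P. (\<forall>l<r0. s l = s0 l) \<and> P * A * mp s * pr r = pr r"
  using r
proof (induction r rule: dec_induct)
  case base
  then show ?case using s0 by blast
next
  case (step r)
  then obtain s P1 where s: "\<forall>l<r0. s l = s0 l" "P1 * A * mp s * pr r = pr r" by auto
  define P Q :: "'a cfm" where "P = pr r * P1" and "Q = mp s * pr r"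
  have PAQ: "P * A * Q = pr r" using s(2) by (simp add: P_def Q_def mult.assoc)
  have rP: "pr r * P = P" and Qr: "Q * pr r = Q" by (simp_all add: P_def Q_def mult.assoc)
  define E where "E = A - A * Q * P * A"
  have "E \<noteq> 0"
  proof
    assume "E = 0"
    have "pr r * (P * A) = P * A" by (simp add: P_def mult.assoc)
    then have "A = (A * Q) * pr r * (P * A)" using \<open>E = 0\<close> by (simp add: E_def mult.assoc)
    then have "N \<le> r" using rk rank_ge_factor by metis
    then show False using step by simp
  qed
  then obtain i j where c: "ent E i j \<noteq> 0" by (rule nonzero_entry)
  define p where "p = cst (inverse (ent E i j)) * mu r i * (1 - A * Q * P)"
  have pA: "p * A = cst (inverse (ent E i j)) * mu r i * E"
    by (simp add: p_def E_def left_diff_distrib right_diff_distrib mult.assoc)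
  have EQ: "E * Q = 0"
    unfolding E_def left_diff_distrib mult.assoc using PAQ Qr by (simp add: mult.assoc)
  have pAQ: "p * A * Q = 0" by (simp add: pA mult.assoc EQ)
  have pAj: "p * A * mu j r = mu r r"
  proof -
    have "p * A * mu j r = cst (inverse (ent E i j)) * (mu r i * E * mu j r)" by (simp add: pA mult.assoc)
    also have "\<dots> = cst (inverse (ent E i j) * ent E i j) * mu r r"
      unfolding mu_mult_mult_mu by (simp add: cst_mult mult.assoc)
    finally show ?thesis using c by simp
  qed
  define s' where "s' = s(r := j)"
  have Q': "mp s' * pr (Suc r) = Q + mu j r"
    by (rule cfm_eqI) (auto simp: Q_def s'_def ent_mult_pr ent_mp ent_mu)
  \<comment> \<open>The old rows are corrected by multiples of \<open>p\<close> so that they vanish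
    on the new column \<open>j\<close>; \<open>p\<close> itself already vanishes on the old
    columns.\<close>
  define P' where "P' = P - P * A * mu j r * p + p"
  have "P' * A * (Q + mu j r) = pr r + P * A * mu j r - P * A * mu j r * (p * A * Q) - P * A * mu j r * (p * A * mu j r) + p * A * Q + p * A * mu j r"
    unfolding P'_def distrib_left distrib_right left_diff_distrib PAQ by (simp add: mult.assoc)
  also have "\<dots> = pr (Suc r)" unfolding pAQ pAj by (simp add: mult.assoc mu_mult_mu pr_Suc)
  finally have "P' * A * mp s' * pr (Suc r) = pr (Suc r)" using Q' by (simp add: mult.assoc)
  moreover have "\<forall>l<r0. s' l = s0 l" using s(1) step by (simp add: s'_def)
  ultimately show ?case by blast
qed

text \<open>Pigeonhole: \<open>d\<close> columns in each of the blocks 1 to \<open>d\<close> would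
  make \<open>d * d\<close>, but at most \<open>n * (d - 1) \<le> Suc d * (d - 1) < d * d\<close>
  indices lie outside block 0.\<close>

lemma sparse_block:
  fixes c :: "nat \<Rightarrow> nat"
  assumes c: "\<And>l. l < n * d \<Longrightarrow> c l \<le> d" and c0: "\<And>l. l < n \<Longrightarrow> c l = 0" and d: "d > 0" and n: "n \<le> Suc d"
  shows "\<exists>b. 1 \<le> b \<and> b \<le> d \<and> card {l. l < n * d \<and> c l = b} < d"
proof (rule ccontr)
  assume "\<not> ?thesis"
  then have ge: "d \<le> card {l. l < n * d \<and> c l = b}" if "b \<in> {1..d}" for b using that by (auto simp: not_less)
  have "d * d = (\<Sum>b\<in>{1..d}. d)" by simp
  also have "\<dots> \<le> (\<Sum>b\<in>{1..d}. card {l. l < n * d \<and> c l = b})" by (rule sum_mono) (rule ge)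
  also have "\<dots> = card (\<Union>b\<in>{1..d}. {l. l < n * d \<and> c l = b})"
    by (rule card_UN_disjoint[symmetric]) auto
  also have "\<dots> \<le> card {n..<n * d}"
    by (rule card_mono) (use c0 in \<open>auto simp: not_less[symmetric]\<close>)
  also have "\<dots> = n * (d - 1)" by (simp add: diff_mult_distrib2)
  also have "\<dots> \<le> Suc d * (d - 1)" using n by (rule mult_le_mono1)
  also have "\<dots> < d * d" using d by (cases d) auto
  finally show False by simp
qed

text \<open>A generic tuple of \<open>d \<times> (d + 1)\<close> matrices \<open>T\<^sub>k\<close> gives \<open>n d\<close> independent rows, and \<open>n\<close> independent
  columns in block column \<open>0\<close>.  Extend these columns to a basis consisting of columns.  As
  \<open>n d - n < d\<^sup>2\<close>, some block column \<open>b \<ge> 1\<close> contains fewer than \<open>d\<close> of the basis columns and can be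
  deleted.\<close>

lemma blowup_descent:
  fixes X :: "nat \<Rightarrow> 'a::field cfm"
  assumes inf: "infinite (UNIV :: 'a set)" and X: "\<And>k. k < m \<Longrightarrow> corner n n (X k)"
    and ns: "\<not> shrunk n m X" and n: "n \<ge> 2" and d: "d > 0" "n \<le> Suc d"
    and T: "\<And>k. k < m \<Longrightarrow> corner (Suc d) (Suc d) (T k)"
    and rk: "rank_ge (blow m X T) (n * Suc d)"
  obtains T' where "\<And>k. k < m \<Longrightarrow> corner d d (T' k)" "rank_ge (blow m X T') (n * d)"
proof -
  let ?e = "pr n \<boxtimes> pr d :: 'a cfm" and ?f = "pr n \<boxtimes> pr (Suc d) :: 'a cfm"
  have fT: "?f * blow m X T = blow m X T" by (rule blow_corner[OF X T])
  obtain R where R: "blow m X T * R = ?f" by (rule full_right_inverse[OF fin_idem_kr fT rk]) (rule that)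
  \<comment> \<open>Dropping the last block row leaves the remaining \<open>n * d\<close> rows
    independent: the right inverse \<open>R\<close> still inverts them.\<close>
  define T1 where "T1 = (\<lambda>k. pr d * T k)"
  have B1: "blow m X T1 = (1 \<boxtimes> pr d) * blow m X T"
    unfolding T1_def blow_mult_left by simp
  have "blow m X T1 * R = ?e"
    unfolding B1 mult.assoc R by (simp add: kr_mult pr_mult_pr)
  moreover have "rank_ge ?e (n * d)" using rank_ge_fin_idem[OF fin_idem_kr] by blast
  ultimately have "rank_ge (1 * blow m X T1 * R) (n * d)" by simp
  then have r1: "rank_ge (blow m X T1) (n * d)" by (rule rank_ge_mult)
  have T1c: "corner d (Suc d) (T1 k)" if "k < m" for k
    using T[OF that] by (simp add: corner_def T1_def mult.assoc)
  obtain j where j: "d = Suc j" using d by (cases d) auto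
  have "\<exists>\<beta>. rank_ge (\<Sum>a<Suc j. io a * comb m X (\<beta> a)) (min n (j + 2))"
    by (rule common_kernel_trivial[OF X ns n])
  moreover have "min n (j + 2) = n" using d j by simp
  ultimately obtain \<beta> where \<beta>: "rank_ge (\<Sum>a<d. io a * comb m X (\<beta> a)) n"
    unfolding j by auto
  \<comment> \<open>Coefficients supported in column 0, chosen so that block column 0 of the blow-up
    is the stack of the combinations given by \<open>\<beta>\<close>.\<close>
  define T2 where "T2 = (\<lambda>k. \<Sum>a<d. cst (\<beta> a k) * mu a 0)"
  have T2c: "corner d (Suc d) (T2 k)" for k
    unfolding corner_def T2_def sum_distrib_left sum_distrib_right
    by (auto intro!: sum.cong simp: cst_left_commute mult.assoc pr_mult_mu mu_mult_pr)
  have "blow m X T2 * io 0 = (\<Sum>k<m. \<Sum>a<d. cst (\<beta> a k) * (io a * X k))"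
    unfolding blow_def T2_def kr_sum_right sum_distrib_right kr_cst_right by (simp add: mult.assoc kr_mu_io)
  also have "\<dots> = (\<Sum>a<d. io a * comb m X (\<beta> a))"
    unfolding comb_def sum_distrib_left cst_left_commute by (rule sum.swap)
  finally have r2: "rank_ge (blow m X T2 * io 0) n" using \<beta> by simp
  define A1 A2 where "A1 = blow m X T1" and "A2 = blow m X T2"
  have "finite {t. \<not> rank_ge (A1 + cst t * A2) (n * d)}"
    by (rule rank_ge_line[of _ 0]) (use r1 in \<open>simp add: A1_def\<close>)
  then have "finite (insert 0 {t. \<not> rank_ge (A1 + cst t * A2) (n * d)})" by simp
  then obtain t0 where t0: "t0 \<noteq> 0" "rank_ge (A1 + cst t0 * A2) (n * d)"
    using inf by (metis (mono_tags, lifting) UNIV_I ex_new_if_finite insertCI mem_Collect_eq)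
  \<comment> \<open>Reversing the pencil gives \<open>A2 + s A1\<close> the full row rank for almost
    all \<open>s\<close>. The condition on block column 0 holds for almost all \<open>s\<close> as
    well, so one parameter satisfies both.\<close>
  have "A1 + cst t0 * A2 = cst t0 * (A2 + cst (inverse t0) * A1) * 1"
    using t0(1) by (simp add: distrib_left mult.assoc[symmetric] cst_mult[symmetric] add.commute)
  then have "rank_ge (A2 + cst (inverse t0) * A1) (n * d)" using t0(2) by (metis rank_ge_mult)
  then have f1: "finite {s. \<not> rank_ge (A2 + cst s * A1) (n * d)}" by (rule rank_ge_line)
  have f2: "finite {s. \<not> rank_ge (A2 * io 0 + cst s * (A1 * io 0)) n}"
    by (rule rank_ge_line[of _ 0]) (use r2 in \<open>simp add: A2_def\<close>)
  obtain s where "s \<notin> {s. \<not> rank_ge (A2 + cst s * A1) (n * d)} \<union> {s. \<not> rank_ge (A2 * io 0 + cst s * (A1 * io 0)) n}"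
    using ex_new_if_finite[OF inf, of "{s. \<not> rank_ge (A2 + cst s * A1) (n * d)} \<union> {s. \<not> rank_ge (A2 * io 0 + cst s * (A1 * io 0)) n}"]
      f1 f2 by blast
  then have s: "rank_ge (A2 + cst s * A1) (n * d)" "rank_ge (A2 * io 0 + cst s * (A1 * io 0)) n" by auto
  define T3 where "T3 = (\<lambda>k. T2 k + cst s * T1 k)"
  define M where "M = blow m X T3"
  have T3c: "corner d (Suc d) (T3 k)" if "k < m" for k
    using T1c[OF that] T2c[of k] by (simp add: corner_def T3_def distrib_left distrib_right cst_left_commute mult.assoc)
  have M: "M = A2 + cst s * A1"
    unfolding M_def A1_def A2_def T3_def blow_def by (simp add: kr_add_right kr_cst_right sum.distrib sum_distrib_left)
  have rM: "rank_ge M (n * d)" and rM0: "rank_ge (M * io 0) n"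
    using s by (simp_all add: M distrib_right mult.assoc)
  have eM: "?e * M = M" and Mf: "M * ?f = M" unfolding M_def by (rule blow_corner[OF X T3c]; assumption)+
  have "?f * io 0 = io 0 * pr n" by (rule pr_mu_io) simp
  then have "M * io 0 * pr n = M * io 0" using Mf by (metis mult.assoc)
  then obtain P0 where "P0 * (M * io 0) = pr n" by (rule full_left_inverse[OF fin_idem_pr _ rM0]) (rule that)
  then have P0: "P0 * M * mp (\<lambda>i. en i 0) * pr n = pr n" by (simp add: io_def mult.assoc[symmetric])
  have nd: "n \<le> n * d" using d by simp
  obtain s P where sl: "\<forall>l<n. s l = en l 0" and PM: "P * M * mp s * pr (n * d) = pr (n * d)"
    using column_selection[OF rM P0 nd order_refl] by blast
  define c where "c = (\<lambda>l. snd (prod_decode (s l)))"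
  have entf: "ent (Y * ?f) l (en j a) = (if j < n \<and> a < Suc d then ent Y l (en j a) else 0)" for Y l j a
  proof -
    have "ent (Y * ?f) l (en j a) = ent Y l (en j a) * ent ?f (en j a) (en j a)"
    proof (rule ent_times_single)
      fix k assume "k \<noteq> en j a"
      moreover obtain j' a' where "k = en j' a'" using en_ex by blast
      ultimately show "ent ?f k (en j a) = 0" by (auto simp: ent_pr)
    qed
    then show ?thesis by (simp add: ent_pr)
  qed
  have cle: "c l \<le> d" if l: "l < n * d" for l
  proof (rule ccontr)
    assume "\<not> c l \<le> d"
    moreover obtain j a where ja: "s l = en j a" using en_ex by blast
    ultimately have "\<not> a < Suc d" by (simp add: c_def)
    then have "ent (P * M * ?f) l (s l) = 0" unfolding ja entf by simp
    then have "ent (P * M) l (s l) = 0" using Mf by (simp add: mult.assoc)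
    moreover have "ent (P * M * mp s * pr (n * d)) l l = 1" unfolding PM using l by (simp add: ent_pr)
    ultimately show False using l by (simp add: ent_mult_pr ent_mult_mp)
  qed
  have c0: "c l = 0" if "l < n" for l using sl that by (simp add: c_def)
  obtain b where b: "1 \<le> b" "b \<le> d" "card {l. l < n * d \<and> c l = b} < d"
    using sparse_block[of n d c] cle c0 d by blast
  define L where "L = {l. l < n * d \<and> c l \<noteq> b}"
  have finL: "finite L" by (simp add: L_def)
  have "{..<n * d} = {l. l < n * d \<and> c l = b} \<union> L" by (auto simp: L_def)
  then have "card {..<n * d} \<le> card {l. l < n * d \<and> c l = b} + card L" by (metis card_Un_le)
  then have "n * d < d + card L" using b by simp
  moreover have "d \<le> n * d" using n by simp
  \<comment> \<open>At most \<open>d - 1\<close> of the \<open>n * d\<close> basis columns are lost,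
    so \<open>(n - 1) * d + 1\<close> survive, just enough for regularity to round up to
    \<open>n * d\<close>.\<close>
  ultimately have cL: "Suc ((n - 1) * d) \<le> card L" unfolding diff_mult_distrib mult_1 by linarith
  let ?N = "card L"
  obtain g where g: "bij_betw g {0..<?N} L" using ex_bij_betw_nat_finite[OF finL] by blast
  have gL: "g i < n * d" "c (g i) \<noteq> b" if "i < ?N" for i
    using bij_betwE[OF g] that by (auto simp: L_def)
  have ginj: "g i = g i' \<longleftrightarrow> i = i'" if "i < ?N" "i' < ?N" for i i'
    using bij_betw_imp_inj_on[OF g] that by (auto simp: inj_on_def)
  define K G where "K = (\<Sum>i<?N. mu i (g i) :: 'a cfm)" and "G = (\<Sum>i<?N. mu (g i) i :: 'a cfm)"
  have "K * pr (n * d) * G = (\<Sum>i<?N. \<Sum>i'<?N. if i = i' then mu i i' else 0)"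
    unfolding K_def G_def sum_distrib_left sum_distrib_right
    by (subst sum.swap, rule sum.cong[OF refl], rule sum.cong[OF refl])
      (auto simp: mu_mult_pr mu_mult_mu gL ginj)
  also have "\<dots> = pr ?N" by (simp add: pr_eq_sum)
  finally have KG: "K * pr (n * d) * G = pr ?N" .
  \<comment> \<open>The increasing enumeration of the block columns other than \<open>b\<close>;
    right multiplication by \<open>J\<close> deletes column \<open>b\<close>.\<close>
  define sk where "sk = (\<lambda>a. if a < b then a else Suc a)"
  define J J' where "J = (\<Sum>a<d. mu (sk a) a :: 'a cfm)" and "J' = (\<Sum>a<d. mu a (sk a) :: 'a cfm)"
  have JJ: "(1 \<boxtimes> (J * J')) * mu (en j a) i = mu (en j a) i" if a: "a \<le> d" "a \<noteq> b" for j a i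
  proof -
    have "J * J' = (\<Sum>a<d. \<Sum>a'<d. if a = a' then mu (sk a) (sk a') else 0)"
      unfolding J_def J'_def sum_product by (simp add: mu_mult_mu)
    then have JJ': "J * J' = (\<Sum>a<d. mu (sk a) (sk a))" by simp
    define a0 where "a0 = (if a < b then a else a - 1)"
    have a0: "a0 < d" "sk a0 = a" using a b by (auto simp: a0_def sk_def)
    have skinj: "sk a' = a \<longleftrightarrow> a' = a0" for a' using a by (auto simp: a0_def sk_def)
    have m: "(1 \<boxtimes> mu x x) * mu (en j a) i = (if x = a then mu (en j a) i else 0 :: 'a cfm)" for x
    proof (rule cfm_eqI)
      fix p q obtain j' a' where p: "p = en j' a'" using en_ex by blast
      show "ent ((1 \<boxtimes> mu x x) * mu (en j a) i) p q = ent (if x = a then mu (en j a) i else 0 :: 'a cfm) p q"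
        by (auto simp: p ent_mult_mu ent_1 ent_mu)
    qed
    have "(1 \<boxtimes> (J * J')) * mu (en j a) i = (\<Sum>a'<d. if a' = a0 then mu (en j a) i else 0)"
      unfolding JJ' kr_sum_right sum_distrib_right m skinj ..
    then show ?thesis using a0 by simp
  qed
  have "(1 \<boxtimes> (J * J')) * (mp s * pr (n * d) * G) = mp s * pr (n * d) * G"
  proof -
    have G: "mp s * pr (n * d) * G = (\<Sum>i<?N. mu (s (g i)) i)"
      unfolding G_def sum_distrib_left by (rule sum.cong) (auto simp: mult.assoc pr_mult_mu gL mp_mult_mu)
    have "(1 \<boxtimes> (J * J')) * mu (s (g i)) i = mu (s (g i)) i" if i: "i < ?N" for i
    proof -
      obtain j a where ja: "s (g i) = en j a" using en_ex by blast
      have "a = c (g i)" by (simp add: c_def ja)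
      then show ?thesis unfolding ja using gL[OF i] cle by (intro JJ) auto
    qed
    then show ?thesis unfolding G sum_distrib_left by simp
  qed
  moreover have "(1 \<boxtimes> (J * J')) = (1 \<boxtimes> J) * (1 \<boxtimes> J')" by (simp add: kr_mult)
  moreover have "K * P * (M * (mp s * pr (n * d) * G)) = pr ?N"
    using KG PM by (metis mult.assoc)
  ultimately have "(K * P) * (M * (1 \<boxtimes> J)) * ((1 \<boxtimes> J') * (mp s * pr (n * d) * G)) = pr ?N"
    by (metis mult.assoc)
  then have "rank_ge (M * (1 \<boxtimes> J)) ?N" unfolding rank_ge_def by blast
  then have "rank_ge (blow m X (\<lambda>k. T3 k * J)) (Suc ((n - 1) * d))"
    using cL rank_ge_mono unfolding M_def blow_mult_right by auto
  moreover have "corner d d (T3 k * J)" if "k < m" for k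
  proof -
    have "J * pr d = J" unfolding J_def sum_distrib_right by (rule sum.cong) (auto simp: mu_mult_pr)
    then show ?thesis using T3c[OF that] by (simp add: corner_def mult.assoc) (simp add: mult.assoc[symmetric])
  qed
  ultimately have TJ: "\<And>k. k < m \<Longrightarrow> corner d d (T3 k * J)" and rJ: "rank_ge (blow m X (\<lambda>k. T3 k * J)) (Suc ((n - 1) * d))"
    by blast+
  obtain T' where T': "\<And>k. k < m \<Longrightarrow> corner d d (T' k)" "rank_ge (blow m X T') (Suc (n - 1) * d)"
    by (rule regularity_infinite[OF inf d(1) X TJ rJ]; (assumption | blast intro: that))
  show thesis
  proof (rule that[OF T'(1)])
    show "rank_ge (blow m X T') (n * d)" using T'(2) n by simp
  qed assumption
qed

text \<open>A full blow-up of size \<open>d0\<close> is enlarged to size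
  \<open>d0 * d \<ge> d\<close>; the descent then applies at every size \<open>D \<ge> d\<close>,
  since \<open>n \<le> Suc D\<close>.\<close>

theorem full_blowup:
  fixes X :: "nat \<Rightarrow> 'a::field cfm"
  assumes inf: "infinite (UNIV :: 'a set)" and X: "\<And>k. k < m \<Longrightarrow> corner n n (X k)"
    and ns: "\<not> shrunk n m X" and n: "n \<ge> 2" and d: "d \<ge> n - 1"
  obtains T where "\<And>k. k < m \<Longrightarrow> corner d d (T k)" "rank_ge (blow m X T) (n * d)"
proof -
  let ?ok = "\<lambda>d. \<exists>T. (\<forall>k<m. corner d d (T k)) \<and> rank_ge (blow m X T) (n * d)"
  obtain d0 T0 where d0: "d0 > 0" and T0: "\<And>k. k < m \<Longrightarrow> corner d0 d0 (T0 k)" "rank_ge (blow m X T0) (n * d0)"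
    by (rule full_blowup_exists[OF inf X ns]; (assumption | blast intro: that))
  obtain T1 where "\<And>k. corner (d0 * d) (d0 * d) (T1 k)" "rank_ge (blow m X T1) (n * d0 * d)"
    by (rule full_blowup_multiple[OF X T0]; (assumption | blast intro: that))
  then have "?ok (d0 * d)" by (auto simp: mult.assoc)
  moreover have "d \<le> d0 * d" using d0 by simp
  moreover have "?ok d" if "d \<le> D" "?ok D" for D
    using that
  proof (induction D rule: dec_induct)
    case (step D)
    obtain T where T: "\<forall>k<m. corner (Suc D) (Suc D) (T k)" "rank_ge (blow m X T) (n * Suc D)"
      using step.prems by blast
    have D: "D > 0" "n \<le> Suc D" using step.hyps n d by linarith+
    obtain T' where "\<And>k. k < m \<Longrightarrow> corner D D (T' k)" "rank_ge (blow m X T') (n * D)"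
      by (rule blowup_descent[OF inf X ns n D, where T = T]) (use T that in auto)
    then show ?case using step.IH by blast
  qed blast
  ultimately show thesis using that by blast
qed

section \<open>Shrunk subspaces and the null cone\<close>

text \<open>Sylvester's determinant identity: the block matrix \<open>?M\<close> is factored in two
  ways, which trades \<open>r * p\<close> for \<open>p * r\<close>.\<close>

lemma det_one_plus_idempotent:
  fixes r p :: "'a::field mat"
  assumes r: "r \<in> carrier_mat n a" and p: "p \<in> carrier_mat a n" and pr1: "p * r = 1\<^sub>m a"
  shows "det (1\<^sub>m n + c \<cdot>\<^sub>m (r * p)) = (1 + c) ^ a"
proof -
  let ?r = "(- c) \<cdot>\<^sub>m r" and ?E = "1\<^sub>m n + c \<cdot>\<^sub>m (r * p)"
  let ?L = "four_block_mat (1\<^sub>m n) (0\<^sub>m n a) p (1\<^sub>m a)"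
  let ?M = "four_block_mat (1\<^sub>m n) ?r p (1\<^sub>m a)"
  have E: "?E \<in> carrier_mat n n" using r p by simp
  have L: "?L \<in> carrier_mat (n + a) (n + a)" using p by simp
  have dL: "det ?L = 1"
    by (subst det_four_block_mat_upper_right_zero[of _ n _ a]) (use p in auto)
  have "four_block_mat ?E ?r (0\<^sub>m a n) (1\<^sub>m a) * ?L = ?M"
  proof (subst mult_four_block_mat[of _ n n _ a _ a _ _ n _ a])
    have "?r * p = (- c) \<cdot>\<^sub>m (r * p)" by (rule mult_smult_assoc_mat[OF r p])
    then have "?E * 1\<^sub>m n + ?r * p = 1\<^sub>m n"
      using r p by (intro eq_matI) auto
    then show "four_block_mat (?E * 1\<^sub>m n + ?r * p) (?E * 0\<^sub>m n a + ?r * 1\<^sub>m a)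
      (0\<^sub>m a n * 1\<^sub>m n + 1\<^sub>m a * p) (0\<^sub>m a n * 0\<^sub>m n a + 1\<^sub>m a * 1\<^sub>m a) = ?M"
      using r p E by simp
  qed (use r p in auto)
  then have "det ?M = det (four_block_mat ?E ?r (0\<^sub>m a n) (1\<^sub>m a)) * det ?L"
    by (metis L det_mult four_block_carrier_mat E one_carrier_mat)
  also have "\<dots> = det ?E"
    unfolding dL by (subst det_four_block_mat_lower_left_zero[of _ n _ a]) (use r E in auto)
  finally have 1: "det ?M = det ?E" .
  have "?L * four_block_mat (1\<^sub>m n) ?r (0\<^sub>m a n) ((1 + c) \<cdot>\<^sub>m 1\<^sub>m a) = ?M"
  proof (subst mult_four_block_mat[of _ n n _ a _ a _ _ n _ a])
    have "p * ?r = (- c) \<cdot>\<^sub>m 1\<^sub>m a" using r p pr1 by (simp add: mult_smult_distrib[OF p r])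
    then have "p * ?r + 1\<^sub>m a * ((1 + c) \<cdot>\<^sub>m 1\<^sub>m a) = 1\<^sub>m a"
      by (intro eq_matI) auto
    then show "four_block_mat (1\<^sub>m n * 1\<^sub>m n + 0\<^sub>m n a * 0\<^sub>m a n) (1\<^sub>m n * ?r + 0\<^sub>m n a * ((1 + c) \<cdot>\<^sub>m 1\<^sub>m a))
      (p * 1\<^sub>m n + 1\<^sub>m a * 0\<^sub>m a n) (p * ?r + 1\<^sub>m a * ((1 + c) \<cdot>\<^sub>m 1\<^sub>m a)) = ?M"
      using r p by simp
  qed (use r p in auto)
  then have "det ?M = det ?L * det (four_block_mat (1\<^sub>m n) ?r (0\<^sub>m a n) ((1 + c) \<cdot>\<^sub>m 1\<^sub>m a))"
    by (metis L det_mult four_block_carrier_mat one_carrier_mat smult_carrier_mat)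
  also have "\<dots> = (1 + c) ^ a"
    unfolding dL by (subst det_four_block_mat_lower_left_zero[of _ n _ a]) (use r in auto)
  finally show ?thesis using 1 by simp
qed

lemma mat_inverse_eqI:
  fixes B :: "'a::field mat"
  assumes B: "B \<in> carrier_mat n n" and C: "C \<in> carrier_mat n n" and BC: "B * C = 1\<^sub>m n"
  shows "the (mat_inverse B) = C"
proof -
  have CB: "C * B = 1\<^sub>m n" by (rule mat_mult_left_right_inverse[OF B C BC])
  have "B \<in> Units (ring_mat TYPE('a) n ())"
    unfolding Units_def ring_mat_def using B C BC CB by auto
  then obtain D where D: "mat_inverse B = Some D"
    using mat_inverse(1)[OF B, of "()"] by (cases "mat_inverse B") auto
  then have D': "D * B = 1\<^sub>m n" "D \<in> carrier_mat n n" using mat_inverse(2)[OF B D] by auto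
  have "D = D * (B * C)" using D' BC by simp
  also have "\<dots> = D * B * C" using assoc_mult_mat[OF D'(2) B C] by simp
  also have "\<dots> = C" using D' C by simp
  finally show ?thesis using D by simp
qed

text \<open>The one-parameter subgroups \<open>t\<^sup>a (1 + (t\<^sup>-\<^sup>n - 1) E)\<close> of \<open>SL\<^sub>n\<close>, for the idempotent \<open>E = r p\<close> of rank
  \<open>a\<close>, contract a tuple with a shrunk subspace to zero.\<close>

lemma one_param_det:
  fixes r p :: "'a::field mat"
  assumes r: "r \<in> carrier_mat n a" and p: "p \<in> carrier_mat a n" and pr1: "p * r = 1\<^sub>m a" and t: "t \<noteq> 0"
  shows "det (t ^ a \<cdot>\<^sub>m (1\<^sub>m n + (inverse t ^ n - 1) \<cdot>\<^sub>m (r * p))) = 1"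
proof -
  have "det (t ^ a \<cdot>\<^sub>m (1\<^sub>m n + (inverse t ^ n - 1) \<cdot>\<^sub>m (r * p))) = (t ^ a) ^ n * (inverse t ^ n) ^ a"
    using det_one_plus_idempotent[OF r p pr1, of "inverse t ^ n - 1"] r p by simp
  also have "\<dots> = (t * inverse t) ^ (a * n)"
    by (simp add: power_mult_distrib power_mult[symmetric] mult.commute)
  finally show ?thesis using t by simp
qed

lemma idempotent_pencil_mult:
  fixes E :: "'a::field mat"
  assumes E: "E \<in> carrier_mat n n" and EE: "E * E = E"
  shows "(1\<^sub>m n + c \<cdot>\<^sub>m E) * (1\<^sub>m n + c' \<cdot>\<^sub>m E) = 1\<^sub>m n + (c + c' + c * c') \<cdot>\<^sub>m E"
proof -
  have "(1\<^sub>m n + c \<cdot>\<^sub>m E) * (1\<^sub>m n + c' \<cdot>\<^sub>m E) = (1\<^sub>m n + c \<cdot>\<^sub>m E) * 1\<^sub>m n + (1\<^sub>m n + c \<cdot>\<^sub>m E) * (c' \<cdot>\<^sub>m E)"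
    by (rule mult_add_distrib_mat) (use E in auto)
  also have "(1\<^sub>m n + c \<cdot>\<^sub>m E) * (c' \<cdot>\<^sub>m E) = 1\<^sub>m n * (c' \<cdot>\<^sub>m E) + c \<cdot>\<^sub>m E * (c' \<cdot>\<^sub>m E)"
    by (rule add_mult_distrib_mat) (use E in auto)
  also have "c \<cdot>\<^sub>m E * (c' \<cdot>\<^sub>m E) = (c * c') \<cdot>\<^sub>m E"
  proof -
    have "c \<cdot>\<^sub>m E * (c' \<cdot>\<^sub>m E) = c \<cdot>\<^sub>m (E * (c' \<cdot>\<^sub>m E))" by (rule mult_smult_assoc_mat[of _ n n _ n]) (use E in auto)
    also have "E * (c' \<cdot>\<^sub>m E) = c' \<cdot>\<^sub>m (E * E)" by (rule mult_smult_distrib[OF E E])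
    finally show ?thesis unfolding EE by (intro eq_matI) auto
  qed
  finally show ?thesis using E by (intro eq_matI) (auto simp: algebra_simps)
qed

lemma eval_coord_poly_0:
  assumes p: "homogeneous_of_degree e p" and e: "e \<ge> 1"
    and v: "\<And>\<mu> v. \<mu> \<in> keys p \<Longrightarrow> v \<in> keys \<mu> \<Longrightarrow> w v = 0"
  shows "(\<Sum>\<mu>\<in>keys p. lookup p \<mu> * (\<Prod>v\<in>keys \<mu>. w v ^ lookup \<mu> v)) = 0"
proof (rule sum.neutral, rule ballI)
  fix \<mu> assume \<mu>: "\<mu> \<in> keys p"
  have "(\<Sum>v\<in>keys \<mu>. lookup \<mu> v) = e"
    using p \<mu> by (auto simp: homogeneous_of_degree_def)
  then have "keys \<mu> \<noteq> {}" using e by auto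
  then obtain u where u: "u \<in> keys \<mu>" by blast
  then have "w u ^ lookup \<mu> u = 0" using v[OF \<mu> u] by (simp add: in_keys_iff)
  then have "(\<Prod>v\<in>keys \<mu>. w v ^ lookup \<mu> v) = 0"
    using u by (intro prod_zero) auto
  then show "lookup p \<mu> * (\<Prod>v\<in>keys \<mu>. w v ^ lookup \<mu> v) = 0" by simp
qed

lemma null_cone_contraction:
  fixes X :: "'a::field mat list"
  assumes inf: "infinite (UNIV :: 'a set)" and X: "X \<in> mat_tuples n m"
    and p: "p \<in> carrier_mat a n" "r \<in> carrier_mat n a" "p * r = 1\<^sub>m a"
    and q: "q \<in> carrier_mat n b" "s \<in> carrier_mat b n" "s * q = 1\<^sub>m b"
    and z: "\<And>M. M \<in> set X \<Longrightarrow> p * M * q = 0\<^sub>m a b" and ab: "n < a + b"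
  shows "X \<in> null_cone n m"
proof -
  define E F where "E = r * p" and "F = q * s"
  have E: "E \<in> carrier_mat n n" and F: "F \<in> carrier_mat n n" using p q by (auto simp: E_def F_def)
  have EE: "E * E = E"
  proof -
    have "E * E = r * (p * (r * p))" unfolding E_def by (rule assoc_mult_mat[of _ n a _ n _ n]) (use p in auto)
    also have "p * (r * p) = p * r * p" by (rule assoc_mult_mat[of _ a n _ a _ n, symmetric]) (use p in auto)
    finally show ?thesis using p by (simp add: E_def)
  qed
  have FF: "F * F = F"
  proof -
    have "F * F = q * (s * (q * s))" unfolding F_def by (rule assoc_mult_mat[of _ n b _ n _ n]) (use q in auto)
    also have "s * (q * s) = s * q * s" by (rule assoc_mult_mat[of _ b n _ b _ n, symmetric]) (use q in auto)
    finally show ?thesis using q by (simp add: F_def)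
  qed
  have Xn: "M \<in> carrier_mat n n" if "M \<in> set X" for M using X that by (auto simp: mat_tuples_def)
  have EMF: "E * M * F = 0\<^sub>m n n" if M: "M \<in> set X" for M
  proof -
    note Mc = Xn[OF M]
    have "E * M * F = r * (p * M) * (q * s)"
      unfolding E_def F_def by (subst assoc_mult_mat[of r n a p n M n]) (use p Mc in auto)
    also have "\<dots> = r * ((p * M) * (q * s))" by (rule assoc_mult_mat[of _ n a _ n _ n]) (use p q Mc in auto)
    also have "(p * M) * (q * s) = p * M * q * s" by (rule assoc_mult_mat[of _ a n _ b _ n, symmetric]) (use p q Mc in auto)
    finally show ?thesis using z[OF M] p q by simp
  qed
  \<comment> \<open>The least weight of the action: the part \<open>E * M * F\<close>, which would
    have weight \<open>a + b - 2 n\<close>, is zero, and the next weight is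
    \<open>a + b - n > 0\<close>.\<close>
  define k where "k = a + b - n"
  define At where "At = (\<lambda>t. t ^ a \<cdot>\<^sub>m (1\<^sub>m n + (inverse t ^ n - 1) \<cdot>\<^sub>m E))"
  define Nt where "Nt = (\<lambda>t. t ^ b \<cdot>\<^sub>m (1\<^sub>m n + (inverse t ^ n - 1) \<cdot>\<^sub>m F))"
  define Bt where "Bt = (\<lambda>t. inverse t ^ b \<cdot>\<^sub>m (1\<^sub>m n + (t ^ n - 1) \<cdot>\<^sub>m F))"
  have c: "At t \<in> carrier_mat n n" "Nt t \<in> carrier_mat n n" "Bt t \<in> carrier_mat n n" for t
    using E F by (simp_all add: At_def Nt_def Bt_def)
  have dA: "det (At t) = 1" if "t \<noteq> 0" for t
    unfolding At_def E_def using that p by (intro one_param_det) auto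
  have dB: "det (Bt t) = 1" if "t \<noteq> 0" for t
    using one_param_det[OF q(1,2,3), of "inverse t"] that unfolding Bt_def F_def by simp
  have BN: "Bt t * Nt t = 1\<^sub>m n" if t: "t \<noteq> 0" for t
  proof -
    let ?G = "1\<^sub>m n + (t ^ n - 1) \<cdot>\<^sub>m F" and ?H = "1\<^sub>m n + (inverse t ^ n - 1) \<cdot>\<^sub>m F"
    have GH: "?G * ?H = 1\<^sub>m n"
    proof -
      have "t ^ n * inverse t ^ n = 1" using t by (simp add: power_mult_distrib[symmetric])
      then have "(t ^ n - 1) + (inverse t ^ n - 1) + (t ^ n - 1) * (inverse t ^ n - 1) = 0"
        by (simp add: algebra_simps)
      then show ?thesis unfolding idempotent_pencil_mult[OF F FF] using F by (intro eq_matI) auto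
    qed
    have "Bt t * Nt t = inverse t ^ b \<cdot>\<^sub>m (?G * (t ^ b \<cdot>\<^sub>m ?H))"
      unfolding Bt_def Nt_def by (rule mult_smult_assoc_mat[of _ n n _ n]) (use F in auto)
    also have "?G * (t ^ b \<cdot>\<^sub>m ?H) = t ^ b \<cdot>\<^sub>m (?G * ?H)" by (rule mult_smult_distrib[of _ n n _ n]) (use F in auto)
    also have "inverse t ^ b \<cdot>\<^sub>m (t ^ b \<cdot>\<^sub>m (?G * ?H)) = 1\<^sub>m n"
      unfolding GH using t by (intro eq_matI) (auto simp: power_mult_distrib[symmetric])
    finally show ?thesis .
  qed
  define C0 where "C0 = (\<lambda>M. E * M + M * F)"
  have AMN: "(At t * M * Nt t) $$ (i, j) = t ^ k * (C0 M $$ (i, j) + t ^ n * (M $$ (i, j) - C0 M $$ (i, j)))"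
    if t: "t \<noteq> 0" and M: "M \<in> set X" and ij: "i < n" "j < n" for t M i j
  proof -
    note Mc = Xn[OF M]
    define u where "u = inverse t ^ n - 1"
    let ?G = "1\<^sub>m n + u \<cdot>\<^sub>m E" and ?H = "1\<^sub>m n + u \<cdot>\<^sub>m F"
    have Gc: "?G \<in> carrier_mat n n" "?H \<in> carrier_mat n n" using E F by auto
    have GM: "?G * M = M + u \<cdot>\<^sub>m (E * M)"
    proof -
      have "?G * M = 1\<^sub>m n * M + u \<cdot>\<^sub>m E * M" by (rule add_mult_distrib_mat) (use E Mc in auto)
      also have "u \<cdot>\<^sub>m E * M = u \<cdot>\<^sub>m (E * M)" by (rule mult_smult_assoc_mat[of _ n n _ n]) (use E Mc in auto)
      finally show ?thesis using Mc by simp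
    qed
    have YH: "Y * ?H = Y + u \<cdot>\<^sub>m (Y * F)" if Y: "Y \<in> carrier_mat n n" for Y
    proof -
      have "Y * ?H = Y * 1\<^sub>m n + Y * (u \<cdot>\<^sub>m F)" by (rule mult_add_distrib_mat) (use F Y in auto)
      also have "Y * (u \<cdot>\<^sub>m F) = u \<cdot>\<^sub>m (Y * F)" by (rule mult_smult_distrib[OF Y F])
      finally show ?thesis using Y by simp
    qed
    have EMc: "E * M \<in> carrier_mat n n" and MF: "M * F \<in> carrier_mat n n" using E F Mc by auto
    have "(M + u \<cdot>\<^sub>m (E * M)) * F = M * F + u \<cdot>\<^sub>m (E * M) * F" by (rule add_mult_distrib_mat) (use E F Mc in auto)
    also have "u \<cdot>\<^sub>m (E * M) * F = u \<cdot>\<^sub>m (E * M * F)" by (rule mult_smult_assoc_mat[of _ n n _ n]) (use E F Mc in auto)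
    finally have GMF: "?G * M * F = M * F" unfolding GM EMF[OF M] using MF by (intro eq_matI) auto
    have GMH: "?G * M * ?H = ?G * M + u \<cdot>\<^sub>m (M * F)" using YH[of "?G * M"] Gc Mc unfolding GMF by auto
    have "At t * M * Nt t = t ^ a \<cdot>\<^sub>m (?G * M) * (t ^ b \<cdot>\<^sub>m ?H)"
      unfolding At_def Nt_def u_def[symmetric] by (subst mult_smult_assoc_mat[of _ n n _ n]) (use Gc Mc in auto)
    also have "\<dots> = t ^ a \<cdot>\<^sub>m (?G * M * (t ^ b \<cdot>\<^sub>m ?H))" by (rule mult_smult_assoc_mat[of _ n n _ n]) (use Gc Mc in auto)
    also have "?G * M * (t ^ b \<cdot>\<^sub>m ?H) = t ^ b \<cdot>\<^sub>m (?G * M * ?H)" by (rule mult_smult_distrib[of _ n n _ n]) (use Gc Mc in auto)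
    finally have "At t * M * Nt t = t ^ a \<cdot>\<^sub>m (t ^ b \<cdot>\<^sub>m (M + u \<cdot>\<^sub>m (E * M) + u \<cdot>\<^sub>m (M * F)))"
      unfolding GMH unfolding GM .
    moreover have "(t ^ a \<cdot>\<^sub>m (t ^ b \<cdot>\<^sub>m (M + u \<cdot>\<^sub>m Y + u \<cdot>\<^sub>m Y'))) $$ (i, j) =
        t ^ a * (t ^ b * (M $$ (i, j) + u * (Y + Y') $$ (i, j)))"
      if "Y \<in> carrier_mat n n" "Y' \<in> carrier_mat n n" for Y Y'
      using that Mc ij by (auto simp: distrib_left add.assoc)
    ultimately have "(At t * M * Nt t) $$ (i, j) = t ^ a * (t ^ b * (M $$ (i, j) + u * C0 M $$ (i, j)))"
      unfolding C0_def using EMc MF by simp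
    also have "t ^ a * (t ^ b * (M $$ (i, j) + u * C0 M $$ (i, j))) =
        t ^ (a + b) * (M $$ (i, j) - C0 M $$ (i, j)) + (t ^ (a + b) * inverse t ^ n) * C0 M $$ (i, j)"
      by (simp add: u_def power_add algebra_simps)
    also have "a + b = k + n" using ab by (simp add: k_def)
    also have "t ^ (k + n) * inverse t ^ n = t ^ k" using t by (simp add: power_add mult.assoc power_mult_distrib[symmetric])
    finally show ?thesis by (simp add: power_add algebra_simps)
  qed
  have "f X = 0" if e: "e \<ge> 1" and f: "f \<in> invariants n m e" for e f
  proof -
    from f obtain P where inv: "invariant_function n m f" and P: "P \<in> coord_polys n m" "homogeneous_of_degree e P"
      and fP: "\<And>Y. Y \<in> mat_tuples n m \<Longrightarrow> f Y = eval_coord_poly P Y" by (auto simp: invariants_def)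
    \<comment> \<open>The coordinates of the moved tuple as polynomials in the parameter. They are
      divisible by its \<open>k\<close>-th power, so they vanish at 0, although the group element is
      not defined there.\<close>
    define w :: "var \<Rightarrow> 'a poly" where "w = (\<lambda>(l, i, j).
      monom 1 k * ([:C0 (X ! l) $$ (i, j):] + monom (X ! l $$ (i, j) - C0 (X ! l) $$ (i, j)) n))"
    define g where "g = (\<Sum>\<mu>\<in>keys P. [:lookup P \<mu>:] *
      (\<Prod>v\<in>keys \<mu>. w v ^ lookup \<mu> v))"
    have pg: "poly g t = (\<Sum>\<mu>\<in>keys P. lookup P \<mu> *
      (\<Prod>v\<in>keys \<mu>. poly (w v) t ^ lookup \<mu> v))" for t
      unfolding g_def by (simp add: poly_sum poly_prod poly_power)
    have k: "k \<ge> 1" using ab by (simp add: k_def)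
    have "poly (w v) 0 = 0" for v using k by (cases v) (simp add: w_def poly_monom power_0_left)
    then have g0: "poly g 0 = 0" unfolding pg by (intro eval_coord_poly_0[OF P(2) e])
    have gt: "poly g t = f X" if t: "t \<noteq> 0" for t
    proof -
      let ?Y = "lr_act (At t) (Bt t) X"
      have Y: "?Y = map (\<lambda>M. At t * M * Nt t) X"
        unfolding lr_act_def using mat_inverse_eqI[OF c(3) c(2) BN[OF t]] by simp
      have Yt: "?Y \<in> mat_tuples n m"
      proof -
        have "At t * M * Nt t \<in> carrier_mat n n" if "M \<in> set X" for M
          by (rule mult_carrier_mat[OF mult_carrier_mat[OF c(1) Xn[OF that]] c(2)])
        then show ?thesis unfolding Y using X by (auto simp: mat_tuples_def)
      qed
      have "f X = f ?Y"
        using inv X c dA[OF t] dB[OF t] by (auto simp: invariant_function_def SL_def)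
      also have "\<dots> = eval_coord_poly P ?Y" by (rule fP[OF Yt])
      also have "\<dots> = poly g t"
        unfolding pg eval_coord_poly_def
      proof (intro sum.cong refl arg_cong2[of _ _ _ _ "(*)"] prod.cong)
        fix \<mu> v assume \<mu>: "\<mu> \<in> keys P" and v: "v \<in> keys \<mu>"
        obtain l i j where lij: "v = (l, i, j)" by (cases v)
        have ll: "l < m" "i < n" "j < n" using P(1) \<mu> v unfolding coord_polys_def lij by auto
        then have lX: "l < length X" using X by (simp add: mat_tuples_def)
        have "coord ?Y v = (At t * X ! l * Nt t) $$ (i, j)" using lX by (simp add: coord_def lij Y)
        also have "\<dots> = poly (w v) t"
          using AMN[OF t nth_mem[OF lX] ll(2,3)] by (simp add: w_def lij poly_monom algebra_simps)
        finally show "coord ?Y v ^ lookup \<mu> v = poly (w v) t ^ lookup \<mu> v" by simp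
      qed
      finally show ?thesis by simp
    qed
    \<comment> \<open>Invariance makes \<open>g\<close> constant away from 0. Over an infinite field
      it is then a constant polynomial, and its value at 0 gives \<open>f X = 0\<close>.\<close>
    have "g - [:f X:] = 0"
    proof (rule ccontr)
      assume "g - [:f X:] \<noteq> 0"
      then have "finite {t. poly (g - [:f X:]) t = 0}" by (rule poly_roots_finite)
      moreover have "- {0} \<subseteq> {t. poly (g - [:f X:]) t = 0}" using gt by auto
      ultimately have "finite (- {0 :: 'a})" by (rule rev_finite_subset)
      then show False using inf by simp
    qed
    then show ?thesis using g0 by simp
  qed
  then show ?thesis using X by (simp add: null_cone_def)
qed

lemma shrunk_null_cone:
  fixes X :: "'a::field mat list"
  assumes inf: "infinite (UNIV :: 'a set)" and X: "X \<in> mat_tuples n m"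
    and sh: "shrunk n m (\<lambda>k. frmat (X ! k))"
  shows "X \<in> null_cone n m"
proof -
  obtain a b and P R Q S :: "'a cfm" where ab: "n < a + b" and PR: "P * pr n * R = pr a" "S * pr n * Q = pr b"
    and z: "\<And>k. k < m \<Longrightarrow> P * frmat (X ! k) * Q = 0"
    using sh unfolding shrunk_def by blast
  show ?thesis
  proof (rule null_cone_contraction[OF inf X])
    show "tomat a n P * tomat n a R = 1\<^sub>m a" "tomat b n S * tomat n b Q = 1\<^sub>m b"
      by (simp_all add: tomat_mult PR tomat_pr)
    fix M assume "M \<in> set X"
    then obtain k where k: "k < m" "M = X ! k" using X by (auto simp: in_set_conv_nth mat_tuples_def)
    have Mc: "M \<in> carrier_mat n n" using X \<open>M \<in> set X\<close> by (auto simp: mat_tuples_def)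
    have "tomat a n P * M * tomat n b Q = tomat a n P * tomat n n (frmat M) * tomat n b Q"
      by (simp add: tomat_frmat[OF Mc])
    also have "\<dots> = tomat a b (P * pr n * frmat M * pr n * Q)" by (simp add: tomat_mult)
    also have "P * pr n * frmat M * pr n * Q = P * frmat M * Q" by (simp add: mult.assoc frmat_corner[OF Mc] mult.assoc[symmetric, of "frmat M"])
    also have "\<dots> = 0" using z[OF k(1)] k(2) by simp
    finally show "tomat a n P * M * tomat n b Q = 0\<^sub>m a b" by (intro eq_matI) (auto simp: tomat_def)
  qed (use ab in auto)
qed

section \<open>Determinantal invariants\<close>

lemma sum_div_mod:
  fixes f g :: "nat \<Rightarrow> 'a::comm_semiring_0"
  shows "(\<Sum>l<n * d. f (l div d) * g (l mod d)) = (\<Sum>i<n. f i) * (\<Sum>a<d. g a)"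
proof -
  have "(\<Sum>l<n * d. f (l div d) * g (l mod d)) = (\<Sum>i<n. \<Sum>l\<in>{i * d..<i * d + d}. f (l div d) * g (l mod d))"
    by (rule sum.nat_group[symmetric])
  also have "\<dots> = (\<Sum>i<n. \<Sum>a<d. f i * g a)"
  proof (rule sum.cong[OF refl])
    fix i
    have "(\<Sum>l\<in>{i * d..<i * d + d}. f (l div d) * g (l mod d)) = (\<Sum>a<d. f ((a + i * d) div d) * g ((a + i * d) mod d))"
      using sum.shift_bounds_nat_ivl[of "\<lambda>l. f (l div d) * g (l mod d)" 0 "i * d" d]
      by (simp add: atLeast0LessThan add.commute)
    also have "\<dots> = (\<Sum>a<d. f i * g a)" by (rule sum.cong) auto
    finally show "(\<Sum>l\<in>{i * d..<i * d + d}. f (l div d) * g (l mod d)) = (\<Sum>a<d. f i * g a)" .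
  qed
  finally show ?thesis by (simp add: sum_product)
qed

lemma div_mod_bounds: "i < n * d \<Longrightarrow> i div d < n" "i < n * d \<Longrightarrow> i mod d < (d :: nat)"
  by (simp_all add: less_mult_imp_div_less) (cases "d = 0"; simp)

lemma kronecker_carrier:
  "A \<in> carrier_mat n n' \<Longrightarrow> B \<in> carrier_mat d d' \<Longrightarrow> A \<otimes>\<^sub>K B \<in> carrier_mat (n * d) (n' * d')"
  by (simp add: kronecker_def)

lemma kronecker_index:
  assumes "A \<in> carrier_mat n n'" "B \<in> carrier_mat d d'" "i < n * d" "j < n' * d'"
  shows "(A \<otimes>\<^sub>K B) $$ (i, j) = A $$ (i div d, j div d') * B $$ (i mod d, j mod d')"
  using assms by (simp add: kronecker_def)

lemma kronecker_mult:
  assumes A: "A \<in> carrier_mat n n" and B: "B \<in> carrier_mat d d" and C: "C \<in> carrier_mat n n" and D: "D \<in> carrier_mat d d"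
  shows "(A \<otimes>\<^sub>K B) * (C \<otimes>\<^sub>K D) = (A * C) \<otimes>\<^sub>K (B * D)"
proof (rule eq_matI)
  note AB = kronecker_carrier[OF A B] and CD = kronecker_carrier[OF C D]
  have ACBD: "(A * C) \<otimes>\<^sub>K (B * D) \<in> carrier_mat (n * d) (n * d)"
    by (rule kronecker_carrier) (use A B C D in auto)
  fix i j assume "i < dim_row ((A * C) \<otimes>\<^sub>K (B * D))" "j < dim_col ((A * C) \<otimes>\<^sub>K (B * D))"
  then have ij: "i < n * d" "j < n * d" using ACBD by auto
  note b = div_mod_bounds[OF ij(1)] div_mod_bounds[OF ij(2)]
  have "((A \<otimes>\<^sub>K B) * (C \<otimes>\<^sub>K D)) $$ (i, j) = (\<Sum>l<n * d. (A \<otimes>\<^sub>K B) $$ (i, l) * (C \<otimes>\<^sub>K D) $$ (l, j))"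
    using ij AB CD by (simp add: scalar_prod_def atLeast0LessThan)
  also have "\<dots> = (\<Sum>l<n * d. (A $$ (i div d, l div d) * C $$ (l div d, j div d)) * (B $$ (i mod d, l mod d) * D $$ (l mod d, j mod d)))"
    by (rule sum.cong) (use ij in \<open>auto simp: kronecker_index[OF A B] kronecker_index[OF C D] mult_ac\<close>)
  also have "\<dots> = (\<Sum>k<n. A $$ (i div d, k) * C $$ (k, j div d)) * (\<Sum>a<d. B $$ (i mod d, a) * D $$ (a, j mod d))"
    by (rule sum_div_mod[where f = "\<lambda>k. A $$ (i div d, k) * C $$ (k, j div d)" and g = "\<lambda>a. B $$ (i mod d, a) * D $$ (a, j mod d)"])
  also have "\<dots> = ((A * C) \<otimes>\<^sub>K (B * D)) $$ (i, j)"
    using A B C D b ij by (subst kronecker_index[of _ n n _ d d]) (auto simp: scalar_prod_def atLeast0LessThan)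
  finally show "((A \<otimes>\<^sub>K B) * (C \<otimes>\<^sub>K D)) $$ (i, j) = ((A * C) \<otimes>\<^sub>K (B * D)) $$ (i, j)" .
qed (use A B C D in \<open>auto simp: kronecker_def\<close>)

lemma det_block_diagonal:
  fixes A :: "'a::field mat"
  assumes A: "A \<in> carrier_mat n n"
  shows "det (mat (d * n) (d * n) (\<lambda>(x, y). if x div n = y div n then A $$ (x mod n, y mod n) else 0)) = det A ^ d"
proof (induction d)
  case 0
  show ?case by (simp add: det_dim_zero)
next
  case (Suc d)
  let ?D = "\<lambda>d. mat (d * n) (d * n) (\<lambda>(x, y). if x div n = y div n then A $$ (x mod n, y mod n) else 0)"
  have "?D (Suc d) = four_block_mat A (0\<^sub>m n (d * n)) (0\<^sub>m (d * n) n) (?D d)"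
  proof (rule eq_matI)
    fix x y assume "x < dim_row (four_block_mat A (0\<^sub>m n (d * n)) (0\<^sub>m (d * n) n) (?D d))"
      "y < dim_col (four_block_mat A (0\<^sub>m n (d * n)) (0\<^sub>m (d * n) n) (?D d))"
    then have xy: "x < n + d * n" "y < n + d * n" using A by auto
    have dv: "z div n = Suc ((z - n) div n)" "z mod n = (z - n) mod n" "n > 0" if "\<not> z < n" "z < n + d * n" for z
    proof -
      show n: "n > 0" using that by (cases n) auto
      show "z div n = Suc ((z - n) div n)" "z mod n = (z - n) mod n"
        using that(1) n by (simp_all add: le_div_geq le_mod_geq)
    qed
    show "?D (Suc d) $$ (x, y) = four_block_mat A (0\<^sub>m n (d * n)) (0\<^sub>m (d * n) n) (?D d) $$ (x, y)"
      using xy A dv[of x] dv[of y] by (cases "x < n"; cases "y < n") (auto simp: index_mat_four_block)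
  qed (use A in auto)
  then have "det (?D (Suc d)) = det A * det (?D d)"
    by (simp only:) (rule det_four_block_mat_lower_left_zero; use A in auto)
  then show ?case using Suc by simp
qed

text \<open>Conjugation by the permutation matrix \<open>W\<close> of \<open>p\<close>, for which
  \<open>W\<close> times its transpose is the identity.\<close>

lemma det_reindex:
  fixes M :: "'a::field mat"
  assumes M: "M \<in> carrier_mat N N" and p: "\<And>x. x < N \<Longrightarrow> p x < N" "inj_on p {..<N}"
  shows "det (mat N N (\<lambda>(x, y). M $$ (p x, p y))) = det M"
proof -
  define W where "W = mat N N (\<lambda>(x, y). if p x = y then 1 else (0 :: 'a))"
  have W: "W \<in> carrier_mat N N" by (simp add: W_def)
  have WY: "(W * Y) $$ (x, y) = Y $$ (p x, y)" if "Y \<in> carrier_mat N N" "x < N" "y < N" for Y x y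
  proof -
    have "(W * Y) $$ (x, y) = (\<Sum>k<N. (if p x = k then 1 else 0) * Y $$ (k, y))"
      using that W by (simp add: W_def scalar_prod_def atLeast0LessThan)
    also have "\<dots> = (\<Sum>k<N. if p x = k then Y $$ (k, y) else 0)" by (rule sum.cong) auto
    finally show ?thesis using p(1)[OF that(2)] by simp
  qed
  have YW: "(Y * transpose_mat W) $$ (x, y) = Y $$ (x, p y)" if "Y \<in> carrier_mat N N" "x < N" "y < N" for Y x y
  proof -
    have "(Y * transpose_mat W) $$ (x, y) = (\<Sum>k<N. Y $$ (x, k) * (if p y = k then 1 else 0))"
      using that W by (simp add: W_def scalar_prod_def atLeast0LessThan)
    also have "\<dots> = (\<Sum>k<N. if p y = k then Y $$ (x, k) else 0)" by (rule sum.cong) auto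
    finally show ?thesis using p(1)[OF that(3)] by simp
  qed
  have "W * transpose_mat W = 1\<^sub>m N"
  proof (rule eq_matI)
    fix x y assume "x < dim_row (1\<^sub>m N :: 'a mat)" "y < dim_col (1\<^sub>m N :: 'a mat)"
    then have xy: "x < N" "y < N" by auto
    then have "(W * transpose_mat W) $$ (x, y) = W $$ (x, p y)" using YW[OF W] by simp
    then show "(W * transpose_mat W) $$ (x, y) = 1\<^sub>m N $$ (x, y)"
      using xy p by (auto simp: W_def inj_on_def)
  qed (use W in auto)
  then have "det (W * transpose_mat W) = 1" by simp
  then have dW: "det W * det (transpose_mat W) = 1" using det_mult[of W N "transpose_mat W"] W by simp
  have "mat N N (\<lambda>(x, y). M $$ (p x, p y)) = W * M * transpose_mat W"
  proof (rule eq_matI)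
    fix x y assume "x < dim_row (W * M * transpose_mat W)" "y < dim_col (W * M * transpose_mat W)"
    then have xy: "x < N" "y < N" using W M by auto
    have "(W * M * transpose_mat W) $$ (x, y) = (W * M) $$ (x, p y)"
      by (rule YW) (use W M xy in auto)
    then show "mat N N (\<lambda>(x, y). M $$ (p x, p y)) $$ (x, y) = (W * M * transpose_mat W) $$ (x, y)"
      using WY[OF M xy(1) p(1)[OF xy(2)]] xy by simp
  qed (use W M in auto)
  then have "det (mat N N (\<lambda>(x, y). M $$ (p x, p y))) = det W * det M * det (transpose_mat W)"
    using W M by (simp add: det_mult[of _ N])
  then show ?thesis using dW by (simp add: mult_ac)
qed

lemma det_kronecker_one:
  fixes A :: "'a::field mat"
  assumes A: "A \<in> carrier_mat n n" shows "det (A \<otimes>\<^sub>K 1\<^sub>m d) = det A ^ d"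
proof -
  let ?D = "mat (d * n) (d * n) (\<lambda>(x, y). if x div n = y div n then A $$ (x mod n, y mod n) else 0)"
  \<comment> \<open>The flip of the two tensor factors, which turns the Kronecker product with an
    identity into a block diagonal matrix of \<open>d\<close> copies of \<open>A\<close>.\<close>
  let ?p = "\<lambda>x. (x mod d) * n + x div d"
  have b: "?p x < d * n" "?p x div n = x mod d" "?p x mod n = x div d" if "x < n * d" for x
  proof -
    note dm = div_mod_bounds[OF that]
    have "Suc (x mod d) * n \<le> d * n" using dm(2) by (intro mult_le_mono1) simp
    then show "?p x < d * n" using dm(1) by simp
    show "?p x div n = x mod d" "?p x mod n = x div d" using dm by simp_all
  qed
  have 1: "A \<otimes>\<^sub>K 1\<^sub>m d = mat (d * n) (d * n) (\<lambda>(x, y). ?D $$ (?p x, ?p y))"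
  proof (rule eq_matI)
    fix x y assume "x < dim_row (mat (d * n) (d * n) (\<lambda>(x, y). ?D $$ (?p x, ?p y)))" "y < dim_col (mat (d * n) (d * n) (\<lambda>(x, y). ?D $$ (?p x, ?p y)))"
    then have xy: "x < n * d" "y < n * d" by (auto simp: mult.commute)
    note bx = b[OF xy(1)] and by' = b[OF xy(2)]
    have "(A \<otimes>\<^sub>K 1\<^sub>m d) $$ (x, y) = A $$ (x div d, y div d) * 1\<^sub>m d $$ (x mod d, y mod d)"
      by (rule kronecker_index[OF A _ xy]) simp
    also have "\<dots> = ?D $$ (?p x, ?p y)"
      using bx by' div_mod_bounds[OF xy(1)] div_mod_bounds[OF xy(2)] by simp
    finally show "(A \<otimes>\<^sub>K 1\<^sub>m d) $$ (x, y) = mat (d * n) (d * n) (\<lambda>(x, y). ?D $$ (?p x, ?p y)) $$ (x, y)"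
      using xy by (simp add: mult.commute)
  qed (use A in \<open>auto simp: kronecker_def mult.commute\<close>)
  have 2: "det (mat (d * n) (d * n) (\<lambda>(x, y). ?D $$ (?p x, ?p y))) = det ?D"
  proof (rule det_reindex)
    show "?D \<in> carrier_mat (d * n) (d * n)" by simp
    show "?p x < d * n" if "x < d * n" for x by (rule b(1)) (use that in \<open>simp add: mult.commute\<close>)
    show "inj_on ?p {..<d * n}"
    proof (rule inj_onI)
      fix x y assume "x \<in> {..<d * n}" "y \<in> {..<d * n}" and eq: "?p x = ?p y"
      then have xy: "x < n * d" "y < n * d" by (simp_all add: mult.commute)
      have "x mod d = y mod d" using b(2)[OF xy(1)] b(2)[OF xy(2)] unfolding eq by simp
      moreover have "x div d = y div d" using b(3)[OF xy(1)] b(3)[OF xy(2)] unfolding eq by simp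
      ultimately show "x = y" by (metis div_mult_mod_eq)
    qed
  qed
  show ?thesis by (rule trans[OF arg_cong[OF 1, of det] trans[OF 2 det_block_diagonal[OF A]]])
qed

definition ksum :: "nat \<Rightarrow> nat \<Rightarrow> 'a::field mat list \<Rightarrow> 'a mat list \<Rightarrow> 'a mat" where
  "ksum n d X T = foldr (+) (map2 (\<otimes>\<^sub>K) X T) (0\<^sub>m (n * d) (n * d))"

lemma ksum_carrier:
  assumes "length X = length T" "set X \<subseteq> carrier_mat n n" "set T \<subseteq> carrier_mat d d"
  shows "ksum n d X T \<in> carrier_mat (n * d) (n * d)"
  using assms unfolding ksum_def
  by (induction X T rule: list_induct2) (auto intro!: add_carrier_mat)

lemma ksum_index:
  assumes "length X = length T" "set X \<subseteq> carrier_mat n n" "set T \<subseteq> carrier_mat d d" "i < n * d" "j < n * d"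
  shows "ksum n d X T $$ (i, j) = (\<Sum>k<length X. X ! k $$ (i div d, j div d) * T ! k $$ (i mod d, j mod d))"
  using assms
proof (induction X T rule: list_induct2)
  case Nil
  then show ?case by (simp add: ksum_def)
next
  case (Cons x xs t ts)
  have c: "ksum n d xs ts \<in> carrier_mat (n * d) (n * d)" by (rule ksum_carrier) (use Cons in auto)
  have "ksum n d (x # xs) (t # ts) $$ (i, j) = (x \<otimes>\<^sub>K t) $$ (i, j) + ksum n d xs ts $$ (i, j)"
    using c Cons.prems by (simp add: ksum_def)
  also have "(x \<otimes>\<^sub>K t) $$ (i, j) = x $$ (i div d, j div d) * t $$ (i mod d, j mod d)"
    by (rule kronecker_index) (use Cons.prems in auto)
  finally show ?case using Cons by (simp add: sum.lessThan_Suc_shift del: sum.lessThan_Suc)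
qed

lemma ksum_act:
  assumes "length X = length T" "set X \<subseteq> carrier_mat n n" "set T \<subseteq> carrier_mat d d"
    and A: "A \<in> carrier_mat n n" and B: "B \<in> carrier_mat n n"
  shows "ksum n d (map (\<lambda>M. A * M * B) X) T = (A \<otimes>\<^sub>K 1\<^sub>m d) * ksum n d X T * (B \<otimes>\<^sub>K 1\<^sub>m d)"
  using assms(1-3)
proof (induction X T rule: list_induct2)
  case Nil
  have "A \<otimes>\<^sub>K 1\<^sub>m d \<in> carrier_mat (n * d) (n * d)" "B \<otimes>\<^sub>K 1\<^sub>m d \<in> carrier_mat (n * d) (n * d)"
    by (rule kronecker_carrier, use A B in auto)+
  then show ?case by (simp add: ksum_def)
next
  case (Cons x xs t ts)
  let ?A = "A \<otimes>\<^sub>K 1\<^sub>m d" and ?B = "B \<otimes>\<^sub>K 1\<^sub>m d" and ?K = "ksum n d xs ts"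
  have c: "?A \<in> carrier_mat (n * d) (n * d)" "?B \<in> carrier_mat (n * d) (n * d)"
    by (rule kronecker_carrier, use A B in auto)+
  have K: "?K \<in> carrier_mat (n * d) (n * d)" by (rule ksum_carrier) (use Cons in auto)
  have x: "x \<in> carrier_mat n n" and t: "t \<in> carrier_mat d d" using Cons.prems by auto
  have xt: "x \<otimes>\<^sub>K t \<in> carrier_mat (n * d) (n * d)" by (rule kronecker_carrier[OF x t])
  have "?A * ksum n d (x # xs) (t # ts) * ?B = ?A * (x \<otimes>\<^sub>K t + ?K) * ?B" by (simp add: ksum_def)
  also have "?A * (x \<otimes>\<^sub>K t + ?K) = ?A * (x \<otimes>\<^sub>K t) + ?A * ?K" by (rule mult_add_distrib_mat[OF c(1) xt K])
  also have "(?A * (x \<otimes>\<^sub>K t) + ?A * ?K) * ?B = ?A * (x \<otimes>\<^sub>K t) * ?B + ?A * ?K * ?B"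
    by (rule add_mult_distrib_mat) (use c xt K in auto)
  also have "?A * (x \<otimes>\<^sub>K t) = (A * x) \<otimes>\<^sub>K t" using kronecker_mult[OF A _ x t, of "1\<^sub>m d"] t by simp
  also have "(A * x) \<otimes>\<^sub>K t * ?B = (A * x * B) \<otimes>\<^sub>K t"
    using kronecker_mult[of "A * x" n t d B "1\<^sub>m d"] A x B t by simp
  finally show ?case using Cons by (simp add: ksum_def)
qed

text \<open>The group acts on the big matrix by left and right multiplication with Kronecker
  products \<open>A \<otimes>\<^sub>K 1\<^sub>m d\<close> and
  \<open>C \<otimes>\<^sub>K 1\<^sub>m d\<close>, whose determinants are \<open>d\<close>-th powers
  of 1.\<close>

lemma f_inv_act:
  assumes X: "X \<in> mat_tuples n m" and T: "T \<in> mat_tuples d m" and A: "A \<in> SL n" and B: "B \<in> SL n"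
  shows "f_inv n d T (lr_act A B X) = f_inv n d T X"
proof -
  have Ac: "A \<in> carrier_mat n n" "det A = 1" and Bc: "B \<in> carrier_mat n n" "det B = 1" using A B by (auto simp: SL_def)
  obtain C where C: "C \<in> carrier_mat n n" "B * C = 1\<^sub>m n" "det C = 1"
  proof -
    have "B \<in> Units (ring_mat TYPE('a) n ())" by (rule det_non_zero_imp_unit[OF Bc(1)]) (simp add: Bc)
    then obtain C where C: "C \<in> carrier_mat n n" "B * C = 1\<^sub>m n" by (auto simp: Units_def ring_mat_def)
    moreover have "det C = 1" using det_mult[OF Bc(1) C(1)] C(2) Bc(2) by simp
    ultimately show thesis using that by blast
  qed
  have inv: "the (mat_inverse B) = C" by (rule mat_inverse_eqI[OF Bc(1) C(1,2)])
  have l: "length X = length T" "set X \<subseteq> carrier_mat n n" "set T \<subseteq> carrier_mat d d"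
    using X T by (auto simp: mat_tuples_def)
  have c: "A \<otimes>\<^sub>K 1\<^sub>m d \<in> carrier_mat (n * d) (n * d)" "C \<otimes>\<^sub>K 1\<^sub>m d \<in> carrier_mat (n * d) (n * d)"
    by (rule kronecker_carrier, use Ac C in auto)+
  have "f_inv n d T (lr_act A B X) = det ((A \<otimes>\<^sub>K 1\<^sub>m d) * ksum n d X T * (C \<otimes>\<^sub>K 1\<^sub>m d))"
    unfolding f_inv_def lr_act_def inv ksum_def[symmetric] ksum_act[OF l Ac(1) C(1)] ..
  also have "\<dots> = det (A \<otimes>\<^sub>K 1\<^sub>m d) * det (ksum n d X T) * det (C \<otimes>\<^sub>K 1\<^sub>m d)"
    using c ksum_carrier[OF l] by (simp add: det_mult[of _ "n * d"])
  also have "\<dots> = f_inv n d T X"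
    by (simp add: det_kronecker_one[OF Ac(1)] det_kronecker_one[OF C(1)] Ac C f_inv_def ksum_def)
  finally show ?thesis .
qed

section \<open>Homogeneous polynomial functions\<close>

definition monomial_value :: "(var \<Rightarrow> 'a::field) \<Rightarrow> (var \<Rightarrow>\<^sub>0 nat) \<Rightarrow> 'a" where
  "monomial_value w \<mu> = (\<Prod>v\<in>keys \<mu>. w v ^ lookup \<mu> v)"

lemma monomial_value_superset:
  assumes "finite S" "keys \<mu> \<subseteq> S"
  shows "monomial_value w \<mu> = (\<Prod>v\<in>S. w v ^ lookup \<mu> v)"
  unfolding monomial_value_def by (rule prod.mono_neutral_left) (use assms in \<open>auto simp: in_keys_iff\<close>)

lemma keys_add_nat: "keys (\<mu> + \<nu> :: 'v \<Rightarrow>\<^sub>0 nat) = keys \<mu> \<union> keys \<nu>"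
  by (auto simp: in_keys_iff lookup_add)

lemma monomial_value_add: "monomial_value w (\<mu> + \<nu>) = monomial_value w \<mu> * monomial_value w \<nu>"
proof -
  let ?S = "keys \<mu> \<union> keys \<nu>"
  have "monomial_value w (\<mu> + \<nu>) = (\<Prod>v\<in>?S. w v ^ lookup (\<mu> + \<nu>) v)"
    by (rule monomial_value_superset) (auto simp: keys_add_nat)
  also have "\<dots> = (\<Prod>v\<in>?S. w v ^ lookup \<mu> v) * (\<Prod>v\<in>?S. w v ^ lookup \<nu> v)"
    by (simp add: lookup_add power_add prod.distrib)
  also have "\<dots> = monomial_value w \<mu> * monomial_value w \<nu>"
    by (simp add: monomial_value_superset[of ?S])
  finally show ?thesis .
qed

lemma eval_superset:
  assumes "finite S" "keys p \<subseteq> S"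
  shows "eval_coord_poly p X = (\<Sum>\<mu>\<in>S. lookup p \<mu> * monomial_value (coord X) \<mu>)"
  unfolding eval_coord_poly_def monomial_value_def[symmetric]
  by (rule sum.mono_neutral_left) (use assms in \<open>auto simp: in_keys_iff\<close>)

lemma eval_add: "eval_coord_poly (p + q) X = eval_coord_poly p X + eval_coord_poly q X"
proof -
  let ?S = "keys p \<union> keys q"
  have "keys (p + q) \<subseteq> ?S" by (rule keys_add)
  then show ?thesis
    by (simp add: eval_superset[of ?S] lookup_add distrib_right sum.distrib)
qed

lemma eval_single: "eval_coord_poly (single \<mu> a) X = a * monomial_value (coord X) \<mu>"
  by (subst eval_superset[of "{\<mu>}"]) auto

lemma eval_0: "eval_coord_poly 0 X = 0"
  by (simp add: eval_coord_poly_def)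

lemma eval_mult: "eval_coord_poly (p * q) X = eval_coord_poly p X * eval_coord_poly q X"
proof (induction p rule: poly_mapping_add_induct)
  case (single k v)
  show ?case
    by (induction q rule: poly_mapping_add_induct)
      (simp_all add: eval_0 mult_single eval_single monomial_value_add distrib_left distrib_right eval_add mult_ac)
qed (simp_all add: eval_0 distrib_right eval_add)

text \<open>The polynomial half of \<open>invariants\<close>, as a predicate on functions; its
  closure under sums and products lets the degree of a determinant be read off the Leibniz
  formula.\<close>

definition hpoly :: "nat \<Rightarrow> nat \<Rightarrow> nat \<Rightarrow> ('a::field mat list \<Rightarrow> 'a) \<Rightarrow> bool" where
  "hpoly n m e f \<longleftrightarrow> (\<exists>p\<in>coord_polys n m. homogeneous_of_degree e p \<and> (\<forall>X\<in>mat_tuples n m. f X = eval_coord_poly p X))"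

lemma hpoly_0: "hpoly n m e (\<lambda>_. 0)"
  unfolding hpoly_def by (rule bexI[of _ 0]) (auto simp: eval_0 homogeneous_of_degree_def coord_polys_def)

lemma hpoly_add:
  assumes "hpoly n m e f" "hpoly n m e g" shows "hpoly n m e (\<lambda>X. f X + g X)"
proof -
  obtain p q where p: "p \<in> coord_polys n m" "homogeneous_of_degree e p" "\<forall>X\<in>mat_tuples n m. f X = eval_coord_poly p X"
    and q: "q \<in> coord_polys n m" "homogeneous_of_degree e q" "\<forall>X\<in>mat_tuples n m. g X = eval_coord_poly q X"
    using assms unfolding hpoly_def by blast
  have k: "\<mu> \<in> keys p \<or> \<mu> \<in> keys q" if "\<mu> \<in> keys (p + q)" for \<mu>
    using that keys_add[of p q] by blast
  show ?thesis unfolding hpoly_def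
  proof (rule bexI[of _ "p + q"], intro conjI)
    show "p + q \<in> coord_polys n m" using k p(1) q(1) unfolding coord_polys_def by blast
    show "homogeneous_of_degree e (p + q)" using k p(2) q(2) unfolding homogeneous_of_degree_def by blast
    show "\<forall>X\<in>mat_tuples n m. f X + g X = eval_coord_poly (p + q) X" using p(3) q(3) by (simp add: eval_add)
  qed
qed

lemma hpoly_sum: "(\<And>i. i \<in> I \<Longrightarrow> hpoly n m e (f i)) \<Longrightarrow> hpoly n m e (\<lambda>X. \<Sum>i\<in>I. f i X)"
  by (induction I rule: infinite_finite_induct) (auto intro: hpoly_0 hpoly_add)

lemma degree_add: "(\<Sum>v\<in>keys (\<mu> + \<nu> :: 'v \<Rightarrow>\<^sub>0 nat). lookup (\<mu> + \<nu>) v) =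
    (\<Sum>v\<in>keys \<mu>. lookup \<mu> v) + (\<Sum>v\<in>keys \<nu>. lookup \<nu> v)"
proof -
  let ?S = "keys \<mu> \<union> keys \<nu>"
  have "(\<Sum>v\<in>keys \<mu>. lookup \<mu> v) = (\<Sum>v\<in>?S. lookup \<mu> v)"
    "(\<Sum>v\<in>keys \<nu>. lookup \<nu> v) = (\<Sum>v\<in>?S. lookup \<nu> v)"
    by (rule sum.mono_neutral_left; auto simp: in_keys_iff)+
  then show ?thesis by (simp add: keys_add_nat lookup_add sum.distrib)
qed

lemma hpoly_mult:
  assumes "hpoly n m e f" "hpoly n m e' g" shows "hpoly n m (e + e') (\<lambda>X. f X * g X)"
proof -
  obtain p q where p: "p \<in> coord_polys n m" "homogeneous_of_degree e p" "\<forall>X\<in>mat_tuples n m. f X = eval_coord_poly p X"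
    and q: "q \<in> coord_polys n m" "homogeneous_of_degree e' q" "\<forall>X\<in>mat_tuples n m. g X = eval_coord_poly q X"
    using assms unfolding hpoly_def by blast
  have k: "\<exists>\<mu>\<in>keys p. \<exists>\<nu>\<in>keys q. \<kappa> = \<mu> + \<nu>" if "\<kappa> \<in> keys (p * q)" for \<kappa>
    using that keys_mult[of p q] by blast
  show ?thesis unfolding hpoly_def
  proof (rule bexI[of _ "p * q"], intro conjI)
    show "p * q \<in> coord_polys n m"
      unfolding coord_polys_def
    proof (intro CollectI ballI)
      fix \<kappa> assume "\<kappa> \<in> keys (p * q)"
      then obtain \<mu> \<nu> where "\<mu> \<in> keys p" "\<nu> \<in> keys q" "\<kappa> = \<mu> + \<nu>" using k by blast
      then show "keys \<kappa> \<subseteq> {..<m} \<times> {..<n} \<times> {..<n}"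
        using p(1) q(1) by (auto simp: coord_polys_def keys_add_nat)
    qed
    show "homogeneous_of_degree (e + e') (p * q)"
      unfolding homogeneous_of_degree_def
    proof (rule ballI)
      fix \<kappa> assume "\<kappa> \<in> keys (p * q)"
      then obtain \<mu> \<nu> where "\<mu> \<in> keys p" "\<nu> \<in> keys q" "\<kappa> = \<mu> + \<nu>" using k by blast
      then show "(\<Sum>v\<in>keys \<kappa>. lookup \<kappa> v) = e + e'"
        using p(2) q(2) by (simp add: homogeneous_of_degree_def degree_add)
    qed
    show "\<forall>X\<in>mat_tuples n m. f X * g X = eval_coord_poly (p * q) X" using p(3) q(3) by (simp add: eval_mult)
  qed
qed

lemma hpoly_const: "hpoly n m 0 (\<lambda>_. c)"
  unfolding hpoly_def
  by (rule bexI[of _ "single 0 c"])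
    (auto simp: eval_single monomial_value_def homogeneous_of_degree_def coord_polys_def)

lemma hpoly_coord: "k < m \<Longrightarrow> i < n \<Longrightarrow> j < n \<Longrightarrow> hpoly n m 1 (\<lambda>X. X ! k $$ (i, j))"
  unfolding hpoly_def
  by (rule bexI[of _ "single (single (k, i, j) 1) 1"])
    (auto simp: eval_single monomial_value_def homogeneous_of_degree_def coord_polys_def coord_def)

lemma hpoly_scale: "hpoly n m e f \<Longrightarrow> hpoly n m e (\<lambda>X. c * f X)"
  using hpoly_mult[OF hpoly_const, of n m e f c] by simp

lemma hpoly_prod: "(\<And>i. i < N \<Longrightarrow> hpoly n m 1 (f i)) \<Longrightarrow> hpoly n m N (\<lambda>X. \<Prod>i<N. f i X)"
proof (induction N)
  case 0
  show ?case using hpoly_const[of n m 1] by simp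
next
  case (Suc N)
  then have "hpoly n m (N + 1) (\<lambda>X. (\<Prod>i<N. f i X) * f N X)" by (intro hpoly_mult) auto
  then show ?case by simp
qed

lemma hpoly_cong: "(\<And>X. X \<in> mat_tuples n m \<Longrightarrow> f X = g X) \<Longrightarrow> hpoly n m e g \<Longrightarrow> hpoly n m e f"
  unfolding hpoly_def by auto

lemma f_inv_invariant:
  fixes T :: "'a::field mat list"
  assumes T: "T \<in> mat_tuples d m"
  shows "f_inv n d T \<in> invariants n m (n * d)"
proof -
  let ?ent = "\<lambda>X i j. \<Sum>k<m. T ! k $$ (i mod d, j mod d) * X ! k $$ (i div d, j div d)"
  have "hpoly n m (n * d) (f_inv n d T)"
  proof (rule hpoly_cong)
    fix X :: "'a mat list" assume X: "X \<in> mat_tuples n m"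
    have l: "length X = length T" "set X \<subseteq> carrier_mat n n" "set T \<subseteq> carrier_mat d d" "length X = m"
      using X T by (auto simp: mat_tuples_def)
    have "f_inv n d T X = (\<Sum>p | p permutes {0..<n * d}. signof p * (\<Prod>i = 0..<n * d. ksum n d X T $$ (i, p i)))"
      unfolding f_inv_def ksum_def[symmetric] by (rule det_def'[OF ksum_carrier[OF l(1-3)]])
    also have "\<dots> = (\<Sum>p | p permutes {0..<n * d}. signof p * (\<Prod>i<n * d. ?ent X i (p i)))"
    proof (intro sum.cong refl arg_cong2[of _ _ _ _ "(*)"] prod.cong)
      fix p i assume p: "p \<in> {p. p permutes {0..<n * d}}" and i: "i \<in> {..<n * d}"
      then have "p i < n * d" using permutes_in_image[of p "{0..<n * d}" i] by auto
      then show "ksum n d X T $$ (i, p i) = ?ent X i (p i)"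
        using ksum_index[OF l(1-3)] i l(4) by (simp add: mult.commute)
    qed auto
    finally show "f_inv n d T X = (\<Sum>p | p permutes {0..<n * d}. signof p * (\<Prod>i<n * d. ?ent X i (p i)))" .
  next
    show "hpoly n m (n * d) (\<lambda>X. \<Sum>p | p permutes {0..<n * d}. signof p * (\<Prod>i<n * d. ?ent X i (p i)))"
    proof (intro hpoly_sum hpoly_scale hpoly_prod hpoly_coord)
      fix p i k assume p: "p \<in> {p. p permutes {0..<n * d}}" and i: "i < n * d" and k: "k \<in> {..<m}"
      then have pi: "p i < n * d" using permutes_in_image[of p "{0..<n * d}" i] by auto
      show "k < m" "i div d < n" "p i div d < n"
        using k div_mod_bounds(1)[OF i] div_mod_bounds(1)[OF pi] by auto
    qed
  qed
  then show ?thesis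
    using f_inv_act[OF _ T] unfolding hpoly_def invariants_def invariant_function_def by blast
qed

lemma f_inv_nonzero:
  fixes X :: "'a::field mat list"
  assumes X: "X \<in> mat_tuples n m" and T: "\<And>k. k < m \<Longrightarrow> corner d d (T k)"
    and rk: "rank_ge (blow m (\<lambda>k. frmat (X ! k)) T) (n * d)"
  shows "f_inv n d (map (\<lambda>k. tomat d d (T k)) [0..<m]) X \<noteq> 0"
proof -
  let ?N = "n * d" and ?T = "map (\<lambda>k. tomat d d (T k)) [0..<m]"
  define g where "g = (\<lambda>c. en (c div d) (c mod d))"
  have inj: "inj g" unfolding g_def by (rule inj_pairing)
  let ?A = "blow m (\<lambda>k. frmat (X ! k)) T" and ?e = "mp g * pr ?N * tp g :: 'a cfm"
  have Xc: "X ! k \<in> carrier_mat n n" if "k < m" for k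
    using X that by (auto simp: mat_tuples_def)
  have Xcc: "corner n n (frmat (X ! k))" if "k < m" for k
    using frmat_corner[OF Xc[OF that]] by (simp add: corner_def)
  have e: "?e = pr n \<boxtimes> pr d" unfolding g_def by (rule pairing_corner)
  have eA: "?e * ?A = ?A" "?A * ?e = ?A" unfolding e by (rule blow_corner[OF Xcc T]; assumption)+
  obtain P Q where PQ: "P * ?A * Q = pr ?N" using rk unfolding rank_ge_def by blast
  have l: "length X = length ?T" "set X \<subseteq> carrier_mat n n" "set ?T \<subseteq> carrier_mat d d" "length X = m"
    using X by (auto simp: mat_tuples_def)
  \<comment> \<open>The reindexing \<open>g\<close> identifies the Kronecker sum with the blow-up on
    its corner, so full rank becomes a nonzero determinant.\<close>
  have K: "ksum n d X ?T = tomat ?N ?N (tp g * ?A * mp g)"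
  proof (rule eq_matI)
    fix i j assume "i < dim_row (tomat ?N ?N (tp g * ?A * mp g))" "j < dim_col (tomat ?N ?N (tp g * ?A * mp g))"
    then have ij: "i < ?N" "j < ?N" by (auto simp: tomat_def)
    note b = div_mod_bounds[OF ij(1)] div_mod_bounds[OF ij(2)]
    have "ksum n d X ?T $$ (i, j) = (\<Sum>k<m. X ! k $$ (i div d, j div d) * ent (T k) (i mod d) (j mod d))"
      using ksum_index[OF l(1-3) ij] l(4) b by simp
    also have "\<dots> = ent ?A (g i) (g j)"
      unfolding blow_def ent_sum g_def by (rule sum.cong) (use b Xc in \<open>auto simp: frmat.rep_eq\<close>)
    also have "\<dots> = ent (tp g * ?A * mp g) i j" by (simp add: ent_mult_mp ent_tp_mult[OF inj] mult.assoc)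
    finally show "ksum n d X ?T $$ (i, j) = tomat ?N ?N (tp g * ?A * mp g) $$ (i, j)" using ij by simp
  qed (use ksum_carrier[OF l(1-3)] in \<open>auto simp: tomat_def\<close>)
  have "tomat ?N ?N (P * mp g) * ksum n d X ?T * tomat ?N ?N (tp g * Q) = tomat ?N ?N (P * (?e * ?A * ?e) * Q)"
    unfolding K tomat_mult by (simp add: mult.assoc)
  also have "\<dots> = 1\<^sub>m ?N" unfolding eA PQ tomat_pr ..
  finally have 1: "det (tomat ?N ?N (P * mp g) * ksum n d X ?T * tomat ?N ?N (tp g * Q)) = 1" by simp
  note cK = ksum_carrier[OF l(1-3)]
  have "det (tomat ?N ?N (P * mp g)) * det (ksum n d X ?T) * det (tomat ?N ?N (tp g * Q)) = 1"
    using 1 unfolding det_mult[OF mult_carrier_mat[OF tomat_carrier cK] tomat_carrier] det_mult[OF tomat_carrier cK] .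
  then have "det (ksum n d X ?T) \<noteq> 0" by auto
  then show ?thesis unfolding f_inv_def ksum_def .
qed

theorem theorem1p8:
  fixes n m :: nat
  assumes "infinite (UNIV :: 'a::field set)" and "n \<ge> 2" and "m \<ge> 1"
  shows "(\<forall>X :: 'a mat list. \<forall>d. X \<in> mat_tuples n m \<and> X \<notin> null_cone n m \<and> d \<ge> n - 1 \<longrightarrow>
            (\<exists>T \<in> mat_tuples d m. f_inv n d T X \<noteq> 0))
         \<and> \<delta> TYPE('a) n m \<le> n - 1
         \<and> \<gamma> TYPE('a) n m \<le> n * (n - 1)"
proof -
  have main: "\<exists>T \<in> mat_tuples d m. f_inv n d T X \<noteq> 0"
    if X: "X \<in> mat_tuples n m" "X \<notin> null_cone n m" and d: "d \<ge> n - 1" for X :: "'a mat list" and d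
  proof -
    have Xcc: "corner n n (frmat (X ! k))" if "k < m" for k
    proof -
      have Xk: "X ! k \<in> carrier_mat n n" using X(1) that by (auto simp: mat_tuples_def)
      show ?thesis using frmat_corner[OF Xk] by (simp add: corner_def)
    qed
    have ns: "\<not> shrunk n m (\<lambda>k. frmat (X ! k))" using shrunk_null_cone[OF assms(1) X(1)] X(2) by blast
    obtain T where T: "\<And>k. k < m \<Longrightarrow> corner d d (T k)" "rank_ge (blow m (\<lambda>k. frmat (X ! k)) T) (n * d)"
      using full_blowup[OF assms(1) Xcc ns assms(2) d] by blast
    show ?thesis
    proof
      show "f_inv n d (map (\<lambda>k. tomat d d (T k)) [0..<m]) X \<noteq> 0" by (rule f_inv_nonzero[OF X(1) T])
    qed (auto simp: mat_tuples_def)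
  qed
  have "\<delta> TYPE('a) n m \<le> n - 1"
    unfolding \<delta>_def
  proof (rule Least_le, intro conjI ballI)
    fix X :: "'a mat list" assume "X \<in> mat_tuples n m - null_cone n m"
    then obtain T where "T \<in> mat_tuples (n - 1) m" "f_inv n (n - 1) T X \<noteq> 0" using main[of X "n - 1"] by blast
    then show "\<exists>d T. 1 \<le> d \<and> d \<le> n - 1 \<and> T \<in> mat_tuples d m \<and> f_inv n d T X \<noteq> 0"
      using assms(2) by (intro exI[of _ "n - 1"] exI[of _ T]) auto
  qed (use assms(2) in simp)
  \<comment> \<open>A point outside the null cone is detected by some f_T of size
    \<open>n - 1\<close>, an invariant of degree \<open>n * (n - 1)\<close>, which is
    positive.\<close>
  moreover have "\<gamma> TYPE('a) n m \<le> n * (n - 1)"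
  proof -
    have pos: "1 \<le> n * (n - 1)" using assms(2) by (simp add: Suc_le_eq)
    have "X \<in> null_cone n m"
      if X: "X \<in> mat_tuples n m" "\<And>e f. 1 \<le> e \<Longrightarrow> e \<le> n * (n - 1) \<Longrightarrow> f \<in> invariants n m e \<Longrightarrow> f X = 0"
      for X :: "'a mat list"
    proof (rule ccontr)
      assume "X \<notin> null_cone n m"
      then obtain T where T: "T \<in> mat_tuples (n - 1) m" "f_inv n (n - 1) T X \<noteq> 0"
        using main[OF X(1), of "n - 1"] by blast
      show False using X(2)[OF pos order_refl f_inv_invariant[OF T(1)]] T(2) by simp
    qed
    then have eq: "{X \<in> mat_tuples n m. \<forall>e. 1 \<le> e \<and> e \<le> n * (n - 1) \<longrightarrow> (\<forall>f\<in>invariants n m e. f X = 0)}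
        = (null_cone n m :: 'a mat list set)"
      by (auto simp: null_cone_def)
    have "0 < n * (n - 1)" using pos by linarith
    then show ?thesis unfolding \<gamma>_def using eq by (intro Least_le conjI)
  qed
  ultimately show ?thesis using main by blast
qed

end
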